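(* Let $X(n)$, $n\ge 0$, the $\sigma$-algebras $\mathcal F_{kl}$, the function $F$, the functions $q_1,\dots,q_\ell$ and the processes $\Xi_i(t)$, $i=1,\dots,\ell$, and $\Xi(t)=\sum_{i=1}^\ell\Xi_i(t)$ be as in the context. With $d=(\ell-1)\wp$, suppose that there exist $p,q\ge 1$ and $\delta,m>0$ with $\delta<\kappa-\frac dp$ such that $$\sum_{n=0}^\infty n^\delta\varpi_{q,p}(n)<\infty,\qquad \sum_{r=0}^\infty (r\beta_q(r))^\delta<\infty,$$ $$\gamma_m<\infty,\qquad \gamma_{2q(\iota+2)}<\infty,\qquad \frac1{2+\delta}\ge\frac1p+\frac{\iota+2}{m}+\frac{\delta}{q}.$$ Let $\sigma_i\ge0$, $i=1,\dots,\ell$, be the constants for which $\Xi_i$ admits a strong approximation by $\sigma_i$ times a Brownian motion (as described in the context; they exist under these hypotheses). Then the following holds. (1) For each $i$ let $K_i$ be the compact set of absolutely continuous functions $x\in C[0,1]$ with $x(0)=0$ and $\int_0^1\dot x^2(u)\,du\le\sigma_i^2$, and set $\zeta_{i,t}(u)=(2t\ln\ln t)^{-1/2}\,\Xi_i(tu)$, $u\in[0,1]$. Then, almost surely, the family $\{\zeta_{i,t},\ t\ge3\}$ is relatively compact in the topology of uniform convergence and, as $t\to\infty$, the set of all limit points of $\zeta_{i,t}$ coincides with $K_i$. (2) Let $K$ be the compact set of functions $x\in C[0,1]$ which can be written in the form $x(u)=\sum_{1\le i\le\ell}x_i(u)$ with $x_i\in K_i$, $i=1,\dots,\ell$, and set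 $\zeta_t(u)=(2t\ln\ln t)^{-1/2}\,\Xi(tu)$, $u\in[0,1]$. Then, almost surely, the family $\{\zeta_t,\ t\ge3\}$ is relatively compact in the topology of uniform convergence and, as $t\to\infty$, the set of all limit points of $\zeta_t$ is contained in $K$.
   Context: **Process and $\sigma$-algebras.** $\{X(n),\ n=0,1,2,\dots\}$ is an $\mathbb R^{\wp}$-valued stochastic process on a probability space $(\Omega,\mathcal F,P)$. $\mathcal F_{kl}\subset\mathcal F$, $-\infty\le k\le l\le\infty$, is a family of $\sigma$-algebras with $\mathcal F_{kl}\subset\mathcal F_{k'l'}$ whenever $k'\le k$ and $l'\ge l$ (if given only for $k,l\ge0$, it is extended by $\mathcal F_{kl}=\mathcal F_{0l}$ for $k<0$, $l\ge 0$). Full stationarity is not assumed; it is only assumed that the distribution of $X(n)$ is a measure $\mu$ not depending on $n$, and that the joint distribution of $(X(n),X(n'))$ is a measure $\mu_{n-n'}$ depending only on $n-n'$. **Mixing and approximation coefficients.** $\|\cdot\|_r$ denotes the $L^r(\Omega,\mathcal F,P)$-norm. For sub-$\sigma$-algebras $\mathcal G,\mathcal H\subset\mathcal F$, $$\varpi_{q,p}(\mathcal G,\mathcal H)=\sup\{\|E[g|\mathcal G]-E[g]\|_p:\ g \text{ real-valued, } \mathcal H\text{-measurable},\ \|g\|_q\le 1\},$$ and $$\varpi_{q,p}(n)=\sup_{k\ge0}\varpi_{q,p}(\mathcal F_{-\infty,k},\mathcal F_{k+n,\infty}),\qquad \beta_p(n)=\sup_{m\ge0}\|X(m)-E(X(m)|\mathcal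 F_{m-n,m+n})\|_p.$$ For $\theta>0$, $\gamma_\theta$ is defined by $\gamma_\theta^\theta=E|X(n)|^\theta=\int|x|^\theta d\mu(x)$. **The function $F$.** $F=F(x_1,\dots,x_\ell)$, $x_j\in\mathbb R^\wp$, is a real function on $\mathbb R^{\wp\ell}$ such that for some $\iota,K_0>0$, $\kappa\in(0,1]$ and all $x_i,y_i\in\mathbb R^\wp$, $$|F(x_1,\dots,x_\ell)-F(y_1,\dots,y_\ell)|\le K_0\Big(1+\sum_{j=1}^\ell|x_j|^\iota+\sum_{j=1}^\ell|y_j|^\iota\Big)\sum_{j=1}^\ell|x_j-y_j|^\kappa,$$ $$|F(x_1,\dots,x_\ell)|\le K_0\Big(1+\sum_{j=1}^\ell|x_j|^\iota\Big),$$ and $F$ is centered: $\int F(x_1,\dots,x_\ell)\,d\mu(x_1)\cdots d\mu(x_\ell)=0$. **The functions $q_i$.** $q_1(n)<q_2(n)<\dots<q_\ell(n)$ are increasing positive functions taking integer values on integers, the first $k$ of which are $q_j(n)=jn$, $j\le k$. For $k+1\le i\le\ell$, $q_i(n+1)-q_i(n)\ge n^{\delta_0}$ for some $\delta_0>0$ and all $n\ge2$. For $k\le i\le \ell-1$ and every $\epsilon>0$, $\liminf_{n\to\infty}(q_{i+1}(\epsilon n)-q_i(n))>0$. **The processes $\Xi_i$ and $\Xi$.** For $i<\ell$ put $$F_i(x_1,\dots,x_i)=\int F(x_1,\dots,x_\ell)\,d\mu(x_{i+1})\cdots d\mu(x_\ell)-\int F(x_1,\dots,x_\ell)\,d\mu(x_i)\cdots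 d\mu(x_\ell),$$ and $F_\ell(x_1,\dots,x_\ell)=F(x_1,\dots,x_\ell)-\int F(x_1,\dots,x_\ell)\,d\mu(x_\ell)$, so that $F=F_1+\dots+F_\ell$. For $1\le i\le\ell$ and $t\ge0$, $$\Xi_i(t)=\sum_{1\le n\le t}F_i\big(X(q_1(n)),\dots,X(q_i(n))\big),\qquad \Xi(t)=\sum_{i=1}^\ell\Xi_i(t).$$ **The constants $\sigma_i$.** $\sigma_i\ge0$ is the constant such that, for some $\alpha>0$, on some probability space there are a process with the same distribution as $\{\Xi_i(t),t\ge0\}$ (still denoted $\Xi_i$) and a standard one-dimensional Brownian motion $B_i$ with $\limsup_{t\to\infty}|\Xi_i(t)-\sigma_iB_i(t)|\,t^{-(\frac12-\alpha)}<\infty$ almost surely.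
   Formalization: Relative compactness of {ζ_t, t≥3} is stated as relative compactness of {ζ_{τ_n}} for every real sequence τ_n≥3 with τ_n→∞; for all real t≥3 it fails in the uniform topology, since ζ_t is a step function whose jump at u=1/t moves with t (e.g. i.i.d. ±1, ℓ=1). *)

theory Defs
  imports "HOL-Probability.Probability" "HOL-Library.Extended"
begin

section \<open>Mixing and approximation coefficients\<close>

text \<open>Norms and coefficients take values in \<^typ>\<open>ennreal\<close>, so that suprema and series always exist.
  Powers \<open>x\<^sup>a\<close> are only used for \<open>a > 0\<close>.\<close>

definition epowr :: "ennreal \<Rightarrow> real \<Rightarrow> ennreal" where
  "epowr x a = (if x = \<top> then \<top> else ennreal (enn2real x powr a))"

definition Lnorm :: "'a measure \<Rightarrow> real \<Rightarrow> ('a \<Rightarrow> 'b::real_normed_vector) \<Rightarrow> ennreal" where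
  "Lnorm M r f = epowr (\<integral>\<^sup>+ \<omega>. ennreal (norm (f \<omega>) powr r) \<partial>M) (1 / r)"

definition mixing :: "'a measure \<Rightarrow> real \<Rightarrow> real \<Rightarrow> 'a measure \<Rightarrow> 'a measure \<Rightarrow> ennreal" where
  "mixing M q p G H =
    (SUP g \<in> {g \<in> borel_measurable H. Lnorm M q g \<le> 1}.
       Lnorm M p (\<lambda>\<omega>. real_cond_exp M G g \<omega> - (\<integral>\<omega>'. g \<omega>' \<partial>M)))"

text \<open>The family of \<open>\<sigma>\<close>-algebras is indexed by integers extended by \<open>-\<infinity>\<close> (\<^const>\<open>Minf\<close>)
  and \<open>\<infinity>\<close> (\<^const>\<open>Pinf\<close>).\<close>

definition mixing_coeff ::
  "'a measure \<Rightarrow> (int extended \<Rightarrow> int extended \<Rightarrow> 'a measure) \<Rightarrow> real \<Rightarrow> real \<Rightarrow> nat \<Rightarrow> ennreal" where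
  "mixing_coeff M Fs q p n =
    (SUP k::nat. mixing M q p (Fs Minf (Fin (int k))) (Fs (Fin (int k + int n)) Pinf))"

definition vec_cond_exp ::
  "'a measure \<Rightarrow> 'a measure \<Rightarrow> ('a \<Rightarrow> real^'p) \<Rightarrow> 'a \<Rightarrow> real^'p" where
  "vec_cond_exp M G Y \<omega> = (\<chi> j. real_cond_exp M G (\<lambda>\<omega>'. Y \<omega>' $ j) \<omega>)"

definition approx_coeff ::
  "'a measure \<Rightarrow> (int extended \<Rightarrow> int extended \<Rightarrow> 'a measure) \<Rightarrow> (nat \<Rightarrow> 'a \<Rightarrow> real^'p)
    \<Rightarrow> real \<Rightarrow> nat \<Rightarrow> ennreal" where
  "approx_coeff M Fs X p n =
    (SUP m::nat. Lnorm M p (\<lambda>\<omega>. X m \<omega> -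
       vec_cond_exp M (Fs (Fin (int m - int n)) (Fin (int m + int n))) (X m) \<omega>))"

definition moment_norm :: "(real^'p) measure \<Rightarrow> real \<Rightarrow> ennreal" where
  "moment_norm \<mu> \<theta> = Lnorm \<mu> \<theta> (\<lambda>x. x)"


section \<open>The nonconventional sums\<close>

text \<open>A function of \<open>(x\<^sub>1, \<dots>, x\<^sub>l)\<close> is a function of \<open>x :: nat \<Rightarrow> real^'p\<close> that depends only on
  \<open>x j\<close> for \<open>1 \<le> j \<le> l\<close>. In \<open>partial_int\<close> the variables \<open>x\<^sub>i\<^sub>+\<^sub>1, \<dots>, x\<^sub>l\<close> are integrated out;
  the case \<open>i = l\<close> is \<open>F\<close> itself, since the empty product measure is a point mass.
  So \<open>F_part\<close> covers both \<open>i < l\<close> and \<open>i = l\<close>.\<close>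

definition partial_int ::
  "nat \<Rightarrow> (real^'p) measure \<Rightarrow> ((nat \<Rightarrow> real^'p) \<Rightarrow> real) \<Rightarrow> nat \<Rightarrow> (nat \<Rightarrow> real^'p) \<Rightarrow> real" where
  "partial_int l \<mu> F i x =
    (\<integral>y. F (\<lambda>j. if j \<in> {Suc i..l} then y j else x j) \<partial>(Pi\<^sub>M {Suc i..l} (\<lambda>_. \<mu>)))"

definition F_part ::
  "nat \<Rightarrow> (real^'p) measure \<Rightarrow> ((nat \<Rightarrow> real^'p) \<Rightarrow> real) \<Rightarrow> nat \<Rightarrow> (nat \<Rightarrow> real^'p) \<Rightarrow> real" where
  "F_part l \<mu> F i x = partial_int l \<mu> F i x - partial_int l \<mu> F (i - 1) x"

text \<open>The functions \<open>q\<^sub>j\<close> have real arguments and values, but \<open>q\<^sub>j n\<close> is a positive integer for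
  \<open>n = 1, 2, \<dots>\<close>.\<close>

definition Xi_part ::
  "nat \<Rightarrow> (real^'p) measure \<Rightarrow> ((nat \<Rightarrow> real^'p) \<Rightarrow> real) \<Rightarrow> (nat \<Rightarrow> 'a \<Rightarrow> real^'p)
    \<Rightarrow> (nat \<Rightarrow> real \<Rightarrow> real) \<Rightarrow> nat \<Rightarrow> real \<Rightarrow> 'a \<Rightarrow> real" where
  "Xi_part l \<mu> F X qs i t \<omega> =
    (\<Sum>n | 1 \<le> n \<and> real n \<le> t. F_part l \<mu> F i (\<lambda>j. X (nat \<lfloor>qs j (real n)\<rfloor>) \<omega>))"

definition Xi ::
  "nat \<Rightarrow> (real^'p) measure \<Rightarrow> ((nat \<Rightarrow> real^'p) \<Rightarrow> real) \<Rightarrow> (nat \<Rightarrow> 'a \<Rightarrow> real^'p)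
    \<Rightarrow> (nat \<Rightarrow> real \<Rightarrow> real) \<Rightarrow> real \<Rightarrow> 'a \<Rightarrow> real" where
  "Xi l \<mu> F X qs t \<omega> = (\<Sum>i=1..l. Xi_part l \<mu> F X qs i t \<omega>)"


section \<open>Strong approximation by Brownian motion\<close>

definition std_brownian_motion :: "'b measure \<Rightarrow> (real \<Rightarrow> 'b \<Rightarrow> real) \<Rightarrow> bool" where
  "std_brownian_motion N B \<longleftrightarrow>
     prob_space N \<and>
     (\<forall>t\<ge>0. B t \<in> borel_measurable N) \<and>
     (AE \<omega> in N. B 0 \<omega> = 0) \<and>
     (\<forall>(n::nat) t. 0 \<le> t 0 \<and> (\<forall>i<n. t i \<le> t (Suc i)) \<longrightarrow>
        prob_space.indep_vars N (\<lambda>_. borel) (\<lambda>i \<omega>. B (t (Suc i)) \<omega> - B (t i) \<omega>) {..<n}) \<and>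
     (\<forall>s t. 0 \<le> s \<and> s < t \<longrightarrow>
        distributed N lborel (\<lambda>\<omega>. B t \<omega> - B s \<omega>) (normal_density 0 (sqrt (t - s)))) \<and>
     (AE \<omega> in N. continuous_on {0..} (\<lambda>t. B t \<omega>))"

definition same_law ::
  "'a measure \<Rightarrow> (real \<Rightarrow> 'a \<Rightarrow> real) \<Rightarrow> 'b measure \<Rightarrow> (real \<Rightarrow> 'b \<Rightarrow> real) \<Rightarrow> bool" where
  "same_law M Z N Y \<longleftrightarrow>
     (\<forall>t\<ge>0. Z t \<in> borel_measurable M) \<and> (\<forall>t\<ge>0. Y t \<in> borel_measurable N) \<and>
     distr M (Pi\<^sub>M {0..} (\<lambda>_. borel)) (\<lambda>\<omega>. \<lambda>t\<in>{0..}. Z t \<omega>) =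
     distr N (Pi\<^sub>M {0..} (\<lambda>_. borel)) (\<lambda>\<omega>. \<lambda>t\<in>{0..}. Y t \<omega>)"

text \<open>The type \<open>'b\<close> carries the auxiliary probability space. It is an argument because HOL cannot
  quantify over types; as a hypothesis with \<open>'b\<close> free, the predicate ranges over all of them.\<close>

definition strong_approx ::
  "'b itself \<Rightarrow> 'a measure \<Rightarrow> (real \<Rightarrow> 'a \<Rightarrow> real) \<Rightarrow> real \<Rightarrow> bool" where
  "strong_approx TYPE('b) M Z s \<longleftrightarrow>
     (\<exists>\<alpha>>0. \<exists>(N::'b measure) Y B.
        std_brownian_motion N B \<and> same_law M Z N Y \<and>
        (AE \<omega> in N. Limsup at_top
           (\<lambda>t. ereal (\<bar>Y t \<omega> - s * B t \<omega>\<bar> * t powr (- (1/2 - \<alpha>)))) < \<infinity>))"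


section \<open>Strassen's limit sets\<close>

text \<open>The uniform topology on the bounded functions on \<open>[0,1]\<close>, represented as functions that are
  \<^const>\<open>undefined\<close> outside \<open>[0,1]\<close>. It contains \<open>C[0,1]\<close>, but also the \<open>zeta\<close> below,
  which are step functions.\<close>

definition unif_top :: "(real \<Rightarrow> real) topology" where
  "unif_top = mtopology_of (funspace {0..1} euclidean_metric)"

definition abs_continuous_01 :: "(real \<Rightarrow> real) \<Rightarrow> bool" where
  "abs_continuous_01 x \<longleftrightarrow>
     (\<forall>\<epsilon>>0. \<exists>\<eta>>0. \<forall>(n::nat) a b.
        (\<forall>i<n. 0 \<le> a i \<and> a i \<le> b i \<and> b i \<le> 1) \<and>
        disjoint_family_on (\<lambda>i. {a i<..<b i}) {..<n} \<and> (\<Sum>i<n. b i - a i) < \<eta>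
        \<longrightarrow> (\<Sum>i<n. \<bar>x (b i) - x (a i)\<bar>) < \<epsilon>)"

definition strassen_set :: "real \<Rightarrow> (real \<Rightarrow> real) set" where
  "strassen_set s = {x. x \<in> extensional {0..1} \<and> abs_continuous_01 x \<and> x 0 = 0 \<and>
     (\<integral>\<^sup>+u\<in>{0..1}. ennreal ((deriv x u)\<^sup>2) \<partial>lborel) \<le> ennreal (s\<^sup>2)}"

definition strassen_sum_set :: "nat \<Rightarrow> (nat \<Rightarrow> real) \<Rightarrow> (real \<Rightarrow> real) set" where
  "strassen_sum_set l \<sigma> = {x. \<exists>xs. (\<forall>i\<in>{1..l}. xs i \<in> strassen_set (\<sigma> i)) \<and>
     x = (\<lambda>u\<in>{0..1}. \<Sum>i=1..l. xs i u)}"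

definition zeta :: "(real \<Rightarrow> 'a \<Rightarrow> real) \<Rightarrow> 'a \<Rightarrow> real \<Rightarrow> real \<Rightarrow> real" where
  "zeta Z \<omega> t = (\<lambda>u\<in>{0..1}. (2 * t * ln (ln t)) powr (-1/2) * Z (t * u) \<omega>)"

definition relatively_compactin :: "'a topology \<Rightarrow> 'a set \<Rightarrow> bool" where
  "relatively_compactin T S \<longleftrightarrow> S \<subseteq> topspace T \<and> compactin T (T closure_of S)"

text \<open>Relative compactness of a family \<open>(f\<^sub>t)\<close>, \<open>t \<ge> 3\<close>, as \<open>t \<rightarrow> \<infinity>\<close>. For \<open>f = zeta Z \<omega>\<close>
  with \<open>Z\<close> a step process, the whole set \<open>{f\<^sub>t | t \<ge> 3}\<close> is in general not relatively compact in
  the uniform topology, because the jump at \<open>u = n/t\<close> moves with \<open>t\<close>: already for \<open>t\<close> in a bounded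
  interval the distances between different \<open>f\<^sub>t\<close> are bounded away from \<open>0\<close>. The compactness
  assertion concerns every sequence of parameters tending to infinity, for instance
  \<open>t = 3, 4, 5, \<dots>\<close>.\<close>

definition rel_compact_family :: "'b topology \<Rightarrow> (real \<Rightarrow> 'b) \<Rightarrow> bool" where
  "rel_compact_family T f \<longleftrightarrow>
     (\<forall>\<tau>. (\<forall>n::nat. 3 \<le> \<tau> n) \<and> filterlim \<tau> at_top sequentially \<longrightarrow>
        relatively_compactin T (range (\<lambda>n. f (\<tau> n))))"

definition limit_points :: "'b topology \<Rightarrow> (real \<Rightarrow> 'b) \<Rightarrow> 'b set" where
  "limit_points T f = {x. \<exists>\<tau>. (\<forall>n::nat. 3 \<le> \<tau> n) \<and> filterlim \<tau> at_top sequentially \<and>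
     limitin T (\<lambda>n. f (\<tau> n)) x sequentially}"

end

theory Submission
  imports Defs "HOL-Real_Asymp.Real_Asymp"
begin

text \<open>
  The almost sure approximation of a rescaled Brownian motion reduces both parts to Strassen's
  law for Brownian motion. The approximation lives on another probability space, so the law has
  to be transferred through equality of distributions. It is therefore split into three
  properties of a path, each measurable in countably many coordinates: a modulus of continuity at
  dyadic scales, an upper bound for the energy of the increments along slowly growing times, and
  the approximation of prescribed increment vectors along the times \<open>r ^ j\<close>. For Brownian motion
  they follow from Gaussian tail bounds and the two Borel--Cantelli lemmas; chaining over dyadic
  intervals replaces maximal inequalities.

  The limit set is described by Riesz's condition: \<open>r\<close> times the sum of the squared increments
  over any partition of the unit interval into \<open>r\<close> equal parts is at most \<open>\<sigma>\<^sup>2\<close>. This needs the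
  differentiability almost everywhere of an absolutely continuous function and the
  fundamental theorem of calculus for it. Part (2) then follows from compactness of the sets
  in part (1).
\<close>

section \<open>Almost everywhere differentiability and absolutely continuous functions\<close>

text \<open>An event of the path space over \<open>{0..}\<close> depends on countably many
  coordinates, so a statement about all limit points of a family indexed by real \<open>t\<close>
  cannot be carried from one probability space to another as it stands. Hence every quantifier in
  the three path properties ranges over a countable set, and all that leads from them to the limit
  set is deterministic. Integer times suffice for the modulus because the sums are constant between
  integers. Riesz's condition is the link: for fixed \<open>r\<close> it involves finitely many
  values, so it survives pointwise limits, and for Brownian motion on \<open>[0, T]\<close> it
  concerns \<open>T\<close> times a chi-squared variable with \<open>r\<close> degrees of freedom.
  Its tail makes the probability of exceeding \<open>1 + e\<close> times the square of
  \<open>lil_scale T\<close> at most a constant times a power of \<open>ln T\<close> with exponent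
  below -1, whatever \<open>r\<close> is. In the opposite direction a box of increments is hit with
  probability at least \<open>1 / ln T\<close>, which along \<open>T = r ^ j\<close> is the harmonic
  series up to a factor.\<close>

definition interval_families :: "real \<Rightarrow> real \<Rightarrow> (real \<times> real) set set" where
  "interval_families a b = {D. finite D \<and> (\<forall>(s, t)\<in>D. a \<le> s \<and> s < t \<and> t \<le> b) \<and>
     pairwise (\<lambda>I J. snd I \<le> fst J \<or> snd J \<le> fst I) D}"

text \<open>The gaps between the intervals only add to the growth of \<open>W\<close>; neighbouring
  intervals may touch. Removing the interval with the largest right endpoint leaves a family to the
  left of it, so the induction varies the right end of the ambient interval.\<close>

lemma sum_increments_le:
  fixes W :: "real \<Rightarrow> real"
  assumes D: "D \<in> interval_families a b" and "a \<le> b" and W: "mono_on {a..b} W"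
  shows "(\<Sum>(s, t)\<in>D. W t - W s) \<le> W b - W a"
proof -
  have "finite D" using D by (auto simp: interval_families_def)
  then have "\<forall>b'. D \<in> interval_families a b' \<and> a \<le> b' \<and> b' \<le> b \<longrightarrow> (\<Sum>(s, t)\<in>D. W t - W s) \<le> W b' - W a"
  proof (induction D rule: finite_ranking_induct[where f = snd])
    case empty
    then show ?case using W \<open>a \<le> b\<close> by (auto intro!: mono_onD[OF W])
  next
    case (insert I D)
    show ?case
    \<comment> \<open>The ranking induction may insert an element that is already present.\<close>
    proof (cases "I \<in> D")
      case True
      then show ?thesis using insert.IH by (simp add: insert_absorb)
    next
      case False
      show ?thesis
      proof (intro allI impI, elim conjE)
        fix b' assume ins: "insert I D \<in> interval_families a b'" and b': "a \<le> b'" "b' \<le> b"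
        obtain s t where I: "I = (s, t)" by force
        have st: "a \<le> s" "s < t" "t \<le> b'" using ins by (auto simp: interval_families_def I)
        have "snd J \<le> s" if "J \<in> D" for J
        proof -
          have "I \<noteq> J" using False that by auto
          then have "snd I \<le> fst J \<or> snd J \<le> fst I"
            using ins that by (auto simp: interval_families_def pairwise_insert)
          moreover have "fst J < snd J" using ins that by (auto simp: interval_families_def)
          moreover have "snd J \<le> snd I" using insert.hyps that by auto
          ultimately show ?thesis by (auto simp: I)
        qed
        then have "D \<in> interval_families a s"
          using ins by (force simp: interval_families_def pairwise_insert)
        then have "(\<Sum>(s, t)\<in>D. W t - W s) \<le> W s - W a"
          using insert.IH st b' by auto
        moreover have "W t \<le> W b'" using st b' by (intro mono_onD[OF W]) auto
        ultimately show "(\<Sum>(s, t)\<in>insert I D. W t - W s) \<le> W b' - W a"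
          using False insert.hyps I by auto
      qed
    qed
  qed
  then show ?thesis using D \<open>a \<le> b\<close> by auto
qed

text \<open>Covering with factor 5: a countable disjoint subfamily, with its radii enlarged five
  times, covers all of \<open>\<I>\<close>. Its finite parts \<open>Cn n\<close> are interval
  families, so each has total length at most \<open>K\<close>, and continuity from below passes to
  the union. The conclusion gives a Borel superset because \<open>E\<close> itself is not known to
  be measurable.\<close>

lemma Vitali_cover_emeasure:
  fixes L K :: real
  assumes "\<And>s t. (s, t) \<in> \<I> \<Longrightarrow> a \<le> s \<and> s < t \<and> t \<le> b"
    and "\<And>D. D \<subseteq> \<I> \<Longrightarrow> D \<in> interval_families a b \<Longrightarrow> (\<Sum>(s, t)\<in>D. t - s) \<le> K"
    and E: "\<And>u. u \<in> E \<Longrightarrow> \<exists>(s, t)\<in>\<I>. s \<le> u \<and> u \<le> t"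
  shows "\<exists>U\<in>sets borel. E \<subseteq> U \<and> emeasure lborel U \<le> ennreal (5 * K)"
proof -
  have K0: "0 \<le> K" using assms(2)[of "{}"] by (auto simp: interval_families_def)
  define c where "c I = (fst I + snd I) / 2" for I :: "real \<times> real"
  define r where "r I = (snd I - fst I) / 2" for I :: "real \<times> real"
  have r: "0 < r I \<and> r I \<le> b - a" if "I \<in> \<I>" for I
    using assms(1)[of "fst I" "snd I"] that unfolding r_def by auto
  have cb: "cball (c I) (r I) = {fst I..snd I}" for I
    by (auto simp: cball_eq_atLeastAtMost c_def r_def field_simps)
  obtain C where C: "countable C" "C \<subseteq> \<I>"
     "pairwise (\<lambda>i j. disjnt (cball (c i) (r i)) (cball (c j) (r j))) C"
     "\<And>i. i \<in> \<I> \<Longrightarrow> \<exists>j. j \<in> C \<and> \<not> disjnt (cball (c i) (r i)) (cball (c j) (r j)) \<and>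
                        cball (c i) (r i) \<subseteq> ball (c j) (5 * r j)"
  proof (rule Vitali_covering_lemma_cballs_balls[of \<I> r "b - a" c])
    show "0 < r I \<and> r I \<le> b - a" if "I \<in> \<I>" for I using r that .
  qed (rule that)
  define U where "U = (\<Union>I\<in>C. ball (c I) (5 * r I))"
  have "E \<subseteq> U"
  proof
    fix u assume "u \<in> E"
    then obtain s t where st: "(s, t) \<in> \<I>" "s \<le> u" "u \<le> t" using E by blast
    then have "u \<in> cball (c (s, t)) (r (s, t))" unfolding cb by auto
    then show "u \<in> U" using C(4)[OF st(1)] unfolding U_def by blast
  qed
  moreover have "U \<in> sets borel" unfolding U_def by (intro borel_open open_UN) auto
  moreover have "emeasure lborel U \<le> ennreal (5 * K)"
  proof -
    define Cn where "Cn n = {I \<in> C. to_nat_on C I < n}" for n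
    define V where "V n = (\<Union>I\<in>Cn n. ball (c I) (5 * r I))" for n
    have fin: "finite (Cn n)" for n
    proof -
      have "inj_on (to_nat_on C) (Cn n)"
        using inj_on_to_nat_on[OF C(1)] by (rule inj_on_subset) (auto simp: Cn_def)
      moreover have "to_nat_on C ` Cn n \<subseteq> {..<n}" by (auto simp: Cn_def)
      ultimately show ?thesis using finite_imageD finite_subset by blast
    qed
    have "U = (\<Union>n. V n)" by (auto simp: U_def V_def Cn_def)
    then have "emeasure lborel U = (SUP n. emeasure lborel (V n))"
      by (subst SUP_emeasure_incseq) (auto simp: incseq_def V_def Cn_def intro!: borel_open)
    also have "\<dots> \<le> ennreal (5 * K)"
    proof (rule SUP_least)
      fix n
      have Cn: "Cn n \<in> interval_families a b"
        unfolding interval_families_def mem_Collect_eq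
      proof (intro conjI)
        show "\<forall>(s, t)\<in>Cn n. a \<le> s \<and> s < t \<and> t \<le> b" using C(2) assms(1) by (auto simp: Cn_def)
        show "pairwise (\<lambda>I J. snd I \<le> fst J \<or> snd J \<le> fst I) (Cn n)"
        proof (rule pairwiseI)
          fix I J assume IJ: "I \<in> Cn n" "J \<in> Cn n" "I \<noteq> J"
          then have "disjnt {fst I..snd I} {fst J..snd J}"
            using C(3) unfolding pairwise_def cb by (auto simp: Cn_def)
          moreover have "fst I < snd I" "fst J < snd J" using IJ C(2) assms(1) by (auto simp: Cn_def)
          moreover have "\<not> (max (fst I) (fst J) \<in> {fst I..snd I} \<and> max (fst I) (fst J) \<in> {fst J..snd J})"
            using \<open>disjnt _ _\<close> unfolding disjnt_iff by blast
          ultimately show "snd I \<le> fst J \<or> snd J \<le> fst I"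
            by (auto simp: max_def split: if_splits)
        qed
      qed (rule fin)
      have "emeasure lborel (V n) \<le> (\<Sum>I\<in>Cn n. emeasure lborel (ball (c I) (5 * r I)))"
        unfolding V_def using fin by (intro emeasure_subadditive_finite) auto
      also have "\<dots> = (\<Sum>I\<in>Cn n. ennreal (5 * (snd I - fst I)))"
      proof (rule sum.cong[OF refl])
        fix I assume "I \<in> Cn n"
        then have "I \<in> \<I>" using C(2) by (auto simp: Cn_def)
        then have "0 < r I" using r by blast
        then show "emeasure lborel (ball (c I) (5 * r I)) = ennreal (5 * (snd I - fst I))"
          by (simp add: ball_eq_greaterThanLessThan r_def field_simps)
      qed
      also have "\<dots> = ennreal (\<Sum>I\<in>Cn n. 5 * (snd I - fst I))"
      proof (rule sum_ennreal)
        fix I assume "I \<in> Cn n"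
        then have "I \<in> \<I>" using C(2) by (auto simp: Cn_def)
        then have "0 < r I" using r by blast
        then show "0 \<le> 5 * (snd I - fst I)" by (simp add: r_def)
      qed
      also have "\<dots> \<le> ennreal (5 * K)"
      proof (rule ennreal_leI)
        have "Cn n \<subseteq> \<I>" using C(2) by (auto simp: Cn_def)
        then have "(\<Sum>I\<in>Cn n. snd I - fst I) \<le> K"
          using assms(2)[OF _ Cn] by (simp add: case_prod_beta)
        then show "(\<Sum>I\<in>Cn n. 5 * (snd I - fst I)) \<le> 5 * K"
          unfolding sum_distrib_left[symmetric] by simp
      qed
      finally show "emeasure lborel (V n) \<le> ennreal (5 * K)" .
    qed
    finally show ?thesis .
  qed
  ultimately show ?thesis by blast
qed


text \<open>Disjoint intervals on which \<open>W\<close> climbs at rate \<open>c\<close> or more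
  together use up at most \<open>W b - W a\<close>, which bounds their total length by
  \<open>(W b - W a) / c\<close>. Small measure comes from a \<open>W\<close> with little growth or
  from a large \<open>c\<close>.\<close>

lemma monotone_cover_emeasure:
  fixes W :: "real \<Rightarrow> real"
  assumes ab: "a \<le> b" and "0 < c" and W: "mono_on {a..b} W"
    and I: "\<And>s t. (s, t) \<in> \<I> \<Longrightarrow> a \<le> s \<and> s < t \<and> t \<le> b \<and> c * (t - s) \<le> W t - W s"
    and E: "\<And>u. u \<in> E \<Longrightarrow> \<exists>(s, t)\<in>\<I>. s \<le> u \<and> u \<le> t"
  shows "\<exists>U\<in>sets borel. E \<subseteq> U \<and> emeasure lborel U \<le> ennreal (5 * ((W b - W a) / c))"
proof -
  have "(\<Sum>(s, t)\<in>D. t - s) \<le> (W b - W a) / c" if D: "D \<subseteq> \<I>" "D \<in> interval_families a b" for D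
  proof -
    have "c * (\<Sum>(s, t)\<in>D. t - s) \<le> (\<Sum>(s, t)\<in>D. W t - W s)"
      unfolding sum_distrib_left using I D(1) by (intro sum_mono) auto
    also have "\<dots> \<le> W b - W a" by (rule sum_increments_le[OF D(2) ab W])
    finally show ?thesis using \<open>0 < c\<close> by (simp add: field_simps)
  qed
  then show ?thesis
    by (rule Vitali_cover_emeasure[of \<I> a b _ E, rotated]) (use I E in auto)
qed

lemma negligible_borel_outer:
  fixes E :: "real set"
  assumes "\<And>e. 0 < e \<Longrightarrow> \<exists>U\<in>sets borel. E \<subseteq> U \<and> emeasure lborel U \<le> ennreal e"
  shows "negligible E"
  unfolding negligible_outer_le
proof (intro allI impI)
  fix e :: real assume e: "0 < e"
  then obtain U where U: "U \<in> sets borel" "E \<subseteq> U" "emeasure lborel U \<le> ennreal e"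
    using assms by blast
  then have eq: "emeasure lebesgue U = emeasure lborel U" by simp
  have "emeasure lborel U < \<infinity>" using U(3) by (rule le_less_trans) simp
  then have "U \<in> lmeasurable" using U(1) eq by (auto simp: fmeasurable_def)
  moreover have "measure lebesgue U \<le> e"
    using U(3) e eq by (simp add: measure_def enn2real_leI)
  ultimately show "\<exists>T. E \<subseteq> T \<and> T \<in> lmeasurable \<and> measure lebesgue T \<le> e"
    using U(2) by blast
qed

section \<open>Total variation and differentiability almost everywhere\<close>

definition variation_sum :: "(real \<Rightarrow> real) \<Rightarrow> (real \<times> real) set \<Rightarrow> real" where
  "variation_sum f D = (\<Sum>(s, t)\<in>D. \<bar>f t - f s\<bar>)"

text \<open>The witness is the total variation of \<open>f\<close> on \<open>{a..t}\<close>. Adding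
  the interval \<open>(s, t)\<close> to a family that ends at \<open>s\<close> gives the first
  property; a family close to the supremum gives the second.\<close>

lemma variation_function:
  fixes f :: "real \<Rightarrow> real"
  assumes ab: "a \<le> b" and B: "\<And>D. D \<in> interval_families a b \<Longrightarrow> variation_sum f D \<le> B"
  obtains W where "\<And>s t. a \<le> s \<Longrightarrow> s \<le> t \<Longrightarrow> t \<le> b \<Longrightarrow> \<bar>f t - f s\<bar> \<le> W t - W s"
    and "\<And>e. 0 < e \<Longrightarrow> \<exists>D\<in>interval_families a b. W b - W a - e < variation_sum f D"
proof -
  define W where "W t = (SUP D\<in>interval_families a t. variation_sum f D)" for t
  have emp: "{} \<in> interval_families a t" for t by (auto simp: interval_families_def)
  have sub: "interval_families a s \<subseteq> interval_families a t" if "s \<le> t" for s t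
    using that by (force simp: interval_families_def)
  have bdd: "bdd_above (variation_sum f ` interval_families a t)" if "t \<le> b" for t
    using sub[OF that] B by (intro bdd_aboveI2[where M = B]) auto
  have fam_a: "interval_families a a = {{}}"
    by (force simp: interval_families_def)
  have Wa: "W a = 0" unfolding W_def fam_a by (simp add: variation_sum_def)
  have "\<bar>f t - f s\<bar> \<le> W t - W s" if st: "a \<le> s" "s \<le> t" "t \<le> b" for s t
  proof (cases "s = t")
    case False
    have "W s \<le> W t - \<bar>f t - f s\<bar>"
      unfolding W_def[of s]
    proof (rule cSUP_least)
      show "interval_families a s \<noteq> {}" using emp by auto
      fix D assume D: "D \<in> interval_families a s"
      then have fin: "finite D" and notin: "(s, t) \<notin> D" by (auto simp: interval_families_def)
      have "insert (s, t) D \<in> interval_families a t"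
        using D st False by (fastforce simp: interval_families_def pairwise_insert)
      then have "variation_sum f (insert (s, t) D) \<le> W t"
        unfolding W_def using bdd[OF st(3)] by (rule cSUP_upper)
      then show "variation_sum f D \<le> W t - \<bar>f t - f s\<bar>"
        using fin notin by (simp add: variation_sum_def)
    qed
    then show ?thesis by simp
  qed simp
  moreover have "\<exists>D\<in>interval_families a b. W b - W a - e < variation_sum f D" if "0 < e" for e
  proof -
    have "W b - e < W b" using that by simp
    have "interval_families a b \<noteq> {}" using emp by blast
    from less_cSUP_iff[OF this bdd[OF order_refl], of "W b - e"] \<open>W b - e < W b\<close>
    show ?thesis by (simp add: Wa flip: W_def)
  qed
  ultimately show ?thesis using that by blast
qed

text \<open>
  On an interval of a family whose variation is within \<open>\<epsilon>\<close> of the supremum, the steps against the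
  direction of \<open>g\<close> contribute at most the deficit of that interval; the Vitali covering
  lemma turns this into a bound for the measure of the exceptional set.
\<close>

lemma negligible_steep_both_ways:
  fixes g :: "real \<Rightarrow> real"
  assumes ab: "a \<le> b" and B: "\<And>D. D \<in> interval_families a b \<Longrightarrow> variation_sum g D \<le> B"
    and c: "0 < c"
  shows "negligible {u\<in>{a<..<b}. \<forall>\<delta>>0.
     (\<exists>s t. s \<le> u \<and> u \<le> t \<and> s < t \<and> t - s < \<delta> \<and> c * (t - s) < g t - g s) \<and>
     (\<exists>s t. s \<le> u \<and> u \<le> t \<and> s < t \<and> t - s < \<delta> \<and> g t - g s < - (c * (t - s)))}"
    (is "negligible ?E")
proof (rule negligible_borel_outer)
  fix e :: real assume "0 < e"
  \<comment> \<open>Two exceptional pieces of outer measure at most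
    \<open>5 * (\<epsilon> / c)\<close> each make up \<open>e\<close>.\<close>
  define \<epsilon> where "\<epsilon> = e * c / 10"
  have eps: "0 < \<epsilon>" using \<open>0 < e\<close> c by (simp add: \<epsilon>_def)
  obtain W where W: "\<And>s t. a \<le> s \<Longrightarrow> s \<le> t \<Longrightarrow> t \<le> b \<Longrightarrow> \<bar>g t - g s\<bar> \<le> W t - W s"
    and W2: "\<And>e. 0 < e \<Longrightarrow> \<exists>D\<in>interval_families a b. W b - W a - e < variation_sum g D"
    using variation_function[OF ab B] by blast
  have monoW: "mono_on {a..b} W"
  proof (rule mono_onI)
    fix s t assume "s \<in> {a..b}" "t \<in> {a..b}" "s \<le> t"
    then show "W s \<le> W t" using W[of s t] abs_ge_zero[of "g t - g s"] by auto
  qed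
  obtain D where D: "D \<in> interval_families a b" and near: "W b - W a - \<epsilon> < variation_sum g D"
    using W2[OF eps] by blast
  have Dab: "a \<le> s" "s < t" "t \<le> b" if "(s, t) \<in> D" for s t
    using D that by (auto simp: interval_families_def)
  have finD: "finite D" using D by (auto simp: interval_families_def)
  have deficit: "(\<Sum>(s, t)\<in>D. (W t - W s) - \<bar>g t - g s\<bar>) \<le> \<epsilon>"
    using near sum_increments_le[OF D ab monoW]
    by (simp add: variation_sum_def sum_subtractf case_prod_beta)
  have inside: "\<exists>U\<in>sets borel. ?E \<inter> {fst J<..<snd J} \<subseteq> U \<and>
      emeasure lborel U \<le> ennreal (5 * (((W (snd J) - W (fst J)) - \<bar>g (snd J) - g (fst J)\<bar>) / c))"
    if "J \<in> D" for J
  proof -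
    obtain s0 t0 where J: "J = (s0, t0)" by force
    have st0: "a \<le> s0" "s0 < t0" "t0 \<le> b" using Dab that J by auto
    define \<sigma> :: real where "\<sigma> = (if g s0 \<le> g t0 then 1 else -1)"
    have sg: "\<sigma> * (g t0 - g s0) = \<bar>g t0 - g s0\<bar>" by (simp add: \<sigma>_def)
    have sg': "\<bar>\<sigma> * x\<bar> = \<bar>x\<bar>" for x by (simp add: \<sigma>_def)
    \<comment> \<open>Since \<open>W\<close> dominates the steps of \<open>g\<close>,
      \<open>N\<close> increases; its growth over \<open>J\<close> is exactly the deficit of
      \<open>J\<close>, and a steep step of \<open>g\<close> against the sign
      \<open>\<sigma>\<close> makes \<open>N\<close> climb at rate \<open>c\<close> or more.\<close>
    define N where "N u = W u - \<sigma> * g u" for u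
    define \<I> where "\<I> = {(s, t). s0 \<le> s \<and> s < t \<and> t \<le> t0 \<and> c * (t - s) \<le> - (\<sigma> * (g t - g s))}"
    have Ninc: "\<bar>\<sigma> * (g t - g s)\<bar> - \<sigma> * (g t - g s) \<le> N t - N s" if "s0 \<le> s" "s \<le> t" "t \<le> t0" for s t
      using W[of s t] that st0 sg'[of "g t - g s"] by (simp add: N_def right_diff_distrib)
    have "\<exists>U\<in>sets borel. ?E \<inter> {s0<..<t0} \<subseteq> U \<and> emeasure lborel U \<le> ennreal (5 * ((N t0 - N s0) / c))"
    proof (rule monotone_cover_emeasure[where \<I> = \<I> and W = N and a = s0 and b = t0 and c = c])
      show "mono_on {s0..t0} N"
      proof (rule mono_onI)
        fix s t assume "s \<in> {s0..t0}" "t \<in> {s0..t0}" "s \<le> t"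
        then show "N s \<le> N t"
          using Ninc[of s t] abs_ge_self[of "\<sigma> * (g t - g s)"] by auto
      qed
      show "s0 \<le> s \<and> s < t \<and> t \<le> t0 \<and> c * (t - s) \<le> N t - N s" if "(s, t) \<in> \<I>" for s t
        using that Ninc[of s t] by (auto simp: \<I>_def)
      show "\<exists>(s, t)\<in>\<I>. s \<le> u \<and> u \<le> t" if "u \<in> ?E \<inter> {s0<..<t0}" for u
      proof -
        define \<delta> where "\<delta> = min (u - s0) (t0 - u)"
        have "0 < \<delta>" using that by (auto simp: \<delta>_def)
        then have up: "\<exists>s t. s \<le> u \<and> u \<le> t \<and> s < t \<and> t - s < \<delta> \<and> c * (t - s) < g t - g s"
          and down: "\<exists>s t. s \<le> u \<and> u \<le> t \<and> s < t \<and> t - s < \<delta> \<and> g t - g s < - (c * (t - s))"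
          using that by blast+
        have "\<exists>s t. s \<le> u \<and> u \<le> t \<and> s < t \<and> t - s < \<delta> \<and> c * (t - s) < - (\<sigma> * (g t - g s))"
        proof (cases "g s0 \<le> g t0")
          case True
          then have "(c * (t - s) < - (\<sigma> * (g t - g s))) = (g t - g s < - (c * (t - s)))" for s t
            by (auto simp: \<sigma>_def)
          then show ?thesis using down by presburger
        next
          case False
          then have "(c * (t - s) < - (\<sigma> * (g t - g s))) = (c * (t - s) < g t - g s)" for s t
            by (auto simp: \<sigma>_def)
          then show ?thesis using up by presburger
        qed
        then obtain s t where st: "s \<le> u" "u \<le> t" "s < t" "t - s < \<delta>" "c * (t - s) < - (\<sigma> * (g t - g s))"
          by blast
        then have "(s, t) \<in> \<I>" by (auto simp: \<I>_def \<delta>_def)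
        then show ?thesis using st by blast
      qed
    qed (use st0 c in auto)
    moreover have "N t0 - N s0 = (W t0 - W s0) - \<bar>g t0 - g s0\<bar>"
      unfolding sg[symmetric] N_def by (simp add: algebra_simps)
    ultimately show ?thesis by (simp add: J)
  qed
  have outside: "\<exists>U\<in>sets borel. ?E - (\<Union>(s, t)\<in>D. {s..t}) \<subseteq> U \<and> emeasure lborel U \<le> ennreal (5 * (\<epsilon> / c))"
  proof -
    \<comment> \<open>Climbing intervals that avoid \<open>D\<close>: a disjoint family of them can
      be joined to \<open>D\<close>, and since \<open>D\<close> already realises all but
      \<open>\<epsilon>\<close> of the growth of \<open>W\<close>, their lengths add up to at most
      \<open>\<epsilon> / c\<close>.\<close>
    define \<I> where "\<I> = {(s, t). a \<le> s \<and> s < t \<and> t \<le> b \<and> c * (t - s) \<le> W t - W s \<and>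
      (\<forall>(s', t')\<in>D. t \<le> s' \<or> t' \<le> s)}"
    have Iab: "a \<le> s \<and> s < t \<and> t \<le> b" if "(s, t) \<in> \<I>" for s t using that by (auto simp: \<I>_def)
    have bound: "(\<Sum>(s, t)\<in>F. t - s) \<le> \<epsilon> / c" if F: "F \<subseteq> \<I>" "F \<in> interval_families a b" for F
    proof -
      have fF: "finite F" using F by (auto simp: interval_families_def)
      have disj: "F \<inter> D = {}"
      proof (rule ccontr)
        assume "F \<inter> D \<noteq> {}"
        then obtain s t where "(s, t) \<in> F" "(s, t) \<in> D" by auto
        then have "t \<le> s \<or> t \<le> s" using F(1) by (fastforce simp: \<I>_def)
        then show False using Dab[OF \<open>(s, t) \<in> D\<close>] by auto
      qed
      have "F \<union> D \<in> interval_families a b"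
        unfolding interval_families_def mem_Collect_eq
      proof (intro conjI)
        show "finite (F \<union> D)" using fF finD by simp
        show "\<forall>(s, t)\<in>F \<union> D. a \<le> s \<and> s < t \<and> t \<le> b"
          using F(2) D by (auto simp: interval_families_def)
        have cross: "snd I \<le> fst J \<or> snd J \<le> fst I" if "I \<in> F" "J \<in> D" for I J
          using that F(1) by (force simp: \<I>_def)
        show "pairwise (\<lambda>I J. snd I \<le> fst J \<or> snd J \<le> fst I) (F \<union> D)"
        proof (rule pairwiseI)
          fix I J assume "I \<in> F \<union> D" "J \<in> F \<union> D" "I \<noteq> J"
          moreover have "pairwise (\<lambda>I J. snd I \<le> fst J \<or> snd J \<le> fst I) F"
            "pairwise (\<lambda>I J. snd I \<le> fst J \<or> snd J \<le> fst I) D"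
            using F(2) D by (auto simp: interval_families_def)
          ultimately show "snd I \<le> fst J \<or> snd J \<le> fst I"
            using cross[of I J] cross[of J I] by (auto simp: pairwise_def)
        qed
      qed
      from sum_increments_le[OF this ab monoW]
      have "(\<Sum>(s, t)\<in>F. W t - W s) + (\<Sum>(s, t)\<in>D. W t - W s) \<le> W b - W a"
        by (simp add: sum.union_disjoint[OF fF finD disj])
      moreover have "variation_sum g D \<le> (\<Sum>(s, t)\<in>D. W t - W s)"
        unfolding variation_sum_def using Dab W by (intro sum_mono) (auto simp: less_imp_le)
      moreover have "c * (\<Sum>(s, t)\<in>F. t - s) \<le> (\<Sum>(s, t)\<in>F. W t - W s)"
        unfolding sum_distrib_left using F(1) by (intro sum_mono) (auto simp: \<I>_def)
      ultimately show ?thesis using near c by (simp add: field_simps)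
    qed
    have cover: "\<exists>(s, t)\<in>\<I>. s \<le> u \<and> u \<le> t" if u: "u \<in> ?E - (\<Union>(s, t)\<in>D. {s..t})" for u
    proof -
      have "closed (\<Union>(s, t)\<in>D. {s..t})" using finD by (intro closed_UN) auto
      then have "open ({a<..<b} - (\<Union>(s, t)\<in>D. {s..t}))" by (intro open_Diff) auto
      moreover have "u \<in> {a<..<b} - (\<Union>(s, t)\<in>D. {s..t})" using u by auto
      ultimately obtain \<delta> where \<delta>: "0 < \<delta>" "ball u \<delta> \<subseteq> {a<..<b} - (\<Union>(s, t)\<in>D. {s..t})"
        using openE by blast
      then obtain s t where st: "s \<le> u" "u \<le> t" "s < t" "t - s < \<delta>" "c * (t - s) < g t - g s"
        using u by blast
      have sub: "{s..t} \<subseteq> ball u \<delta>" using st by (auto simp: dist_real_def)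
      have "s \<in> ball u \<delta>" "t \<in> ball u \<delta>" using st by (auto simp: dist_real_def)
      then have ab': "a \<le> s" "t \<le> b" using \<delta>(2) by auto
      have "t \<le> s' \<or> t' \<le> s" if "(s', t') \<in> D" for s' t'
      proof (rule ccontr)
        assume "\<not> (t \<le> s' \<or> t' \<le> s)"
        then have "max s s' \<in> {s..t}" "max s s' \<in> {s'..t'}"
          using st Dab[OF that] by auto
        then show False using sub \<delta>(2) that by blast
      qed
      then have "(s, t) \<in> \<I>" using st ab' W[of s t] by (auto simp: \<I>_def)
      then show ?thesis using st by blast
    qed
    show ?thesis
    proof (rule Vitali_cover_emeasure)
      show "a \<le> s \<and> s < t \<and> t \<le> b" if "(s, t) \<in> \<I>" for s t using that by (rule Iab)
      show "(\<Sum>(s, t)\<in>F. t - s) \<le> \<epsilon> / c" if "F \<subseteq> \<I>" "F \<in> interval_families a b" for F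
        using that by (rule bound)
      show "\<exists>(s, t)\<in>\<I>. s \<le> u \<and> u \<le> t" if "u \<in> ?E - (\<Union>(s, t)\<in>D. {s..t})" for u
        using that by (rule cover)
    qed
  qed
  have "\<forall>J\<in>D. \<exists>U. U \<in> sets borel \<and> ?E \<inter> {fst J<..<snd J} \<subseteq> U \<and> emeasure lborel U \<le>
      ennreal (5 * (((W (snd J) - W (fst J)) - \<bar>g (snd J) - g (fst J)\<bar>) / c))"
    using inside by (simp only: Bex_def) blast
  from bchoice[OF this] obtain U where U0: "\<forall>J\<in>D. U J \<in> sets borel \<and> ?E \<inter> {fst J<..<snd J} \<subseteq> U J \<and>
      emeasure lborel (U J) \<le> ennreal (5 * (((W (snd J) - W (fst J)) - \<bar>g (snd J) - g (fst J)\<bar>) / c))" ..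
  have U: "U J \<in> sets borel" "?E \<inter> {fst J<..<snd J} \<subseteq> U J"
    "emeasure lborel (U J) \<le> ennreal (5 * (((W (snd J) - W (fst J)) - \<bar>g (snd J) - g (fst J)\<bar>) / c))"
    if "J \<in> D" for J
    using bspec[OF U0 that] by simp_all
  from outside obtain V where V: "V \<in> sets borel" "?E - (\<Union>(s, t)\<in>D. {s..t}) \<subseteq> V"
    "emeasure lborel V \<le> ennreal (5 * (\<epsilon> / c))" by blast
  \<comment> \<open>The endpoints of \<open>D\<close> lie neither in the open intervals treated by
    \<open>inside\<close> nor off the closed ones treated by \<open>outside\<close>; there are
    finitely many of them.\<close>
  define P where "P = fst ` D \<union> snd ` D"
  have P: "finite P" using finD by (simp add: P_def)
  have "emeasure lborel P = 0" using P by (intro emeasure_lborel_countable countable_finite)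
  have sets: "P \<in> sets lborel" "(\<Union>J\<in>D. U J) \<in> sets lborel" "V \<in> sets lborel"
    using P U(1) V(1) finD by (auto intro: borel_closed finite_imp_closed)
  have "emeasure lborel (\<Union>J\<in>D. U J) \<le> (\<Sum>J\<in>D. emeasure lborel (U J))"
    using finD U(1) by (intro emeasure_subadditive_finite) auto
  also have "\<dots> \<le> (\<Sum>J\<in>D. ennreal (5 * (((W (snd J) - W (fst J)) - \<bar>g (snd J) - g (fst J)\<bar>) / c)))"
    by (intro sum_mono U(3))
  also have "\<dots> = ennreal (\<Sum>J\<in>D. 5 * (((W (snd J) - W (fst J)) - \<bar>g (snd J) - g (fst J)\<bar>) / c))"
  proof (rule sum_ennreal)
    fix J assume "J \<in> D"
    then have "\<bar>g (snd J) - g (fst J)\<bar> \<le> W (snd J) - W (fst J)"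
      using Dab[of "fst J" "snd J"] W by simp
    then show "0 \<le> 5 * (((W (snd J) - W (fst J)) - \<bar>g (snd J) - g (fst J)\<bar>) / c)" using c by simp
  qed
  also have "\<dots> \<le> ennreal (5 * (\<epsilon> / c))"
  proof (rule ennreal_leI)
    have "(\<Sum>J\<in>D. 5 * (((W (snd J) - W (fst J)) - \<bar>g (snd J) - g (fst J)\<bar>) / c)) =
      5 * ((\<Sum>(s, t)\<in>D. (W t - W s) - \<bar>g t - g s\<bar>) / c)"
      by (simp add: sum_distrib_left sum_divide_distrib case_prod_beta)
    also have "\<dots> \<le> 5 * (\<epsilon> / c)" using deficit c by (intro mult_left_mono divide_right_mono) auto
    finally show "(\<Sum>J\<in>D. 5 * (((W (snd J) - W (fst J)) - \<bar>g (snd J) - g (fst J)\<bar>) / c)) \<le> 5 * (\<epsilon> / c)" .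
  qed
  finally have "emeasure lborel (\<Union>J\<in>D. U J) \<le> ennreal (5 * (\<epsilon> / c))" .
  moreover have "emeasure lborel (P \<union> (\<Union>J\<in>D. U J) \<union> V) \<le>
      emeasure lborel P + emeasure lborel (\<Union>J\<in>D. U J) + emeasure lborel V"
    using sets by (intro order_trans[OF emeasure_subadditive] add_mono emeasure_subadditive) auto
  ultimately have "emeasure lborel (P \<union> (\<Union>J\<in>D. U J) \<union> V) \<le> ennreal (5 * (\<epsilon> / c)) + ennreal (5 * (\<epsilon> / c))"
    using V(3) \<open>emeasure lborel P = 0\<close> by (auto intro: order_trans add_mono)
  also have "\<dots> = ennreal e" using eps c \<open>0 < e\<close> by (subst ennreal_plus[symmetric]) (auto simp: \<epsilon>_def)
  finally have "emeasure lborel (P \<union> (\<Union>J\<in>D. U J) \<union> V) \<le> ennreal e" .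
  moreover have "?E \<subseteq> P \<union> (\<Union>J\<in>D. U J) \<union> V"
  proof
    fix u assume u: "u \<in> ?E"
    show "u \<in> P \<union> (\<Union>J\<in>D. U J) \<union> V"
    proof (cases "u \<in> (\<Union>(s, t)\<in>D. {s..t})")
      case True
      then obtain J where J: "J \<in> D" "fst J \<le> u" "u \<le> snd J" by auto
      then have "u = fst J \<or> u = snd J \<or> u \<in> {fst J<..<snd J}" by auto
      then show ?thesis using J(1) U(2)[OF J(1)] u by (auto simp: P_def)
    qed (use V(2) u in blast)
  qed
  ultimately show "\<exists>U\<in>sets borel. ?E \<subseteq> U \<and> emeasure lborel U \<le> ennreal e"
    using sets by (intro bexI[of _ "P \<union> (\<Union>J\<in>D. U J) \<union> V"]) auto
qed


text \<open>Such points are covered by intervals of slope at least \<open>c\<close> for every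
  \<open>c\<close>, and the covering estimate decreases like \<open>1 / c\<close>. The total
  variation takes the role of the monotone function.\<close>

lemma negligible_unbounded_quotients:
  fixes f :: "real \<Rightarrow> real"
  assumes ab: "a \<le> b" and B: "\<And>D. D \<in> interval_families a b \<Longrightarrow> variation_sum f D \<le> B"
  shows "negligible {u\<in>{a<..<b}. \<forall>c. \<forall>\<delta>>0.
     \<exists>s t. s \<le> u \<and> u \<le> t \<and> s < t \<and> t - s < \<delta> \<and> c * (t - s) < \<bar>f t - f s\<bar>}"
    (is "negligible ?E")
proof (rule negligible_borel_outer)
  fix e :: real assume "0 < e"
  obtain W where W: "\<And>s t. a \<le> s \<Longrightarrow> s \<le> t \<Longrightarrow> t \<le> b \<Longrightarrow> \<bar>f t - f s\<bar> \<le> W t - W s"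
    by (rule variation_function[OF ab B]) (assumption | rule that)+
  have monoW: "mono_on {a..b} W"
  proof (rule mono_onI)
    fix s t assume "s \<in> {a..b}" "t \<in> {a..b}" "s \<le> t"
    then show "W s \<le> W t" using W[of s t] abs_ge_zero[of "f t - f s"] by auto
  qed
  \<comment> \<open>Makes \<open>5 * ((W b - W a) / c)\<close> at most \<open>e\<close>; the summand
    1 keeps \<open>c\<close> positive when \<open>W b = W a\<close>.\<close>
  define c where "c = 5 * (W b - W a + 1) / e"
  have "0 \<le> W b - W a" using W[of a b] ab by simp
  then have c: "0 < c" using \<open>0 < e\<close> by (simp add: c_def)
  have "\<exists>U\<in>sets borel. ?E \<subseteq> U \<and> emeasure lborel U \<le> ennreal (5 * ((W b - W a) / c))"
  proof (rule monotone_cover_emeasure[OF ab c monoW,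
        where \<I> = "{(s, t). a \<le> s \<and> s < t \<and> t \<le> b \<and> c * (t - s) \<le> W t - W s}"])
    fix u assume u: "u \<in> ?E"
    then have "0 < min (u - a) (b - u)" by auto
    then obtain s t where st: "s \<le> u" "u \<le> t" "s < t" "t - s < min (u - a) (b - u)"
      "c * (t - s) < \<bar>f t - f s\<bar>" using u by blast
    moreover have "c * (t - s) \<le> W t - W s" using st W[of s t] by auto
    ultimately show "\<exists>(s, t)\<in>{(s, t). a \<le> s \<and> s < t \<and> t \<le> b \<and> c * (t - s) \<le> W t - W s}. s \<le> u \<and> u \<le> t"
      by (intro bexI[of _ "(s, t)"]) auto
  qed auto
  moreover have "5 * ((W b - W a) / c) \<le> e"
    using \<open>0 < e\<close> \<open>0 \<le> W b - W a\<close> by (simp add: c_def field_simps)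
  ultimately show "\<exists>U\<in>sets borel. ?E \<subseteq> U \<and> emeasure lborel U \<le> ennreal e"
    using order_trans[OF _ ennreal_leI] by blast
qed

text \<open>For negative \<open>h\<close> the same quotient belongs to the interval from
  \<open>u + h\<close> to \<open>u\<close>, so two-sided difference quotients become slopes over
  intervals with \<open>u\<close> at one end, as the covering arguments need.\<close>

lemma frequently_at_quotient:
  fixes f :: "real \<Rightarrow> real"
  assumes "frequently (\<lambda>h. P ((f (u + h) - f u) / h)) (at 0)" and "0 < \<delta>"
  shows "\<exists>s t. s \<le> u \<and> u \<le> t \<and> s < t \<and> t - s < \<delta> \<and> P ((f t - f s) / (t - s))"
proof -
  obtain h where h: "h \<noteq> 0" "\<bar>h\<bar> < \<delta>" "P ((f (u + h) - f u) / h)"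
    using assms unfolding frequently_at by (auto simp: dist_real_def)
  show ?thesis
  proof (cases "0 < h")
    case True
    then show ?thesis using h by (intro exI[of _ u] exI[of _ "u + h"]) auto
  next
    case False
    have "(f u - f (u + h)) / (u - (u + h)) = (f (u + h) - f u) / h"
      using h(1) by (simp add: field_simps)
    then show ?thesis using h False by (intro exI[of _ "u + h"] exI[of _ u]) auto
  qed
qed

text \<open>A gap between the lower and the upper limit contains two rationals; using rationals
  keeps the exceptional set of the next theorem a countable union. The bound \<open>R\<close>
  excludes infinite limits.\<close>

lemma real_tendsto_if_no_oscillation:
  fixes D :: "real \<Rightarrow> real"
  assumes bdd: "eventually (\<lambda>h. \<bar>D h\<bar> \<le> R) (at 0)"
    and osc: "\<And>p q. p \<in> \<rat> \<Longrightarrow> q \<in> \<rat> \<Longrightarrow> p < q \<Longrightarrow>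
      \<not> (frequently (\<lambda>h. D h < p) (at 0) \<and> frequently (\<lambda>h. q < D h) (at 0))"
  shows "\<exists>l. (D \<longlongrightarrow> l) (at 0)"
proof -
  let ?L = "Liminf (at 0) (\<lambda>h. ereal (D h))" and ?U = "Limsup (at 0) (\<lambda>h. ereal (D h))"
  have le: "?L \<le> ?U" by (rule Liminf_le_Limsup) simp
  have "\<not> ?L < ?U"
  proof
    assume "?L < ?U"
    then obtain x where "?L < ereal x" "ereal x < ?U" using ereal_dense2 by blast
    moreover then obtain y where "ereal x < ereal y" "ereal y < ?U" using ereal_dense2 by blast
    ultimately obtain x y where xy: "?L < ereal x" "x < y" "ereal y < ?U" by auto
    obtain p where p: "p \<in> \<rat>" "x < p" "p < y" using Rats_dense_in_real[OF xy(2)] by blast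
    obtain q where q: "q \<in> \<rat>" "p < q" "q < y" using Rats_dense_in_real[OF p(3)] by blast
    have "frequently (\<lambda>h. D h < p) (at 0)"
    proof (rule ccontr)
      assume "\<not> frequently (\<lambda>h. D h < p) (at 0)"
      then have "ereal p \<le> ?L"
        by (intro Liminf_bounded) (auto simp: frequently_def not_less elim: eventually_mono)
      also note xy(1)
      finally show False using p by simp
    qed
    moreover have "frequently (\<lambda>h. q < D h) (at 0)"
    proof (rule ccontr)
      assume "\<not> frequently (\<lambda>h. q < D h) (at 0)"
      then have "?U \<le> ereal q"
        by (intro Limsup_bounded) (auto simp: frequently_def not_less elim: eventually_mono)
      with xy(3) have "ereal y < ereal q" by (rule less_le_trans)
      then show False using q by simp
    qed
    ultimately show False using osc p(1) q(1,2) by blast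
  qed
  then have eq: "?L = ?U" using le by simp
  have "((\<lambda>h. ereal (D h)) \<longlongrightarrow> ?L) (at 0)"
    using eq by (subst tendsto_iff_Liminf_eq_Limsup) auto
  moreover have "ereal (- R) \<le> ?L"
    using bdd by (intro Liminf_bounded) (auto elim: eventually_mono)
  moreover have "?U \<le> ereal R"
    using bdd by (intro Limsup_bounded) (auto elim: eventually_mono)
  ultimately obtain l :: real where "((\<lambda>h. ereal (D h)) \<longlongrightarrow> ereal l) (at 0)"
    using eq by (cases ?U) auto
  then show ?thesis by auto
qed

text \<open>Lebesgue's theorem on functions of bounded variation. Subtracting the line of slope
  \<open>(p + q) / 2\<close> turns quotients below \<open>p\<close> and above \<open>q\<close> into
  slopes below \<open>-c\<close> and above \<open>c\<close> with \<open>c = (q - p) / 2\<close>, so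
  each oscillation is a case of \<open>negligible_steep_both_ways\<close>; a line of slope
  \<open>m\<close> adds at most \<open>\<bar>m\<bar> * (b - a)\<close> to the variation.\<close>

theorem bounded_variation_imp_differentiable_ae:
  fixes f :: "real \<Rightarrow> real"
  assumes ab: "a \<le> b" and B: "\<And>D. D \<in> interval_families a b \<Longrightarrow> variation_sum f D \<le> B"
  shows "negligible {u\<in>{a<..<b}. \<nexists>l. (f has_real_derivative l) (at u)}"
proof -
  define E where "E c m = {u\<in>{a<..<b}. \<forall>\<delta>>0.
     (\<exists>s t. s \<le> u \<and> u \<le> t \<and> s < t \<and> t - s < \<delta> \<and> c * (t - s) < (f t - m * t) - (f s - m * s)) \<and>
     (\<exists>s t. s \<le> u \<and> u \<le> t \<and> s < t \<and> t - s < \<delta> \<and> (f t - m * t) - (f s - m * s) < - (c * (t - s)))}"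
    for c m
  define E' where "E' = {u\<in>{a<..<b}. \<forall>c. \<forall>\<delta>>0.
     \<exists>s t. s \<le> u \<and> u \<le> t \<and> s < t \<and> t - s < \<delta> \<and> c * (t - s) < \<bar>f t - f s\<bar>}"
  have "negligible (E c m)" if "0 < c" for c m
    unfolding E_def
  proof (rule negligible_steep_both_ways[OF ab _ that])
    fix D assume D: "D \<in> interval_families a b"
    have "variation_sum (\<lambda>t. f t - m * t) D \<le> (\<Sum>(s, t)\<in>D. \<bar>f t - f s\<bar> + \<bar>m\<bar> * (t - s))"
      unfolding variation_sum_def
    proof (intro sum_mono, clarify)
      fix s t assume "(s, t) \<in> D"
      then have "s < t" using D by (auto simp: interval_families_def)
      have "(f t - m * t) - (f s - m * s) = (f t - f s) - m * (t - s)" by (simp add: algebra_simps)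
      also have "\<bar>\<dots>\<bar> \<le> \<bar>f t - f s\<bar> + \<bar>m * (t - s)\<bar>" by (rule abs_triangle_ineq4)
      finally show "\<bar>(f t - m * t) - (f s - m * s)\<bar> \<le> \<bar>f t - f s\<bar> + \<bar>m\<bar> * (t - s)"
        using \<open>s < t\<close> by (simp add: abs_mult)
    qed
    also have "\<dots> = variation_sum f D + \<bar>m\<bar> * (\<Sum>(s, t)\<in>D. t - s)"
      by (simp add: variation_sum_def sum.distrib sum_distrib_left case_prod_beta)
    also have "\<dots> \<le> B + \<bar>m\<bar> * (b - a)"
      using B[OF D] sum_increments_le[OF D ab, of "\<lambda>x. x"]
      by (intro add_mono mult_left_mono) (auto simp: mono_on_def)
    finally show "variation_sum (\<lambda>t. f t - m * t) D \<le> B + \<bar>m\<bar> * (b - a)" .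
  qed
  then have neg: "negligible (\<Union>(p, q)\<in>{(p, q). p \<in> \<rat> \<and> q \<in> \<rat> \<and> p < q}. E ((q - p) / 2) ((p + q) / 2))"
  proof (intro negligible_countable_Union)
    have "countable (\<rat> \<times> \<rat> :: (real \<times> real) set)" by (intro countable_SIGMA countable_rat)
    then have "countable {(p, q :: real). p \<in> \<rat> \<and> q \<in> \<rat> \<and> p < q}"
      by (rule countable_subset[rotated]) auto
    then show "countable ((\<lambda>(p, q). E ((q - p) / 2) ((p + q) / 2)) ` {(p, q). p \<in> \<rat> \<and> q \<in> \<rat> \<and> p < q})"
      by (rule countable_image)
  qed auto
  have neg': "negligible E'"
    unfolding E'_def by (rule negligible_unbounded_quotients[OF ab B])
  have "{u\<in>{a<..<b}. \<nexists>l. (f has_real_derivative l) (at u)} \<subseteq>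
    (\<Union>(p, q)\<in>{(p, q). p \<in> \<rat> \<and> q \<in> \<rat> \<and> p < q}. E ((q - p) / 2) ((p + q) / 2)) \<union> E'"
  proof (rule subsetI, rule ccontr)
    fix u assume u: "u \<in> {u\<in>{a<..<b}. \<nexists>l. (f has_real_derivative l) (at u)}"
      and not: "u \<notin> (\<Union>(p, q)\<in>{(p, q). p \<in> \<rat> \<and> q \<in> \<rat> \<and> p < q}. E ((q - p) / 2) ((p + q) / 2)) \<union> E'"
    define D where "D h = (f (u + h) - f u) / h" for h
    have "\<exists>l. (D \<longlongrightarrow> l) (at 0)"
    proof -
      from not u have "\<not> (\<forall>c. \<forall>\<delta>>0. \<exists>s t. s \<le> u \<and> u \<le> t \<and> s < t \<and> t - s < \<delta> \<and>
          c * (t - s) < \<bar>f t - f s\<bar>)"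
        unfolding E'_def by blast
      then obtain c \<delta> where c: "0 < \<delta>"
        "\<And>s t. s \<le> u \<Longrightarrow> u \<le> t \<Longrightarrow> s < t \<Longrightarrow> t - s < \<delta> \<Longrightarrow> \<bar>f t - f s\<bar> \<le> c * (t - s)"
        by (meson not_less)
      have "eventually (\<lambda>h. \<bar>D h\<bar> \<le> c) (at 0)"
      proof (rule ccontr)
        assume "\<not> eventually (\<lambda>h. \<bar>D h\<bar> \<le> c) (at 0)"
        then have "frequently (\<lambda>h. c < \<bar>(f (u + h) - f u) / h\<bar>) (at 0)"
          by (simp add: D_def not_eventually not_le)
        from frequently_at_quotient[OF this c(1)] obtain s t where
          "s \<le> u" "u \<le> t" "s < t" "t - s < \<delta>" "c < \<bar>(f t - f s) / (t - s)\<bar>" by blast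
        then show False using c(2)[of s t] by (auto simp: abs_divide field_simps)
      qed
      then show ?thesis
      proof (rule real_tendsto_if_no_oscillation)
        fix p q :: real assume pq: "p \<in> \<rat>" "q \<in> \<rat>" "p < q"
        show "\<not> (frequently (\<lambda>h. D h < p) (at 0) \<and> frequently (\<lambda>h. q < D h) (at 0))"
        proof
          assume fr: "frequently (\<lambda>h. D h < p) (at 0) \<and> frequently (\<lambda>h. q < D h) (at 0)"
          have "u \<in> E ((q - p) / 2) ((p + q) / 2)"
            unfolding E_def mem_Collect_eq
          proof (intro conjI allI impI)
            show "u \<in> {a<..<b}" using u by simp
            fix \<delta> :: real assume "0 < \<delta>"
            from frequently_at_quotient[OF _ this, of "\<lambda>x. q < x"] fr obtain s t where
              st: "s \<le> u" "u \<le> t" "s < t" "t - s < \<delta>" "q < (f t - f s) / (t - s)"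
              unfolding D_def by blast
            then have "q * (t - s) < f t - f s" by (simp add: field_simps)
            then have "(q - p) / 2 * (t - s) < (f t - (p + q) / 2 * t) - (f s - (p + q) / 2 * s)"
              by (simp add: field_simps)
            with st show "\<exists>s t. s \<le> u \<and> u \<le> t \<and> s < t \<and> t - s < \<delta> \<and>
              (q - p) / 2 * (t - s) < (f t - (p + q) / 2 * t) - (f s - (p + q) / 2 * s)" by blast
          next
            fix \<delta> :: real assume "0 < \<delta>"
            from frequently_at_quotient[OF _ this, of "\<lambda>x. x < p"] fr obtain s t where
              st: "s \<le> u" "u \<le> t" "s < t" "t - s < \<delta>" "(f t - f s) / (t - s) < p"
              unfolding D_def by blast
            then have "f t - f s < p * (t - s)" by (simp add: field_simps)
            then have "(f t - (p + q) / 2 * t) - (f s - (p + q) / 2 * s) < - ((q - p) / 2 * (t - s))"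
              by (simp add: field_simps)
            with st show "\<exists>s t. s \<le> u \<and> u \<le> t \<and> s < t \<and> t - s < \<delta> \<and>
              (f t - (p + q) / 2 * t) - (f s - (p + q) / 2 * s) < - ((q - p) / 2 * (t - s))" by blast
          qed
          then show False using not pq by blast
        qed
      qed
    qed
    then have "\<exists>l. (f has_real_derivative l) (at u)"
      by (simp add: DERIV_def D_def[abs_def])
    then show False using u by blast
  qed
  then show ?thesis
    using neg neg' by (auto intro: negligible_subset[OF negligible_Un])
qed

section \<open>Absolutely continuous functions and the fundamental theorem of calculus\<close>

lemma interval_families_mono:
  assumes "a' \<le> a" "b \<le> b'"
  shows "interval_families a b \<subseteq> interval_families a' b'"
  using assms by (auto simp: interval_families_def split_beta intro: order_trans)


lemma abs_continuous_01_variation: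
  assumes x: "abs_continuous_01 x" and "0 < \<epsilon>"
  shows "\<exists>\<eta>>0. \<forall>D\<in>interval_families 0 1. (\<Sum>(s, t)\<in>D. t - s) < \<eta> \<longrightarrow> variation_sum x D < \<epsilon>"
proof -
  obtain \<eta> where \<eta>: "0 < \<eta>" and H: "\<And>n a b. (\<forall>i<n. 0 \<le> a i \<and> a i \<le> b i \<and> b i \<le> 1) \<Longrightarrow>
      disjoint_family_on (\<lambda>i. {a i<..<b i}) {..<n::nat} \<Longrightarrow> (\<Sum>i<n. b i - a i) < \<eta> \<Longrightarrow>
      (\<Sum>i<n. \<bar>x (b i) - x (a i)\<bar>) < \<epsilon>"
    using assms unfolding abs_continuous_01_def by meson
  have "variation_sum x D < \<epsilon>" if D: "D \<in> interval_families 0 1" "(\<Sum>(s, t)\<in>D. t - s) < \<eta>" for D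
  proof -
    have "finite D" using D by (auto simp: interval_families_def)
    then obtain h where h: "bij_betw h {..<card D} D"
      using ex_bij_betw_nat_finite atLeast0LessThan by metis
    have sum_h: "(\<Sum>i<card D. F (h i)) = (\<Sum>I\<in>D. F I)" for F :: "real \<times> real \<Rightarrow> real"
      by (rule sum.reindex_bij_betw[OF h])
    have mem: "h i \<in> D" if "i < card D" for i using h that by (auto simp: bij_betw_def)
    have "(\<Sum>i<card D. \<bar>x (snd (h i)) - x (fst (h i))\<bar>) < \<epsilon>"
    proof (rule H)
      show "\<forall>i<card D. 0 \<le> fst (h i) \<and> fst (h i) \<le> snd (h i) \<and> snd (h i) \<le> 1"
        using D(1) mem by (force simp: interval_families_def)
      show "(\<Sum>i<card D. snd (h i) - fst (h i)) < \<eta>"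
        using D(2) sum_h[of "\<lambda>I. snd I - fst I"] by (simp add: case_prod_beta)
      show "disjoint_family_on (\<lambda>i. {fst (h i)<..<snd (h i)}) {..<card D}"
        unfolding disjoint_family_on_def
      proof (intro ballI impI)
        fix i j assume ij: "i \<in> {..<card D}" "j \<in> {..<card D}" "i \<noteq> j"
        then have "h i \<noteq> h j" using h by (auto simp: bij_betw_def inj_on_def)
        then have "snd (h i) \<le> fst (h j) \<or> snd (h j) \<le> fst (h i)"
          using D(1) mem ij by (auto simp: interval_families_def pairwise_def)
        then show "{fst (h i)<..<snd (h i)} \<inter> {fst (h j)<..<snd (h j)} = {}" by auto
      qed
    qed
    then show ?thesis
      using sum_h[of "\<lambda>I. \<bar>x (snd I) - x (fst I)\<bar>"] by (simp add: variation_sum_def case_prod_beta)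
  qed
  then show ?thesis using \<eta> by blast
qed

text \<open>On a cell of length below \<open>\<eta>\<close> every interval family has variation
  below 1. Cutting \<open>{0..1}\<close> into \<open>r\<close> such cells leaves finitely many
  division points, among them 0 and 1, where the derivative would look outside the interval.\<close>

lemma abs_continuous_01_differentiable_ae:
  assumes x: "abs_continuous_01 x"
  shows "negligible {u\<in>{0..1}. \<nexists>l. (x has_real_derivative l) (at u)}"
proof -
  obtain \<eta> where \<eta>: "0 < \<eta>"
    and H: "\<And>D. D \<in> interval_families 0 1 \<Longrightarrow> (\<Sum>(s, t)\<in>D. t - s) < \<eta> \<Longrightarrow> variation_sum x D < 1"
    using abs_continuous_01_variation[OF x zero_less_one] by blast
  obtain n where n: "inverse (real (Suc n)) < \<eta>" using reals_Archimedean[OF \<eta>] by blast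
  define r where "r = Suc n"
  have r: "0 < r" "1 / real r < \<eta>" using n by (simp_all add: r_def inverse_eq_divide)
  define E where "E i = {u\<in>{real i / r<..<real (Suc i) / r}. \<nexists>l. (x has_real_derivative l) (at u)}" for i
  have "negligible (E i)" if "i < r" for i
    unfolding E_def
  proof (rule bounded_variation_imp_differentiable_ae)
    show le: "real i / r \<le> real (Suc i) / r" by (simp add: divide_right_mono)
    fix D assume D: "D \<in> interval_families (real i / r) (real (Suc i) / r)"
    have "0 \<le> real i / r" "real (Suc i) / r \<le> 1" using that by (auto simp: field_simps)
    then have "D \<in> interval_families 0 1"
      using D interval_families_mono by blast
    moreover have "(\<Sum>(s, t)\<in>D. t - s) \<le> real (Suc i) / r - real i / r"
      using sum_increments_le[OF D le, of "\<lambda>x. x"] by (auto simp: mono_on_def)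
    then have "(\<Sum>(s, t)\<in>D. t - s) < \<eta>" using r by (simp add: diff_divide_distrib[symmetric])
    ultimately show "variation_sum x D \<le> 1" using H by (simp add: less_imp_le)
  qed
  then have "negligible (\<Union>i<r. E i)" by (intro negligible_Union) auto
  moreover have "negligible ((\<lambda>i. real i / r) ` {..r})" by (intro negligible_finite) auto
  moreover have "{u\<in>{0..1}. \<nexists>l. (x has_real_derivative l) (at u)} \<subseteq>
    (\<Union>i<r. E i) \<union> (\<lambda>i. real i / r) ` {..r}"
  proof
    fix u assume u: "u \<in> {u\<in>{0..1}. \<nexists>l. (x has_real_derivative l) (at u)}"
    define i where "i = nat \<lfloor>u * r\<rfloor>"
    have i: "real i \<le> u * r" "u * r < real (Suc i)" using u r by (auto simp: i_def) linarith
    have "u * r \<le> r" using u r by (auto simp: mult_le_cancel_right1)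
    then have "real i \<le> real r" using i by linarith
    then have ir: "i \<le> r" by simp
    show "u \<in> (\<Union>i<r. E i) \<union> (\<lambda>i. real i / r) ` {..r}"
    proof (cases "u = real i / r")
      case True
      then show ?thesis using ir by auto
    next
      case False
      then have "real i \<noteq> u * r" using r by (auto simp: field_simps)
      then have *: "real i < u * r" using i by linarith
      then have "i < r" using \<open>u * r \<le> r\<close> by linarith
      moreover have "u \<in> E i" using u i * r by (auto simp: E_def field_simps)
      ultimately show ?thesis by blast
    qed
  qed
  ultimately show ?thesis by (meson negligible_Un negligible_subset)
qed

lemma interval_family_length_le_measure:
  assumes D: "D \<in> interval_families a b" and T: "T \<in> lmeasurable"
    and sub: "\<And>s t. (s, t) \<in> D \<Longrightarrow> {s<..<t} \<subseteq> T"
  shows "(\<Sum>(s, t)\<in>D. t - s) \<le> measure lebesgue T"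
proof -
  have fin: "finite D" using D by (auto simp: interval_families_def)
  have "(\<Sum>(s, t)\<in>D. t - s) = (\<Sum>I\<in>D. measure lebesgue {fst I<..<snd I})"
    using D by (intro sum.cong) (auto simp: interval_families_def)
  also have "\<dots> = measure lebesgue (\<Union>I\<in>D. {fst I<..<snd I})"
  proof (rule measure_UNION'[symmetric])
    show "pairwise (\<lambda>I J. disjnt {fst I<..<snd I} {fst J<..<snd J}) D"
    proof (rule pairwiseI)
      fix I J assume "I \<in> D" "J \<in> D" "I \<noteq> J"
      then have "snd I \<le> fst J \<or> snd J \<le> fst I"
        using D by (auto simp: interval_families_def pairwise_def)
      then show "disjnt {fst I<..<snd I} {fst J<..<snd J}" by (auto simp: disjnt_iff)
    qed
  qed (use fin in auto)
  also have "\<dots> \<le> measure lebesgue T"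
  proof (rule measure_mono_fmeasurable[OF _ _ T])
    show "(\<Union>I\<in>D. {fst I<..<snd I}) \<subseteq> T"
      using sub by (intro UN_least) (metis prod.collapse)
  qed (use fin in auto)
  finally show ?thesis .
qed

text \<open>A gauge argument. At a point with a derivative the gauge is chosen so that the increment
  over a cell differs from \<open>f u\<close> times its length by at most \<open>\<epsilon>\<close>
  times the length. The points without a derivative form a null set inside an open set
  \<open>T\<close> of measure below \<open>\<eta>\<close>; cells tagged there contribute 0 to the
  Riemann sum, and absolute continuity makes the increments over them small in total. The hypotheses
  fix \<open>f\<close> at every point because \<open>deriv\<close> is unspecified where no
  derivative exists.\<close>

theorem abs_continuous_01_FTC:
  assumes x: "abs_continuous_01 x" and ab: "0 \<le> a" "a \<le> b" "b \<le> 1"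
    and f: "\<And>u l. (x has_real_derivative l) (at u) \<Longrightarrow> f u = l"
    and f0: "\<And>u. \<nexists>l. (x has_real_derivative l) (at u) \<Longrightarrow> f u = 0"
  shows "(f has_integral (x b - x a)) {a..b}"
  unfolding box_real[symmetric] has_integral
proof (intro allI impI)
  fix e :: real assume e: "0 < e"
  define N where "N = {u\<in>{0..1}. \<nexists>l. (x has_real_derivative l) (at u)}"
  have N: "negligible N" unfolding N_def by (rule abs_continuous_01_differentiable_ae[OF x])
  obtain \<eta> where \<eta>: "0 < \<eta>"
    and H: "\<And>D. D \<in> interval_families 0 1 \<Longrightarrow> (\<Sum>(s, t)\<in>D. t - s) < \<eta> \<Longrightarrow> variation_sum x D < e / 2"
    using abs_continuous_01_variation[OF x half_gt_zero[OF e]] by blast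
  have "N \<in> sets lebesgue" using N by (simp add: negligible_iff_null_sets null_setsD2)
  then obtain T where T: "open T" "N \<subseteq> T" "T - N \<in> lmeasurable" "emeasure lebesgue (T - N) < ennreal \<eta>"
    using sets_lebesgue_outer_open \<eta> by metis
  have Nm: "N \<in> lmeasurable" "measure lebesgue N = 0"
    using N by (auto simp: negligible_imp_measurable negligible_imp_measure0)
  have TN: "T = N \<union> (T - N)" using T by auto
  have Tm: "T \<in> lmeasurable" using Nm T(3) by (subst TN) (rule fmeasurable.Un)
  have "measure lebesgue T \<le> measure lebesgue N + measure lebesgue (T - N)"
    using Nm T(3) by (subst TN) (intro measure_Un_le fmeasurableD)
  also have "\<dots> < \<eta>"
    using T(3,4) Nm \<eta> by (simp add: emeasure_eq_measure2 ennreal_less_iff)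
  finally have T\<eta>: "measure lebesgue T < \<eta>" .
  \<comment> \<open>Spreads \<open>e / 2\<close> over the length \<open>b - a\<close>; the summand 1
    covers \<open>a = b\<close>.\<close>
  define \<epsilon> where "\<epsilon> = e / (2 * (b - a + 1))"
  have \<epsilon>: "0 < \<epsilon>" using e ab by (simp add: \<epsilon>_def)
  have "\<exists>\<delta>>0. \<forall>y. \<bar>y - u\<bar> < \<delta> \<longrightarrow> \<bar>x y - x u - f u * (y - u)\<bar> \<le> \<epsilon> * \<bar>y - u\<bar>"
    if "u \<in> {0..1} - N" for u
  proof -
    have "\<exists>l. (x has_real_derivative l) (at u)" using that by (simp add: N_def)
    then obtain l where l: "(x has_real_derivative l) (at u)" by blast
    then have "(x has_derivative (\<lambda>h. h * l)) (at u)" by (simp add: has_field_derivative_def mult_commute_abs)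
    then obtain \<delta> where "0 < \<delta>" "\<And>y. \<bar>y - u\<bar> < \<delta> \<Longrightarrow> \<bar>x y - x u - (y - u) * l\<bar> \<le> \<epsilon> * \<bar>y - u\<bar>"
      using \<epsilon> unfolding has_derivative_at_alt by force
    then show ?thesis using f[OF l] by (auto simp: mult.commute)
  qed
  then obtain \<delta> where \<delta>: "\<And>u. u \<in> {0..1} - N \<Longrightarrow> 0 < \<delta> u"
    "\<And>u y. u \<in> {0..1} - N \<Longrightarrow> \<bar>y - u\<bar> < \<delta> u \<Longrightarrow> \<bar>x y - x u - f u * (y - u)\<bar> \<le> \<epsilon> * \<bar>y - u\<bar>"
    by metis
  define \<gamma> where "\<gamma> u = (if u \<in> N then T else if u \<in> {0..1} then ball u (\<delta> u) else UNIV)" for u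
  have gauge: "gauge \<gamma>" using T \<delta>(1) by (auto simp: gauge_def \<gamma>_def)
  have fine: "norm ((\<Sum>(u, K)\<in>\<D>. measure lborel K *\<^sub>R f u) - (x b - x a)) < e"
    if \<D>: "\<D> tagged_division_of cbox a b" "\<gamma> fine \<D>" for \<D>
  proof -
    have fin: "finite \<D>" using \<D>(1) by (rule tagged_division_of_finite)
    have K: "\<exists>s t. K = {s..t} \<and> s \<le> u \<and> u \<le> t \<and> a \<le> s \<and> t \<le> b \<and> {s..t} \<subseteq> \<gamma> u" if "(u, K) \<in> \<D>" for u K
    proof -
      have "u \<in> K" "K \<subseteq> {a..b}" "\<exists>s t. K = cbox s t" "K \<subseteq> \<gamma> u"
        using tagged_division_ofD(2,3,4)[OF \<D>(1) that] fineD[OF \<D>(2) that] by auto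
      then show ?thesis by (auto simp: subset_iff)
    qed
    have tel: "x b - x a = (\<Sum>(u, K)\<in>\<D>. x (Sup K) - x (Inf K))"
      using additive_tagged_division_1[OF ab(2), of \<D> x] \<D>(1) by simp
    have cont: "(\<Sum>(u, K)\<in>\<D>. measure lborel K) = b - a"
      using additive_content_tagged_division[OF \<D>(1)] ab by simp
    \<comment> \<open>Degenerate cells have no increment and are dropped: an interval family
      requires \<open>s < t\<close>, and without them the map to endpoints is injective.\<close>
    define \<D>N where "\<D>N = {(u, K)\<in>\<D>. u \<in> N \<and> Inf K < Sup K}"
    define D where "D = (\<lambda>(u, K). (Inf K, Sup K)) ` \<D>N"
    have sub: "\<D>N \<subseteq> \<D>" by (auto simp: \<D>N_def)
    have finN: "finite \<D>N" using fin sub by (rule finite_subset[rotated])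
    have sep: "Sup K \<le> Inf K' \<or> Sup K' \<le> Inf K" if "(u, K) \<in> \<D>N" "(u', K') \<in> \<D>N" "(u, K) \<noteq> (u', K')" for u K u' K'
    proof -
      have mem: "(u, K) \<in> \<D>" "(u', K') \<in> \<D>" using that sub by auto
      obtain s t where st1: "K = {s..t}" "s \<le> t" using K[OF mem(1)] order_trans by blast
      obtain s' t' where st2: "K' = {s'..t'}" "s' \<le> t'" using K[OF mem(2)] order_trans by blast
      note st = st1(1) st2(1)
      have "s < t" "s' < t'" using that(1,2) st1 st2 by (simp_all add: \<D>N_def)
      have "{s<..<t} \<inter> {s'<..<t'} = {}"
        using tagged_division_ofD(5)[OF \<D>(1) mem that(3)] st by (simp add: interior_atLeastAtMost_real)
      show ?thesis
      proof (rule ccontr)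
        assume "\<not> ?thesis"
        then have "max s s' < min t t'" using \<open>s < t\<close> \<open>s' < t'\<close> st by auto
        then obtain z where "max s s' < z" "z < min t t'" using dense by blast
        then have "z \<in> {s<..<t} \<inter> {s'<..<t'}" by auto
        then show False using \<open>{s<..<t} \<inter> {s'<..<t'} = {}\<close> by blast
      qed
    qed
    have inj: "inj_on (\<lambda>(u, K). (Inf K, Sup K)) \<D>N"
    proof (rule inj_onI, rule ccontr)
      fix p p' assume p: "p \<in> \<D>N" "p' \<in> \<D>N" "(case p of (u, K) \<Rightarrow> (Inf K, Sup K)) = (case p' of (u, K) \<Rightarrow> (Inf K, Sup K))" "p \<noteq> p'"
      then show False using sep[of "fst p" "snd p" "fst p'" "snd p'"] by (auto simp: \<D>N_def case_prod_beta)
    qed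
    have D: "D \<in> interval_families 0 1"
      unfolding interval_families_def mem_Collect_eq
    proof (intro conjI)
      show "finite D" using finN by (simp add: D_def)
      show "\<forall>(s, t)\<in>D. 0 \<le> s \<and> s < t \<and> t \<le> 1"
      proof (clarsimp simp: D_def)
        fix u K assume uK: "(u, K) \<in> \<D>N"
        then have "(u, K) \<in> \<D>" using sub by blast
        then obtain s t where "K = {s..t}" "s \<le> u" "u \<le> t" "a \<le> s" "t \<le> b" using K by meson
        then show "0 \<le> Inf K \<and> Inf K < Sup K \<and> Sup K \<le> 1" using uK ab by (auto simp: \<D>N_def)
      qed
      show "pairwise (\<lambda>I J. snd I \<le> fst J \<or> snd J \<le> fst I) D"
        unfolding D_def pairwise_image
      proof (rule pairwiseI, rule impI)
        fix p p' assume p: "p \<in> \<D>N" "p' \<in> \<D>N" "p \<noteq> p'"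
        then show "snd (case p of (u, K) \<Rightarrow> (Inf K, Sup K)) \<le> fst (case p' of (u, K) \<Rightarrow> (Inf K, Sup K)) \<or>
            snd (case p' of (u, K) \<Rightarrow> (Inf K, Sup K)) \<le> fst (case p of (u, K) \<Rightarrow> (Inf K, Sup K))"
          using sep[of "fst p" "snd p" "fst p'" "snd p'"] by (simp add: case_prod_beta prod_eq_iff)
      qed
    qed
    have "(\<Sum>(s, t)\<in>D. t - s) \<le> measure lebesgue T"
    proof (rule interval_family_length_le_measure[OF D Tm])
      fix s t assume "(s, t) \<in> D"
      then obtain u K' where uK: "(u, K') \<in> \<D>" "u \<in> N" "s = Inf K'" "t = Sup K'" by (auto simp: D_def \<D>N_def)
      then obtain s' t' where K': "K' = {s'..t'}" "s' \<le> u" "u \<le> t'" "{s'..t'} \<subseteq> \<gamma> u" using K by meson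
      then show "{s<..<t} \<subseteq> T" using uK by (auto simp: \<gamma>_def subset_iff)
    qed
    then have "variation_sum x D < e / 2" using H[OF D] T\<eta> by simp
    moreover have "variation_sum x D = (\<Sum>(u, K)\<in>\<D>N. \<bar>x (Sup K) - x (Inf K)\<bar>)"
      unfolding variation_sum_def D_def sum.reindex[OF inj] by (intro sum.cong) auto
    ultimately have bad: "(\<Sum>(u, K)\<in>\<D>N. \<bar>x (Sup K) - x (Inf K)\<bar>) < e / 2" by simp
    have "norm ((\<Sum>(u, K)\<in>\<D>. measure lborel K *\<^sub>R f u) - (x b - x a)) =
      \<bar>\<Sum>(u, K)\<in>\<D>. measure lborel K * f u - (x (Sup K) - x (Inf K))\<bar>"
      unfolding tel by (simp add: sum_subtractf case_prod_beta)
    also have "\<dots> \<le> (\<Sum>(u, K)\<in>\<D>. \<bar>measure lborel K * f u - (x (Sup K) - x (Inf K))\<bar>)"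
      using sum_abs[of "\<lambda>p. measure lborel (snd p) * f (fst p) - (x (Sup (snd p)) - x (Inf (snd p)))" \<D>]
      by (simp add: case_prod_beta)
    also have "\<dots> \<le> (\<Sum>(u, K)\<in>\<D>. (if (u, K) \<in> \<D>N then \<bar>x (Sup K) - x (Inf K)\<bar> else 0) + \<epsilon> * measure lborel K)"
    proof (intro sum_mono, clarify)
      fix u K' assume uK: "(u, K') \<in> \<D>"
      then obtain s t where st: "K' = {s..t}" "s \<le> u" "u \<le> t" "a \<le> s" "t \<le> b" "{s..t} \<subseteq> \<gamma> u"
        using K by blast
      have u01: "u \<in> {0..1}" using st ab by auto
      show "\<bar>measure lborel K' * f u - (x (Sup K') - x (Inf K'))\<bar> \<le>
        (if (u, K') \<in> \<D>N then \<bar>x (Sup K') - x (Inf K')\<bar> else 0) + \<epsilon> * measure lborel K'"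
      proof (cases "u \<in> N")
        case True
        then have "f u = 0" using f0 by (auto simp: N_def)
        show ?thesis
        proof (cases "s < t")
          case less: True
          then have "0 \<le> \<epsilon> * (t - s)" using \<epsilon> by simp
          then show ?thesis
            using \<open>f u = 0\<close> True less uK st by (simp add: \<D>N_def abs_minus_commute)
        next
          case False
          then have "t = s" using st by auto
          then show ?thesis using st by simp
        qed
      next
        case False
        have "s \<in> {s..t}" "t \<in> {s..t}" using st by auto
        then have "s \<in> \<gamma> u" "t \<in> \<gamma> u" using st(6) by blast+
        then have "s \<in> ball u (\<delta> u)" "t \<in> ball u (\<delta> u)" using False u01 by (auto simp: \<gamma>_def)
        then have "\<bar>x t - x u - f u * (t - u)\<bar> \<le> \<epsilon> * \<bar>t - u\<bar>" "\<bar>x s - x u - f u * (s - u)\<bar> \<le> \<epsilon> * \<bar>s - u\<bar>"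
          using \<delta>(2)[of u t] \<delta>(2)[of u s] False u01 by (auto simp: dist_real_def abs_minus_commute)
        moreover have "(t - s) * f u - (x t - x s) =
            (x s - x u - f u * (s - u)) - (x t - x u - f u * (t - u))" by (simp add: algebra_simps)
        ultimately have "\<bar>(t - s) * f u - (x t - x s)\<bar> \<le> \<epsilon> * (t - s)"
          using st by (simp add: algebra_simps)
        then show ?thesis using False st by (auto simp: \<D>N_def)
      qed
    qed
    also have "\<dots> = (\<Sum>(u, K)\<in>\<D>N. \<bar>x (Sup K) - x (Inf K)\<bar>) + \<epsilon> * (b - a)"
    proof -
      have "(\<Sum>(u, K)\<in>\<D>. if (u, K) \<in> \<D>N then \<bar>x (Sup K) - x (Inf K)\<bar> else 0) = (\<Sum>(u, K)\<in>\<D>N. \<bar>x (Sup K) - x (Inf K)\<bar>)"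
        using sub fin by (intro sum.mono_neutral_cong_right) auto
      then show ?thesis using cont by (simp add: sum.distrib sum_distrib_left[symmetric] case_prod_beta)
    qed
    also have "\<dots> < e / 2 + e / 2"
    proof (rule add_less_le_mono[OF bad])
      have "\<epsilon> * (b - a) \<le> \<epsilon> * (b - a + 1)" using \<epsilon> by (intro mult_left_mono) auto
      also have "\<dots> = e / 2" using ab by (simp add: \<epsilon>_def field_split_simps)
      finally show "\<epsilon> * (b - a) \<le> e / 2" .
    qed
    finally show ?thesis by simp
  qed
  show "\<exists>\<gamma>. gauge \<gamma> \<and> (\<forall>\<D>. \<D> tagged_division_of cbox a b \<and> \<gamma> fine \<D> \<longrightarrow>
      norm ((\<Sum>(u, K)\<in>\<D>. measure lborel K *\<^sub>R f u) - (x b - x a)) < e)"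
    by (intro exI[of _ \<gamma>] conjI allI impI, rule gauge, erule conjE, rule fine)
qed

section \<open>Riesz's characterisation of the limit set\<close>

text \<open>The integral of the squared derivative of the polygon through the points of the graph
  over \<open>i / r\<close>.\<close>

definition increment_energy :: "nat \<Rightarrow> (real \<Rightarrow> real) \<Rightarrow> real" where
  "increment_energy r x = real r * (\<Sum>i<r. (x (real (Suc i) / real r) - x (real i / real r))\<^sup>2)"

text \<open>Cauchy-Schwarz on each grid cell: with \<open>d\<close> the increment, that is the
  integral of \<open>f\<close> over a cell of length \<open>1 / r\<close>, integrating the square of
  \<open>f u - r * d\<close> gives \<open>r * d\<^sup>2\<close> as a lower bound for the cell's
  share of the integral.\<close>

lemma abs_continuous_01_energy_le:
  assumes x: "abs_continuous_01 x"
    and s: "(\<integral>\<^sup>+u\<in>{0..1}. ennreal ((deriv x u)\<^sup>2) \<partial>lborel) \<le> ennreal (s\<^sup>2)"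
    and r: "1 \<le> r"
  shows "increment_energy r x \<le> s\<^sup>2"
proof -
  define f where "f u = (if \<exists>l. (x has_real_derivative l) (at u) then deriv x u else 0)" for u
  have FTC: "(f has_integral (x b - x a)) {a..b}" if "0 \<le> a" "a \<le> b" "b \<le> 1" for a b
    using x that by (rule abs_continuous_01_FTC) (auto simp: f_def DERIV_imp_deriv)
  \<comment> \<open>Integrability in the gauge sense makes \<open>f\<close> measurable for the
    completed measure, so the energy is computed over \<open>lebesgue\<close> instead of
    \<open>lborel\<close>.\<close>
  have meas: "f \<in> borel_measurable (lebesgue_on {0..1})"
    using FTC[of 0 1] by (intro integrable_imp_measurable) auto
  define G where "G u = indicator {0..1} u * (f u)\<^sup>2" for u :: real
  have "(\<lambda>u. (f u)\<^sup>2) \<in> borel_measurable (lebesgue_on {0..1})" using meas by measurable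
  then have Gm: "G \<in> borel_measurable lebesgue"
    using borel_measurable_restrict_space_iff[of "{0..1}" lebesgue "\<lambda>u. (f u)\<^sup>2"]
    by (simp add: G_def[abs_def] mult.commute)
  have "AE u in lebesgue. u \<notin> {u\<in>{0..1}. \<nexists>l. (x has_real_derivative l) (at u)}"
    using abs_continuous_01_differentiable_ae[OF x] unfolding negligible_iff_null_sets by (rule AE_not_in)
  then have "AE u in lebesgue. ennreal (G u) = ennreal ((deriv x u)\<^sup>2) * indicator {0..1} u"
    by eventually_elim (auto simp: G_def f_def split: split_indicator)
  then have "(\<integral>\<^sup>+u. ennreal (G u) \<partial>lebesgue) = (\<integral>\<^sup>+u\<in>{0..1}. ennreal ((deriv x u)\<^sup>2) \<partial>lebesgue)"
    by (rule nn_integral_cong_AE)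
  also have "\<dots> \<le> ennreal (s\<^sup>2)" using s by (simp add: nn_integral_completion)
  finally have nn: "(\<integral>\<^sup>+u. ennreal (G u) \<partial>lebesgue) \<le> ennreal (s\<^sup>2)" .
  have Gnn: "0 \<le> G u" for u by (simp add: G_def)
  have Gint: "integrable lebesgue G"
    using nn Gm Gnn by (intro integrableI_nonneg) (auto intro: le_less_trans)
  have "ennreal (integral\<^sup>L lebesgue G) \<le> ennreal (s\<^sup>2)"
    using nn nn_integral_eq_integral[OF Gint] Gnn by simp
  then have Gle: "integral\<^sup>L lebesgue G \<le> s\<^sup>2" by simp
  have "set_integrable lebesgue {0..1} (\<lambda>u. (f u)\<^sup>2)"
    using Gint by (simp add: set_integrable_def G_def[abs_def])
  from set_lebesgue_integral_eq_integral[OF this]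
  have int: "(\<lambda>u. (f u)\<^sup>2) integrable_on {0..1}" and "integral {0..1} (\<lambda>u. (f u)\<^sup>2) = integral\<^sup>L lebesgue G"
    by (simp_all add: set_lebesgue_integral_def G_def[abs_def])
  then have total: "integral {0..1} (\<lambda>u. (f u)\<^sup>2) \<le> s\<^sup>2" using Gle by simp
  have intK: "(\<lambda>u. (f u)\<^sup>2) integrable_on {a..b}" if "0 \<le> a" "b \<le> 1" for a b
    using int that by (intro integrable_on_subinterval[OF int]) auto
  define I where "I i = integral {real i / r..real (Suc i) / r} (\<lambda>u. (f u)\<^sup>2)" for i
  have piece: "real r * (x (real (Suc i) / r) - x (real i / r))\<^sup>2 \<le> I i" if i: "i < r" for i
  proof -
    define a b where "a = real i / r" and "b = real (Suc i) / r"
    have ab: "0 \<le> a" "a \<le> b" "b \<le> 1" using i by (auto simp: a_def b_def field_simps)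
    define d where "d = x b - x a"
    have ba: "b - a = 1 / r" by (simp add: a_def b_def diff_divide_distrib[symmetric])
    have 1: "(f has_integral d) {a..b}" unfolding d_def using ab by (intro FTC)
    have 2: "((\<lambda>u. (f u)\<^sup>2) has_integral I i) {a..b}"
      unfolding I_def a_def[symmetric] b_def[symmetric] using ab by (intro integrable_integral intK)
    have 3: "((\<lambda>u. (real r * d)\<^sup>2) has_integral (b - a) *\<^sub>R (real r * d)\<^sup>2) {a..b}"
      using has_integral_const_real[of "(real r * d)\<^sup>2" a b] ab by simp
    have 4: "((\<lambda>u. (f u)\<^sup>2 - (2 * real r * d) * f u + (real r * d)\<^sup>2) has_integral
        (I i - (2 * real r * d) * d + (b - a) *\<^sub>R (real r * d)\<^sup>2)) {a..b}"
      by (intro has_integral_add has_integral_diff has_integral_mult_right 1 2 3)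
    have 5: "0 \<le> (f u)\<^sup>2 - (2 * real r * d) * f u + (real r * d)\<^sup>2" for u
    proof -
      have "(f u)\<^sup>2 - (2 * real r * d) * f u + (real r * d)\<^sup>2 = (f u - real r * d)\<^sup>2"
        by (simp add: power2_eq_square algebra_simps)
      then show ?thesis by simp
    qed
    have "0 \<le> I i - (2 * real r * d) * d + (b - a) *\<^sub>R (real r * d)\<^sup>2"
      using 4 5 by (rule has_integral_nonneg)
    moreover have 6: "(b - a) *\<^sub>R (real r * d)\<^sup>2 = real r * d\<^sup>2"
      using r by (simp add: ba power2_eq_square)
    ultimately have "real r * d\<^sup>2 \<le> I i" unfolding 6 by (simp add: power2_eq_square algebra_simps)
    then show ?thesis by (simp only: d_def a_def b_def)
  qed
  have "(\<Sum>i<k. I i) = integral {0..real k / r} (\<lambda>u. (f u)\<^sup>2)" if "k \<le> r" for k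
    using that
  proof (induction k)
    case (Suc k)
    have "integral {0..real k / r} (\<lambda>u. (f u)\<^sup>2) + I k = integral {0..real (Suc k) / r} (\<lambda>u. (f u)\<^sup>2)"
      unfolding I_def using Suc.prems r by (intro Henstock_Kurzweil_Integration.integral_combine intK) (auto simp: field_simps)
    then show ?case using Suc by simp
  qed simp
  from this[of r] have "(\<Sum>i<r. I i) = integral {0..1} (\<lambda>u. (f u)\<^sup>2)" using r by simp
  moreover have "increment_energy r x \<le> (\<Sum>i<r. I i)"
    unfolding increment_energy_def sum_distrib_left by (intro sum_mono piece) simp
  ultimately show ?thesis using total by simp
qed

lemma floor_grid_tendsto:
  assumes "0 \<le> t"
  shows "(\<lambda>r. real (nat \<lfloor>real r * t\<rfloor>) / real r) \<longlonglongrightarrow> t"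
proof (rule tendsto_sandwich)
  have "real (nat \<lfloor>real r * t\<rfloor>) \<le> real r * t \<and> real r * t - 1 \<le> real (nat \<lfloor>real r * t\<rfloor>)" for r
    using assms by (auto simp: of_nat_nat)
  then show "eventually (\<lambda>r. real (nat \<lfloor>real r * t\<rfloor>) / real r \<le> t) sequentially"
    "eventually (\<lambda>r. t - 1 / real r \<le> real (nat \<lfloor>real r * t\<rfloor>) / real r) sequentially"
    by (auto intro!: eventually_sequentiallyI[of 1] simp: field_simps)
  have "(\<lambda>r. t - 1 / real r) \<longlonglongrightarrow> t - 0" by (intro tendsto_intros lim_1_over_n)
  then show "(\<lambda>r. t - 1 / real r) \<longlonglongrightarrow> t" by simp
qed auto

text \<open>With all endpoints rounded down to multiples of \<open>1 / r\<close>, the variation is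
  at most a sum of absolute grid increments over disjoint index blocks, and Cauchy-Schwarz bounds
  its square by the energy times the number of cells divided by \<open>r\<close>. Letting
  \<open>r\<close> grow removes the rounding by continuity. A single interval gives the modulus of
  continuity \<open>\<sigma> * sqrt (t - s)\<close>.\<close>

lemma energy_imp_variation_le:
  assumes cont: "continuous_on {0..1} x" and en: "\<And>r. 1 \<le> r \<Longrightarrow> increment_energy r x \<le> s\<^sup>2"
    and D: "D \<in> interval_families 0 1"
  shows "(variation_sum x D)\<^sup>2 \<le> s\<^sup>2 * (\<Sum>(s, t)\<in>D. t - s)"
proof -
  define g where "g r t = real (nat \<lfloor>real r * t\<rfloor>) / real r" for r :: nat and t :: real
  have D01: "0 \<le> fst I \<and> fst I < snd I \<and> snd I \<le> 1" if "I \<in> D" for I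
    using D that by (auto simp: interval_families_def)
  have D01': "0 \<le> fst I" "fst I \<le> 1" "0 \<le> snd I" "snd I \<le> 1" if "I \<in> D" for I
    using D01[OF that] by linarith+
  have fin: "finite D" using D by (auto simp: interval_families_def)
  have grid: "(\<Sum>I\<in>D. \<bar>x (g r (snd I)) - x (g r (fst I))\<bar>)\<^sup>2 \<le> s\<^sup>2 * (\<Sum>I\<in>D. g r (snd I) - g r (fst I))"
    if r: "1 \<le> r" for r
  proof -
    define n where "n t = nat \<lfloor>real r * t\<rfloor>" for t
    define d where "d i = x (real (Suc i) / real r) - x (real i / real r)" for i
    define A where "A I = {n (fst I)..<n (snd I)}" for I
    have nmono: "n t \<le> n t'" if "t \<le> t'" for t t'
      unfolding n_def using that by (intro nat_mono floor_mono mult_left_mono) auto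
    have nr: "n t \<le> r" if "t \<le> 1" for t
      using nmono[OF that] by (simp add: n_def)
    have "\<bar>x (g r (snd I)) - x (g r (fst I))\<bar> \<le> (\<Sum>i\<in>A I. \<bar>d i\<bar>)" if "I \<in> D" for I
    proof -
      have "x (g r (snd I)) - x (g r (fst I)) = (\<Sum>i\<in>A I. d i)"
        unfolding A_def d_def g_def n_def[symmetric]
        using sum_Suc_diff'[of "n (fst I)" "n (snd I)" "\<lambda>i. x (real i / real r)"] nmono D01[OF that]
        by (simp add: less_imp_le)
      then show ?thesis by simp
    qed
    then have "(\<Sum>I\<in>D. \<bar>x (g r (snd I)) - x (g r (fst I))\<bar>) \<le> (\<Sum>I\<in>D. \<Sum>i\<in>A I. \<bar>d i\<bar>)"
      by (rule sum_mono)
    also have "\<dots> = (\<Sum>i\<in>(\<Union>I\<in>D. A I). \<bar>d i\<bar>)"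
    proof (rule sum.UNION_disjoint[symmetric])
      show "\<forall>I\<in>D. \<forall>J\<in>D. I \<noteq> J \<longrightarrow> A I \<inter> A J = {}"
      proof (intro ballI impI)
        fix I J assume "I \<in> D" "J \<in> D" "I \<noteq> J"
        then have "snd I \<le> fst J \<or> snd J \<le> fst I"
          using D by (auto simp: interval_families_def pairwise_def)
        then show "A I \<inter> A J = {}" using nmono by (auto simp: A_def) (meson not_less order_trans)+
      qed
    qed (use fin in \<open>auto simp: A_def\<close>)
    finally have "(\<Sum>I\<in>D. \<bar>x (g r (snd I)) - x (g r (fst I))\<bar>)\<^sup>2 \<le> (\<Sum>i\<in>(\<Union>I\<in>D. A I). \<bar>d i\<bar>)\<^sup>2"
      by (intro power_mono) (auto intro: sum_nonneg)
    also have "\<dots> \<le> (\<Sum>i\<in>(\<Union>I\<in>D. A I). \<bar>d i\<bar>\<^sup>2) * card (\<Union>I\<in>D. A I)"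
      using fin by (intro sum_squared_le_sum_of_squares)
    also have "\<dots> \<le> (\<Sum>i<r. (d i)\<^sup>2) * card (\<Union>I\<in>D. A I)"
    proof (intro mult_right_mono)
      have "(\<Union>I\<in>D. A I) \<subseteq> {..<r}" using nr D01 by (fastforce simp: A_def)
      then show "(\<Sum>i\<in>(\<Union>I\<in>D. A I). \<bar>d i\<bar>\<^sup>2) \<le> (\<Sum>i<r. (d i)\<^sup>2)"
        by (simp add: sum_mono2)
    qed simp
    also have "\<dots> = increment_energy r x * (card (\<Union>I\<in>D. A I) / real r)"
      using r by (simp add: increment_energy_def d_def)
    also have "\<dots> \<le> s\<^sup>2 * (\<Sum>I\<in>D. g r (snd I) - g r (fst I))"
    proof (rule mult_mono[OF en[OF r]])
      have "real (card (\<Union>I\<in>D. A I)) \<le> (\<Sum>I\<in>D. real (card (A I)))"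
        unfolding of_nat_sum[symmetric] of_nat_le_iff by (rule card_UN_le[OF fin])
      also have "\<dots> = (\<Sum>I\<in>D. real (n (snd I)) - real (n (fst I)))"
        using nmono D01 by (intro sum.cong) (auto simp: A_def of_nat_diff less_imp_le)
      finally show "card (\<Union>I\<in>D. A I) / real r \<le> (\<Sum>I\<in>D. g r (snd I) - g r (fst I))"
        using r by (simp add: g_def n_def[symmetric] sum_divide_distrib[symmetric] diff_divide_distrib[symmetric] divide_right_mono)
    qed auto
    finally show ?thesis .
  qed
  have glim: "(\<lambda>r. g r t) \<longlonglongrightarrow> t" if "0 \<le> t" for t
    unfolding g_def by (rule floor_grid_tendsto[OF that])
  have g01: "g r t \<in> {0..1}" if "0 \<le> t" "t \<le> 1" for r t
  proof -
    have "real (nat \<lfloor>real r * t\<rfloor>) \<le> real r * t" using that by (simp add: of_nat_nat)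
    also have "\<dots> \<le> real r" using that by (simp add: mult_left_le)
    finally show ?thesis by (auto simp: g_def divide_le_eq_1)
  qed
  have xlim: "(\<lambda>r. x (g r t)) \<longlonglongrightarrow> x t" if "0 \<le> t" "t \<le> 1" for t
    using continuous_on_tendsto_compose[OF cont glim] g01 that by auto
  have "(\<Sum>I\<in>D. \<bar>x (snd I) - x (fst I)\<bar>)\<^sup>2 \<le> s\<^sup>2 * (\<Sum>I\<in>D. snd I - fst I)"
  proof (rule LIMSEQ_le)
    show "(\<lambda>r. (\<Sum>I\<in>D. \<bar>x (g r (snd I)) - x (g r (fst I))\<bar>)\<^sup>2) \<longlonglongrightarrow> (\<Sum>I\<in>D. \<bar>x (snd I) - x (fst I)\<bar>)\<^sup>2"
      by (intro tendsto_intros xlim D01')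
    show "(\<lambda>r. s\<^sup>2 * (\<Sum>I\<in>D. g r (snd I) - g r (fst I))) \<longlonglongrightarrow> s\<^sup>2 * (\<Sum>I\<in>D. snd I - fst I)"
      by (intro tendsto_intros glim D01')
  qed (use grid in blast)
  then show ?thesis by (simp add: variation_sum_def case_prod_beta)
qed

lemma energy_imp_abs_continuous_01:
  assumes cont: "continuous_on {0..1} x" and en: "\<And>r. 1 \<le> r \<Longrightarrow> increment_energy r x \<le> s\<^sup>2"
  shows "abs_continuous_01 x"
  unfolding abs_continuous_01_def
proof (intro allI impI)
  fix \<epsilon> :: real assume "0 < \<epsilon>"
  \<comment> \<open>Gives \<open>s\<^sup>2 * \<eta> < \<epsilon>\<^sup>2\<close>, also for
    \<open>s = 0\<close>.\<close>
  define \<eta> where "\<eta> = \<epsilon>\<^sup>2 / (s\<^sup>2 + 1)"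
  have s1: "0 < s\<^sup>2 + 1" by (simp add: add_nonneg_pos)
  have "0 < \<eta>" using \<open>0 < \<epsilon>\<close> s1 by (simp add: \<eta>_def)
  moreover have "(\<Sum>i<n. \<bar>x (b i) - x (a i)\<bar>) < \<epsilon>"
    if ab: "(\<forall>i<n. 0 \<le> a i \<and> a i \<le> b i \<and> b i \<le> 1) \<and>
        disjoint_family_on (\<lambda>i. {a i<..<b i}) {..<n} \<and> (\<Sum>i<n. b i - a i) < \<eta>" for n :: nat and a b
  proof -
    \<comment> \<open>Intervals with \<open>a i = b i\<close> are allowed in
      \<open>abs_continuous_01\<close> but not in an interval family.\<close>
    define J where "J = {i. i < n \<and> a i < b i}"
    define D where "D = (\<lambda>i. (a i, b i)) ` J"
    have fin: "finite J" by (simp add: J_def)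
    have sep: "b i \<le> a j \<or> b j \<le> a i" if "i \<in> J" "j \<in> J" "i \<noteq> j" for i j
    proof (rule ccontr)
      assume "\<not> ?thesis"
      then have "max (a i) (a j) < min (b i) (b j)" using that by (auto simp: J_def)
      then obtain z where "max (a i) (a j) < z" "z < min (b i) (b j)" using dense by blast
      then have "z \<in> {a i<..<b i} \<inter> {a j<..<b j}" by auto
      then show False using ab that unfolding disjoint_family_on_def J_def by blast
    qed
    have inj: "inj_on (\<lambda>i. (a i, b i)) J"
    proof (rule inj_onI, rule ccontr)
      fix i j assume ij: "i \<in> J" "j \<in> J" "(a i, b i) = (a j, b j)" "i \<noteq> j"
      then show False using sep[OF ij(1,2,4)] by (auto simp: J_def)
    qed
    have D: "D \<in> interval_families 0 1"
      unfolding interval_families_def mem_Collect_eq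
    proof (intro conjI)
      show "finite D" using fin by (simp add: D_def)
      show "\<forall>(s, t)\<in>D. 0 \<le> s \<and> s < t \<and> t \<le> 1" using ab by (auto simp: D_def J_def)
      show "pairwise (\<lambda>I J. snd I \<le> fst J \<or> snd J \<le> fst I) D"
        unfolding D_def pairwise_image by (rule pairwiseI) (use sep in auto)
    qed
    have eqz: "a i = b i" if "i < n" "i \<notin> J" for i
      using ab that by (auto simp: J_def not_less intro: antisym)
    have JS: "i < n" if "i \<in> J" for i using that by (simp add: J_def)
    have len: "(\<Sum>(s, t)\<in>D. t - s) = (\<Sum>i<n. b i - a i)"
      unfolding D_def sum.reindex[OF inj]
      by (rule sum.mono_neutral_cong_left) (auto simp: eqz JS)
    have "variation_sum x D = (\<Sum>i<n. \<bar>x (b i) - x (a i)\<bar>)"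
      unfolding D_def variation_sum_def sum.reindex[OF inj]
      by (rule sum.mono_neutral_cong_left) (auto simp: eqz JS)
    then have "(\<Sum>i<n. \<bar>x (b i) - x (a i)\<bar>)\<^sup>2 \<le> s\<^sup>2 * (\<Sum>i<n. b i - a i)"
      using energy_imp_variation_le[OF cont en D] len by simp
    also have "\<dots> \<le> s\<^sup>2 * \<eta>" using ab by (intro mult_left_mono) auto
    also have "\<dots> < (s\<^sup>2 + 1) * \<eta>" using \<open>0 < \<eta>\<close> by (simp add: algebra_simps)
    also have "\<dots> = \<epsilon>\<^sup>2" using s1 by (simp add: \<eta>_def)
    finally have sq: "(\<Sum>i<n. \<bar>x (b i) - x (a i)\<bar>)\<^sup>2 < \<epsilon>\<^sup>2" .
    show ?thesis by (rule power_less_imp_less_base[OF sq]) (use \<open>0 < \<epsilon>\<close> in simp)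
  qed
  ultimately show "\<exists>\<eta>>0. \<forall>n a b. (\<forall>i<n. 0 \<le> a i \<and> a i \<le> b i \<and> b i \<le> 1) \<and>
        disjoint_family_on (\<lambda>i. {a i<..<b i}) {..<n::nat} \<and> (\<Sum>i<n. b i - a i) < \<eta>
        \<longrightarrow> (\<Sum>i<n. \<bar>x (b i) - x (a i)\<bar>) < \<epsilon>" by blast
qed

text \<open>The grid cell around \<open>u\<close> seldom has \<open>u\<close> as an endpoint. Its
  slope is a weighted mean of the slopes to the left and to the right of \<open>u\<close>, so the
  two-sided derivative controls it. Equality is allowed on the left, as for half-open cells.\<close>

lemma straddle_quotient_tendsto:
  fixes x :: "real \<Rightarrow> real"
  assumes l: "(x has_real_derivative l) (at u)"
    and a: "a \<longlonglongrightarrow> u" "\<And>n. a n \<le> u" and b: "b \<longlonglongrightarrow> u" "\<And>n. u < b n"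
  shows "(\<lambda>n. (x (b n) - x (a n)) / (b n - a n)) \<longlonglongrightarrow> l"
proof (rule LIMSEQ_I)
  fix e :: real assume "0 < e"
  define e' where "e' = e / 2"
  have e2: "0 < e'" using \<open>0 < e\<close> by (simp add: e'_def)
  from l have "(x has_derivative (\<lambda>h. h * l)) (at u)"
    by (simp add: has_field_derivative_def mult_commute_abs)
  then obtain \<delta> where \<delta>: "0 < \<delta>" "\<And>y. \<bar>y - u\<bar> < \<delta> \<Longrightarrow> \<bar>x y - x u - (y - u) * l\<bar> \<le> e' * \<bar>y - u\<bar>"
    using e2 unfolding has_derivative_at_alt by force
  have "eventually (\<lambda>n. \<bar>a n - u\<bar> < \<delta>) sequentially" "eventually (\<lambda>n. \<bar>b n - u\<bar> < \<delta>) sequentially"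
    using a(1) b(1) \<delta>(1) by (auto simp: tendsto_iff dist_real_def)
  then have "eventually (\<lambda>n. norm ((x (b n) - x (a n)) / (b n - a n) - l) < e) sequentially"
  proof eventually_elim
    case (elim n)
    have pos: "0 < b n - a n" using a(2)[of n] b(2)[of n] by linarith
    have "(x (b n) - x (a n)) - (b n - a n) * l =
      (x (b n) - x u - (b n - u) * l) - (x (a n) - x u - (a n - u) * l)" by (simp add: algebra_simps)
    also have "\<bar>\<dots>\<bar> \<le> e' * \<bar>b n - u\<bar> + e' * \<bar>a n - u\<bar>"
      using \<delta>(2)[OF elim(1)] \<delta>(2)[OF elim(2)] by linarith
    also have "\<dots> = e' * (b n - a n)" using a(2)[of n] b(2)[of n] by (simp add: algebra_simps)
    also have "\<dots> < e * (b n - a n)" using pos \<open>0 < e\<close> by (simp add: e'_def)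
    finally have "\<bar>(x (b n) - x (a n)) - (b n - a n) * l\<bar> < e * (b n - a n)" .
    moreover have "(x (b n) - x (a n)) / (b n - a n) - l = ((x (b n) - x (a n)) - (b n - a n) * l) / (b n - a n)"
      using pos by (simp add: field_simps)
    ultimately show ?case using pos by (simp add: abs_divide pos_divide_less_eq)
  qed
  then show "\<exists>N. \<forall>n\<ge>N. norm ((x (b n) - x (a n)) / (b n - a n) - l) < e"
    by (simp add: eventually_sequentially)
qed

text \<open>Fatou's lemma: \<open>\<phi> n\<close> is the squared slope of the polygon over the grid
  of mesh \<open>1 / n\<close>, its integral is \<open>increment_energy n x\<close>, and it tends to
  the squared derivative at almost every point of the interval.\<close>

lemma energy_imp_deriv_square_integral_le:
  assumes cont: "continuous_on {0..1} x" and en: "\<And>r. 1 \<le> r \<Longrightarrow> increment_energy r x \<le> s\<^sup>2"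
  shows "(\<integral>\<^sup>+u\<in>{0..1}. ennreal ((deriv x u)\<^sup>2) \<partial>lborel) \<le> ennreal (s\<^sup>2)"
proof -
  have ac: "abs_continuous_01 x" using cont en by (rule energy_imp_abs_continuous_01)
  define c where "c n i = (real n * (x (real (Suc i) / real n) - x (real i / real n)))\<^sup>2" for n i
  define \<phi> where "\<phi> n u = (\<Sum>i<n. ennreal (c n i) * indicator {real i / n..<real (Suc i) / n} u)" for n and u :: real
  have [measurable]: "\<phi> n \<in> borel_measurable lborel" for n unfolding \<phi>_def by measurable
  have int: "(\<integral>\<^sup>+u. \<phi> n u \<partial>lborel) \<le> ennreal (s\<^sup>2)" if n: "1 \<le> n" for n
  proof -
    have "(\<integral>\<^sup>+u. \<phi> n u \<partial>lborel) = (\<Sum>i<n. ennreal (c n i) * emeasure lborel {real i / n..<real (Suc i) / n})"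
      unfolding \<phi>_def by (subst nn_integral_sum) (auto simp: nn_integral_cmult_indicator)
    also have "\<dots> = (\<Sum>i<n. ennreal (c n i * (1 / n)))"
    proof (rule sum.cong[OF refl])
      fix i
      have "real i / n \<le> real (Suc i) / n" by (simp add: divide_right_mono)
      then have "emeasure lborel {real i / n..<real (Suc i) / n} = ennreal (1 / n)"
        by (simp add: diff_divide_distrib[symmetric])
      then show "ennreal (c n i) * emeasure lborel {real i / n..<real (Suc i) / n} = ennreal (c n i * (1 / n))"
        by (simp add: ennreal_mult[symmetric] c_def)
    qed
    also have "\<dots> = ennreal (\<Sum>i<n. c n i * (1 / n))" by (intro sum_ennreal) (simp add: c_def)
    also have "(\<Sum>i<n. c n i * (1 / n)) = increment_energy n x"
      unfolding increment_energy_def sum_distrib_left using n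
      by (intro sum.cong) (auto simp: c_def power2_eq_square)
    finally show ?thesis using en[OF n] by (simp add: ennreal_leI)
  qed
  have "AE u in lebesgue. u \<notin> {u\<in>{0..1}. \<nexists>l. (x has_real_derivative l) (at u)}"
    using abs_continuous_01_differentiable_ae[OF ac] unfolding negligible_iff_null_sets by (rule AE_not_in)
  then have "AE u in lborel. u \<notin> {u\<in>{0..1}. \<nexists>l. (x has_real_derivative l) (at u)}"
    by (simp add: AE_completion_iff)
  moreover have "AE u in lborel. u \<noteq> (1 :: real)" by (rule AE_lborel_singleton)
  ultimately have "AE u in lborel. ennreal ((deriv x u)\<^sup>2) * indicator {0..1} u \<le> liminf (\<lambda>n. \<phi> n u)"
  proof eventually_elim
    case (elim u)
    show ?case
    proof (cases "u \<in> {0..1}")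
      case True
      then obtain l where l: "(x has_real_derivative l) (at u)" using elim by auto
      have u: "0 \<le> u" "u < 1" using True elim by auto
      define k where "k n = nat \<lfloor>real n * u\<rfloor>" for n
      have k: "real (k n) \<le> real n * u" "real n * u < real (k n) + 1" for n
        using u by (auto simp: k_def of_nat_nat)
      have kn: "k n < n" if "1 \<le> n" for n
      proof -
        have "real n * u < real n" using that u by simp
        then show ?thesis using k(1)[of n] by linarith
      qed
      have \<phi>_eq: "\<phi> n u = ennreal (c n (k n))" if n: "1 \<le> n" for n
      proof -
        have iff: "u \<in> {real i / n..<real (Suc i) / n} \<longleftrightarrow> i = k n" for i
        proof
          assume "u \<in> {real i / n..<real (Suc i) / n}"
          then have "real i \<le> real n * u" "real n * u < real i + 1" using n by (auto simp: field_simps)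
          then show "i = k n" using k[of n] by linarith
        next
          assume "i = k n"
          then show "u \<in> {real i / n..<real (Suc i) / n}" using k[of n] n by (auto simp: field_simps)
        qed
        have ind: "indicator {real i / n..<real (Suc i) / n} u = (if i = k n then 1 else 0 :: ennreal)" for i
          unfolding indicator_def iff of_bool_def ..
        have "\<phi> n u = (\<Sum>i<n. if i = k n then ennreal (c n i) else 0)"
          unfolding \<phi>_def ind by (intro sum.cong) auto
        then show ?thesis using kn[OF n] by simp
      qed
      have alim: "(\<lambda>n. real (k n) / real n) \<longlonglongrightarrow> u"
        unfolding k_def by (rule floor_grid_tendsto[OF u(1)])
      have "(\<lambda>n. real (k n) / real n + 1 / real n) \<longlonglongrightarrow> u + 0"
        by (intro tendsto_add alim lim_1_over_n)
      then have blim: "(\<lambda>n. real (Suc (k n)) / real n) \<longlonglongrightarrow> u"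
        by (simp add: add_divide_distrib add.commute)
      have "(\<lambda>n. (x (real (Suc (k (Suc n))) / real (Suc n)) - x (real (k (Suc n)) / real (Suc n))) /
         (real (Suc (k (Suc n))) / real (Suc n) - real (k (Suc n)) / real (Suc n))) \<longlonglongrightarrow> l"
      proof (rule straddle_quotient_tendsto[OF l])
        show "(\<lambda>n. real (k (Suc n)) / real (Suc n)) \<longlonglongrightarrow> u" using alim by (rule LIMSEQ_Suc)
        show "(\<lambda>n. real (Suc (k (Suc n))) / real (Suc n)) \<longlonglongrightarrow> u" using blim by (rule LIMSEQ_Suc)
        show "real (k (Suc n)) / real (Suc n) \<le> u" for n using k(1)[of "Suc n"] by (simp add: field_simps)
        show "u < real (Suc (k (Suc n))) / real (Suc n)" for n using k(2)[of "Suc n"] by (simp add: field_simps)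
      qed
      then have "(\<lambda>n. ((x (real (Suc (k (Suc n))) / real (Suc n)) - x (real (k (Suc n)) / real (Suc n))) /
         (real (Suc (k (Suc n))) / real (Suc n) - real (k (Suc n)) / real (Suc n)))\<^sup>2) \<longlonglongrightarrow> l\<^sup>2"
        by (intro tendsto_intros)
      also have "(\<lambda>n. ((x (real (Suc (k (Suc n))) / real (Suc n)) - x (real (k (Suc n)) / real (Suc n))) /
         (real (Suc (k (Suc n))) / real (Suc n) - real (k (Suc n)) / real (Suc n)))\<^sup>2) = (\<lambda>n. c (Suc n) (k (Suc n)))"
        by (rule ext) (simp add: c_def diff_divide_distrib[symmetric] mult.commute)
      finally have "(\<lambda>n. ennreal (c (Suc n) (k (Suc n)))) \<longlonglongrightarrow> ennreal (l\<^sup>2)"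
        by (intro tendsto_ennrealI)
      then have "(\<lambda>n. \<phi> (Suc n) u) \<longlonglongrightarrow> ennreal (l\<^sup>2)" by (simp add: \<phi>_eq)
      then have "(\<lambda>n. \<phi> n u) \<longlonglongrightarrow> ennreal (l\<^sup>2)" by (rule LIMSEQ_imp_Suc)
      then have "liminf (\<lambda>n. \<phi> n u) = ennreal (l\<^sup>2)" by (simp add: tendsto_iff_Liminf_eq_Limsup)
      then show ?thesis using True DERIV_imp_deriv[OF l] by simp
    qed simp
  qed
  then have "(\<integral>\<^sup>+u\<in>{0..1}. ennreal ((deriv x u)\<^sup>2) \<partial>lborel) \<le> (\<integral>\<^sup>+u. liminf (\<lambda>n. \<phi> n u) \<partial>lborel)"
    by (rule nn_integral_mono_AE)
  also have "\<dots> \<le> liminf (\<lambda>n. \<integral>\<^sup>+u. \<phi> n u \<partial>lborel)" by (intro nn_integral_liminf) simp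
  also have "\<dots> \<le> liminf (\<lambda>n. ennreal (s\<^sup>2))"
    using int by (intro Liminf_mono) (auto intro: eventually_sequentiallyI)
  finally show ?thesis by (simp add: Liminf_const)
qed

text \<open>Both inclusions for the limit set rest on this description: for fixed \<open>r\<close>
  the energy condition refers to finitely many values of \<open>x\<close> at rational points, hence
  is closed under pointwise limits. Continuity is listed separately because the grids say nothing
  about irrational points.\<close>

theorem strassen_set_iff:
  "x \<in> strassen_set s \<longleftrightarrow> x \<in> extensional {0..1} \<and> x 0 = 0 \<and> continuous_on {0..1} x \<and>
     (\<forall>r\<ge>1. increment_energy r x \<le> s\<^sup>2)"
proof
  assume x: "x \<in> strassen_set s"
  then have ac: "abs_continuous_01 x" by (simp add: strassen_set_def)
  have "continuous_on {0..1} x"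
    unfolding continuous_on_iff
  proof (intro ballI allI impI)
    fix u e :: real assume u: "u \<in> {0..1}" and e: "0 < e"
    obtain \<eta> where \<eta>: "0 < \<eta>"
      and H: "\<And>D. D \<in> interval_families 0 1 \<Longrightarrow> (\<Sum>(s, t)\<in>D. t - s) < \<eta> \<Longrightarrow> variation_sum x D < e"
      using abs_continuous_01_variation[OF ac e] by blast
    have "dist (x v) (x u) < e" if v: "v \<in> {0..1}" "dist v u < \<eta>" for v
    proof (cases "v = u")
      case False
      have "{(min u v, max u v)} \<in> interval_families 0 1"
        using u v False by (auto simp: interval_families_def min_def max_def)
      moreover have "(\<Sum>(s, t)\<in>{(min u v, max u v)}. t - s) < \<eta>"
        using v by (auto simp: dist_real_def)
      ultimately have "variation_sum x {(min u v, max u v)} < e" by (rule H)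
      then show ?thesis
        by (auto simp: variation_sum_def dist_real_def min_def max_def abs_minus_commute split: if_splits)
    qed (simp add: e)
    then show "\<exists>d>0. \<forall>x'\<in>{0..1}. dist x' u < d \<longrightarrow> dist (x x') (x u) < e" using \<eta> by blast
  qed
  then show "x \<in> extensional {0..1} \<and> x 0 = 0 \<and> continuous_on {0..1} x \<and>
     (\<forall>r\<ge>1. increment_energy r x \<le> s\<^sup>2)"
    using x abs_continuous_01_energy_le[OF ac] by (auto simp: strassen_set_def)
next
  assume x: "x \<in> extensional {0..1} \<and> x 0 = 0 \<and> continuous_on {0..1} x \<and>
     (\<forall>r\<ge>1. increment_energy r x \<le> s\<^sup>2)"
  then have c: "continuous_on {0..1} x" and en: "\<And>r. 1 \<le> r \<Longrightarrow> increment_energy r x \<le> s\<^sup>2" by blast+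
  show "x \<in> strassen_set s"
    unfolding strassen_set_def mem_Collect_eq
    using x energy_imp_abs_continuous_01[OF c en] energy_imp_deriv_square_integral_le[OF c en] by (intro conjI) simp_all
qed

lemma strassen_set_modulus:
  assumes x: "x \<in> strassen_set \<sigma>" and st: "0 \<le> s" "s \<le> t" "t \<le> 1" and "0 \<le> \<sigma>"
  shows "\<bar>x t - x s\<bar> \<le> \<sigma> * sqrt (t - s)"
proof (cases "s = t")
  case False
  have "{(s, t)} \<in> interval_families 0 1" using st False by (auto simp: interval_families_def)
  from energy_imp_variation_le[OF _ _ this, of x \<sigma>] x
  have "\<bar>x t - x s\<bar>\<^sup>2 \<le> \<sigma>\<^sup>2 * (t - s)" by (simp add: strassen_set_iff variation_sum_def)
  also have "\<dots> = (\<sigma> * sqrt (t - s))\<^sup>2" using st by (simp add: power_mult_distrib)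
  finally have sq: "\<bar>x t - x s\<bar>\<^sup>2 \<le> (\<sigma> * sqrt (t - s))\<^sup>2" .
  show ?thesis by (rule power2_le_imp_le[OF sq]) (use st \<open>0 \<le> \<sigma>\<close> in simp)
qed simp

section \<open>Uniform topology and compactness\<close>

abbreviation bfun01 :: "(real \<Rightarrow> real) metric" where
  "bfun01 \<equiv> funspace {0..1} euclidean_metric"

interpretation unif: Metric_space "mspace bfun01" "mdist bfun01"
  by (rule Metric_space_mspace_mdist)

lemma unif_top_eq: "unif_top = unif.mtopology"
  by (simp only: unif_top_def mtopology_of_def)

lemma mem_bfun01: "f \<in> mspace bfun01 \<longleftrightarrow> f \<in> extensional {0..1} \<and> bounded (f ` {0..1})"
  by (auto simp: Met_TC.fspace_def)

lemma mdist_bfun01_le: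
  assumes "f \<in> mspace bfun01" "g \<in> mspace bfun01"
  shows "mdist bfun01 f g \<le> a \<longleftrightarrow> (\<forall>u\<in>{0..1}. \<bar>f u - g u\<bar> \<le> a)"
  using funspace_mdist_le[OF assms, of a] by (simp add: dist_real_def)

lemma mcomplete_bfun01: "unif.mcomplete"
proof -
  have "mcomplete_of (funspace {0..1 :: real} (euclidean_metric :: real metric))"
    using Met_TC.mcomplete_funspace[where S = "{0..1 :: real}" and 'a = real]
    by (simp add: complete_UNIV euclidean_metric_def Met_TC.Self_def)
  then show ?thesis by (simp only: mcomplete_of_def)
qed

lemma bfun01I:
  assumes "f \<in> extensional {0..1}" "\<And>u. u \<in> {0..1} \<Longrightarrow> \<bar>f u\<bar> \<le> B"
  shows "f \<in> mspace bfun01"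
  unfolding mem_bfun01 bounded_iff using assms by (intro conjI exI[of _ B]) auto

lemma bfun01D:
  assumes "f \<in> mspace bfun01"
  shows "\<exists>B. \<forall>u\<in>{0..1}. \<bar>f u\<bar> \<le> B"
proof -
  obtain B where "\<forall>y\<in>f ` {0..1}. norm y \<le> B" using assms unfolding mem_bfun01 bounded_iff by blast
  then have "\<forall>u\<in>{0..1}. \<bar>f u\<bar> \<le> B" by auto
  then show ?thesis ..
qed

lemma bfun01I_limit:
  assumes "f \<in> mspace bfun01" "x \<in> extensional {0..1}" "\<And>u. u \<in> {0..1} \<Longrightarrow> \<bar>f u - x u\<bar> \<le> e"
  shows "x \<in> mspace bfun01"
proof -
  obtain B where B: "\<And>u. u \<in> {0..1} \<Longrightarrow> \<bar>f u\<bar> \<le> B"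
    using bfun01D[OF assms(1)] by blast
  have "\<bar>x u\<bar> \<le> B + e" if "u \<in> {0..1}" for u using assms(3)[OF that] B[OF that] by linarith
  then show ?thesis using assms(2) by (rule bfun01I[rotated])
qed

lemma limitin_unif_top:
  assumes f: "\<And>n. f n \<in> mspace bfun01"
  shows "limitin unif_top f x sequentially \<longleftrightarrow> x \<in> extensional {0..1} \<and>
    (\<forall>e>0. \<forall>\<^sub>F n in sequentially. \<forall>u\<in>{0..1}. \<bar>f n u - x u\<bar> \<le> e)"
    (is "_ \<longleftrightarrow> ?R")
proof
  assume "limitin unif_top f x sequentially"
  then have x: "x \<in> mspace bfun01"
    and lim: "\<And>e. 0 < e \<Longrightarrow> \<forall>\<^sub>F n in sequentially. f n \<in> mspace bfun01 \<and> mdist bfun01 (f n) x < e"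
    unfolding unif_top_eq unif.limitin_metric by blast+
  have "\<forall>\<^sub>F n in sequentially. \<forall>u\<in>{0..1}. \<bar>f n u - x u\<bar> \<le> e" if "0 < e" for e
    using lim[OF that]
  proof eventually_elim
    case (elim n)
    then have "mdist bfun01 (f n) x \<le> e" by linarith
    then show ?case unfolding mdist_bfun01_le[OF f x] .
  qed
  then show ?R using x unfolding mem_bfun01 by blast
next
  assume R: ?R
  then have "\<forall>\<^sub>F n in sequentially. \<forall>u\<in>{0..1}. \<bar>f n u - x u\<bar> \<le> 1" by simp
  then obtain n where n: "\<forall>u\<in>{0..1}. \<bar>f n u - x u\<bar> \<le> 1"
    unfolding eventually_sequentially by blast
  have x: "x \<in> mspace bfun01" using bfun01I_limit[OF f[of n]] R n by blast
  show "limitin unif_top f x sequentially"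
    unfolding unif_top_eq unif.limitin_metric
  proof (intro conjI allI impI x)
    fix e :: real assume "0 < e"
    then have "0 < e / 2" by simp
    then have "\<forall>\<^sub>F n in sequentially. \<forall>u\<in>{0..1}. \<bar>f n u - x u\<bar> \<le> e / 2" using R by blast
    then show "\<forall>\<^sub>F n in sequentially. f n \<in> mspace bfun01 \<and> mdist bfun01 (f n) x < e"
    proof eventually_elim
      case (elim n)
      then have "mdist bfun01 (f n) x \<le> e / 2" unfolding mdist_bfun01_le[OF f x] .
      then show ?case using f \<open>0 < e\<close> by simp
    qed
  qed
qed

text \<open>A version of Arzela-Ascoli for functions with jumps: for each \<open>e\<close> the
  oscillation has to be small only up to \<open>e\<close>, and finitely many members may be exempt.
  The remaining ones are coded by their grid values rounded to multiples of \<open>e\<close>; the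
  modulus and \<open>f 0 = 0\<close> bound these values by \<open>r * e\<close>, so there are
  finitely many codes, and equal codes force a distance of at most \<open>3 * e\<close>.\<close>

lemma mtotally_bounded_equicontinuous:
  assumes F: "\<F> \<subseteq> mspace bfun01"
    and equi: "\<And>e. 0 < e \<Longrightarrow> \<exists>\<F>0. finite \<F>0 \<and> \<F>0 \<subseteq> \<F> \<and> (\<exists>\<delta>>0. \<forall>f\<in>\<F> - \<F>0. f 0 = 0 \<and>
      (\<forall>u\<in>{0..1}. \<forall>v\<in>{0..1}. \<bar>u - v\<bar> \<le> \<delta> \<longrightarrow> \<bar>f u - f v\<bar> \<le> e))"
  shows "unif.mtotally_bounded \<F>"
  unfolding unif.mtotally_bounded_def
proof (intro allI impI)
  fix \<epsilon> :: real assume "0 < \<epsilon>"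
  define e where "e = \<epsilon> / 4"
  have e: "0 < e" using \<open>0 < \<epsilon>\<close> by (simp add: e_def)
  obtain \<F>0 \<delta> where F0: "finite \<F>0" "\<F>0 \<subseteq> \<F>" and \<delta>: "0 < \<delta>"
    and zero: "\<And>f. f \<in> \<F> - \<F>0 \<Longrightarrow> f 0 = 0"
    and mod: "\<And>f u v. f \<in> \<F> - \<F>0 \<Longrightarrow> u \<in> {0..1} \<Longrightarrow> v \<in> {0..1} \<Longrightarrow> \<bar>u - v\<bar> \<le> \<delta> \<Longrightarrow> \<bar>f u - f v\<bar> \<le> e"
    using equi[OF e] by blast
  obtain r0 where "inverse (real (Suc r0)) < \<delta>" using reals_Archimedean[OF \<delta>] by blast
  then obtain r :: nat where r: "1 \<le> r" "1 / real r \<le> \<delta>"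
    by (metis One_nat_def Suc_le_eq inverse_eq_divide less_imp_le zero_less_Suc)
  define code where "code f = (\<lambda>i\<in>{..r}. \<lfloor>f (real i / r) / e\<rfloor>)" for f :: "real \<Rightarrow> real"
  have grid01: "real i / r \<in> {0..1}" if "i \<le> r" for i using that r by (auto simp: field_simps)
  have grid: "\<bar>f (real i / r)\<bar> \<le> real i * e" if "f \<in> \<F> - \<F>0" "i \<le> r" for f i
    using that(2)
  proof (induction i)
    case 0
    then show ?case using zero[OF that(1)] by simp
  next
    case (Suc i)
    have "real (Suc i) / r - real i / r = 1 / r" by (simp add: diff_divide_distrib[symmetric])
    then have "\<bar>f (real (Suc i) / r) - f (real i / r)\<bar> \<le> e"
      using Suc.prems r by (intro mod[OF that(1)] grid01) auto
    moreover have "real (Suc i) * e = real i * e + e" by (simp add: algebra_simps)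
    ultimately show ?case using Suc by simp
  qed
  have "code ` (\<F> - \<F>0) \<subseteq> PiE {..r} (\<lambda>_. {- int r - 1..int r})"
  proof (rule image_subsetI)
    fix f assume f: "f \<in> \<F> - \<F>0"
    show "code f \<in> PiE {..r} (\<lambda>_. {- int r - 1..int r})"
    proof (rule PiE_I)
      fix i assume i: "i \<in> {..r}"
      then have "\<bar>f (real i / r)\<bar> \<le> real i * e" using grid[OF f] by simp
      also have "\<dots> \<le> real r * e" using i e by (intro mult_right_mono) auto
      finally have "\<bar>f (real i / r) / e\<bar> \<le> real r" using e by (simp add: abs_divide divide_le_eq)
      then have "- real r \<le> f (real i / r) / e" "f (real i / r) / e \<le> real r" by linarith+
      then have "- int r - 1 \<le> \<lfloor>f (real i / r) / e\<rfloor>" "\<lfloor>f (real i / r) / e\<rfloor> \<le> int r"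
        by (simp_all add: le_floor_iff floor_le_iff)
      then show "code f i \<in> {- int r - 1..int r}" using i by (simp add: code_def)
    qed (simp add: code_def)
  qed
  then have fin: "finite (code ` (\<F> - \<F>0))"
    by (rule finite_subset) (intro finite_PiE, auto)
  define rep where "rep = inv_into (\<F> - \<F>0) code"
  have rep: "rep c \<in> \<F> - \<F>0" "code (rep c) = c" if "c \<in> code ` (\<F> - \<F>0)" for c
    using inv_into_into[OF that] f_inv_into_f[OF that] by (simp_all only: rep_def)
  have close: "mdist bfun01 (rep (code f)) f < \<epsilon>" if f: "f \<in> \<F> - \<F>0" for f
  proof -
    let ?g = "rep (code f)"
    have g: "?g \<in> \<F> - \<F>0" "code ?g = code f" using rep[of "code f"] f by auto
    have "\<bar>?g u - f u\<bar> \<le> 3 * e" if u: "u \<in> {0..1}" for u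
    proof -
      define i where "i = nat \<lfloor>real r * u\<rfloor>"
      have i: "real i \<le> real r * u" "real r * u < real i + 1" using u by (auto simp: i_def)
      have "real r * u \<le> real r" using u by (simp add: mult_left_le)
      then have ir: "i \<le> r" using i by linarith
      have "u - real i / r = (real r * u - real i) / r" using r by (simp add: field_simps)
      also have "\<bar>\<dots>\<bar> \<le> 1 / r" unfolding abs_divide using i by (auto intro: divide_right_mono)
      finally have "\<bar>u - real i / r\<bar> \<le> 1 / r" .
      then have ui: "\<bar>u - real i / r\<bar> \<le> \<delta>" using r by linarith
      have "code ?g i = code f i" using g(2) by simp
      then have "\<lfloor>?g (real i / r) / e\<rfloor> = \<lfloor>f (real i / r) / e\<rfloor>" using ir by (simp add: code_def)
      then have "\<bar>?g (real i / r) / e - f (real i / r) / e\<bar> \<le> 1" by linarith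
      then have "\<bar>?g (real i / r) - f (real i / r)\<bar> \<le> e"
        using e by (simp add: diff_divide_distrib[symmetric] abs_divide divide_le_eq)
      moreover have "\<bar>?g u - ?g (real i / r)\<bar> \<le> e" by (rule mod[OF g(1) u grid01[OF ir] ui])
      moreover have "\<bar>f u - f (real i / r)\<bar> \<le> e" by (rule mod[OF f u grid01[OF ir] ui])
      ultimately show ?thesis by linarith
    qed
    then have "mdist bfun01 ?g f \<le> 3 * e"
      using F f g(1) by (subst mdist_bfun01_le) auto
    then show ?thesis using e by (simp add: e_def)
  qed
  show "\<exists>K. finite K \<and> K \<subseteq> \<F> \<and> \<F> \<subseteq> (\<Union>x\<in>K. unif.mball x \<epsilon>)"
  proof (intro exI[of _ "\<F>0 \<union> rep ` code ` (\<F> - \<F>0)"] conjI)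
    show "finite (\<F>0 \<union> rep ` code ` (\<F> - \<F>0))" using F0 fin by simp
    show "\<F>0 \<union> rep ` code ` (\<F> - \<F>0) \<subseteq> \<F>" using F0 rep(1) by blast
    show "\<F> \<subseteq> (\<Union>x\<in>\<F>0 \<union> rep ` code ` (\<F> - \<F>0). unif.mball x \<epsilon>)"
    proof
      fix f assume f: "f \<in> \<F>"
      show "f \<in> (\<Union>x\<in>\<F>0 \<union> rep ` code ` (\<F> - \<F>0). unif.mball x \<epsilon>)"
      proof (cases "f \<in> \<F>0")
        case True
        then have "f \<in> unif.mball f \<epsilon>" using F f \<open>0 < \<epsilon>\<close> by (intro unif.centre_in_mball_iff[THEN iffD2]) auto
        then show ?thesis using True by blast
      next
        case False
        then have f': "f \<in> \<F> - \<F>0" using f by blast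
        then have "rep (code f) \<in> \<F>" using rep(1)[of "code f"] by blast
        then have "f \<in> unif.mball (rep (code f)) \<epsilon>"
          using close[OF f'] F f unfolding unif.in_mball by blast
        then show ?thesis using f' by blast
      qed
    qed
  qed
qed

section \<open>Compactness of the limit sets\<close>

lemma strassen_set_bfun01: "strassen_set s \<subseteq> mspace bfun01"
proof
  fix x assume x: "x \<in> strassen_set s"
  then have "compact (x ` {0..1})" by (intro compact_continuous_image) (auto simp: strassen_set_iff)
  then show "x \<in> mspace bfun01" using x compact_imp_bounded unfolding mem_bfun01 strassen_set_iff by blast
qed

text \<open>Pointwise convergence carries the energies to the limit. The energy bounds may start
  late, depending on \<open>r\<close>, and have a vanishing slack \<open>c n\<close>; a sequence of
  rescaled paths provides no more than that.\<close>

lemma strassen_set_uniform_limit: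
  assumes f: "\<And>n. f n \<in> extensional {0..1} \<and> f n 0 = 0"
    and x: "x \<in> extensional {0..1}" "continuous_on {0..1} x"
    and lim: "\<And>u. u \<in> {0..1} \<Longrightarrow> (\<lambda>n. f n u) \<longlonglongrightarrow> x u"
    and en: "\<And>r. 1 \<le> r \<Longrightarrow> \<forall>\<^sub>F n in sequentially. increment_energy r (f n) \<le> s\<^sup>2 + c n" and c: "c \<longlonglongrightarrow> 0"
  shows "x \<in> strassen_set s"
  unfolding strassen_set_iff
proof (intro conjI allI impI x)
  show "x 0 = 0" using LIMSEQ_unique[OF lim[of 0]] f by simp
  fix r :: nat assume r: "1 \<le> r"
  have grid01: "real i / r \<in> {0..1}" if "i \<le> r" for i using that r by (auto simp: field_simps)
  have "(\<lambda>n. increment_energy r (f n)) \<longlonglongrightarrow> increment_energy r x"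
    unfolding increment_energy_def by (intro tendsto_intros lim grid01) auto
  moreover have "(\<lambda>n. s\<^sup>2 + c n) \<longlonglongrightarrow> s\<^sup>2 + 0" by (intro tendsto_intros c)
  ultimately show "increment_energy r x \<le> s\<^sup>2"
    using tendsto_le[OF sequentially_bot _ _ en[OF r]] by simp
qed

lemma compactin_strassen_set:
  assumes "0 \<le> s"
  shows "compactin unif_top (strassen_set s)"
proof -
  have "unif.mtotally_bounded (strassen_set s)"
  proof (rule mtotally_bounded_equicontinuous[OF strassen_set_bfun01])
    fix e :: real assume e: "0 < e"
    \<comment> \<open>Makes \<open>s * sqrt \<delta>\<close> at most \<open>e\<close> in the bound
      of \<open>strassen_set_modulus\<close>; the summand 1 covers \<open>s = 0\<close>.\<close>
    define \<delta> where "\<delta> = (e / (s + 1))\<^sup>2"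
    have "sqrt \<delta> = e / (s + 1)" unfolding \<delta>_def real_sqrt_abs using e assms by simp
    then have "s * sqrt \<delta> = s * e / (s + 1)" by simp
    also have "\<dots> \<le> e" using e assms by (simp add: field_simps)
    finally have \<delta>: "0 < \<delta>" "s * sqrt \<delta> \<le> e" using e assms by (simp_all add: \<delta>_def)
    have "\<bar>x u - x v\<bar> \<le> e" if x: "x \<in> strassen_set s" "u \<in> {0..1}" "v \<in> {0..1}" "\<bar>u - v\<bar> \<le> \<delta>" for x u v
    proof -
      have "\<bar>x (max u v) - x (min u v)\<bar> \<le> s * sqrt (max u v - min u v)"
        using x assms by (intro strassen_set_modulus) auto
      also have "\<dots> \<le> s * sqrt \<delta>" using x(4) assms by (intro mult_left_mono real_sqrt_le_mono) auto
      finally show ?thesis using \<delta>(2) by (auto simp: max_def min_def split: if_splits)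
    qed
    then show "\<exists>\<F>0. finite \<F>0 \<and> \<F>0 \<subseteq> strassen_set s \<and> (\<exists>\<delta>>0. \<forall>f\<in>strassen_set s - \<F>0. f 0 = 0 \<and>
      (\<forall>u\<in>{0..1}. \<forall>v\<in>{0..1}. \<bar>u - v\<bar> \<le> \<delta> \<longrightarrow> \<bar>f u - f v\<bar> \<le> e))"
      using \<delta>(1) by (intro exI[of _ "{}"] conjI exI[of _ \<delta>]) (auto simp: strassen_set_iff)
  qed
  then have "compactin unif.mtopology (unif.mtopology closure_of strassen_set s)"
    using unif.mtotally_bounded_eq_compact_closure_of[OF mcomplete_bfun01] by blast
  moreover have "closedin unif.mtopology (strassen_set s)"
    unfolding unif.metric_closedin_iff_sequentially_closed
  proof (intro conjI allI impI strassen_set_bfun01)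
    fix f x assume fx: "range f \<subseteq> strassen_set s \<and> limitin unif.mtopology f x sequentially"
    then have fS: "f n \<in> strassen_set s" for n by blast
    then have fb: "f n \<in> mspace bfun01" for n using strassen_set_bfun01 by blast
    have fx': "limitin unif_top f x sequentially" using fx unfolding unif_top_eq by blast
    have lim: "x \<in> extensional {0..1}"
      "\<And>e. 0 < e \<Longrightarrow> \<forall>\<^sub>F n in sequentially. \<forall>u\<in>{0..1}. \<bar>f n u - x u\<bar> \<le> e"
      using iffD1[OF limitin_unif_top[OF fb] fx'] by blast+
    have "uniform_limit {0..1} f x sequentially"
    proof (rule uniform_limitI)
      fix e :: real assume "0 < e"
      then have "0 < e / 2" by simp
      from lim(2)[OF this] show "\<forall>\<^sub>F n in sequentially. \<forall>u\<in>{0..1}. dist (f n u) (x u) < e"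
        by eventually_elim (use \<open>0 < e\<close> in \<open>fastforce simp: dist_real_def\<close>)
    qed
    then have "continuous_on {0..1} x"
      by (rule uniform_limit_theorem[rotated]) (use fS in \<open>auto simp: strassen_set_iff\<close>)
    moreover have "(\<lambda>n. f n u) \<longlonglongrightarrow> x u" if "u \<in> {0..1}" for u
      using \<open>uniform_limit _ _ _ _\<close> that by (rule tendsto_uniform_limitI)
    ultimately show "x \<in> strassen_set s"
      using fS lim(1) by (intro strassen_set_uniform_limit[of f x s "\<lambda>_. 0"]) (auto simp: strassen_set_iff)
  qed
  ultimately show ?thesis unfolding unif_top_eq by (simp add: closure_of_closedin)
qed

text \<open>Extractions are made for one index after another. Since \<open>P\<close> is inherited by
  subsequences, what was gained for earlier indices is kept.\<close>

lemma common_subsequence: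
  fixes P :: "'i \<Rightarrow> (nat \<Rightarrow> nat) \<Rightarrow> bool"
  assumes "finite I"
    and ex: "\<And>i s. i \<in> I \<Longrightarrow> strict_mono s \<Longrightarrow> \<exists>r :: nat \<Rightarrow> nat. strict_mono r \<and> P i (s \<circ> r)"
    and sub: "\<And>i s (r :: nat \<Rightarrow> nat). P i s \<Longrightarrow> strict_mono r \<Longrightarrow> P i (s \<circ> r)"
  shows "\<exists>s. strict_mono s \<and> (\<forall>i\<in>I. P i s)"
  using assms(1) ex
proof (induction I rule: finite_induct)
  case empty
  then show ?case by (auto intro: exI[of _ id] simp: strict_mono_def)
next
  case (insert i I)
  then obtain s where s: "strict_mono s" "\<forall>j\<in>I. P j s" by auto
  then obtain r where r: "strict_mono r" "P i (s \<circ> r)" using insert.prems[of i s] by blast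
  then have "\<forall>j\<in>insert i I. P j (s \<circ> r)" using s sub by auto
  then show ?case using strict_mono_o[OF s(1) r(1)] by blast
qed

lemma limitin_subseq:
  fixes f :: "nat \<Rightarrow> 'a" and r :: "nat \<Rightarrow> nat"
  assumes "limitin T f x sequentially" "strict_mono r"
  shows "limitin T (f \<circ> r) x sequentially"
  using assms unfolding limitin_sequentially by (metis comp_apply le_trans seq_suble)

lemma compactin_unif_subsequence:
  fixes f :: "nat \<Rightarrow> real \<Rightarrow> real"
  assumes "compactin unif_top K" "range f \<subseteq> K"
  obtains L r where "L \<in> K" "strict_mono r" "limitin unif_top (f \<circ> r) L sequentially"
proof -
  from assms(1)[unfolded unif_top_eq unif.compactin_sequentially]
  have "range f \<subseteq> K \<longrightarrow> (\<exists>l r. l \<in> K \<and> strict_mono r \<and> limitin unif.mtopology (f \<circ> r) l sequentially)"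
    by (rule conjunct2[THEN spec])
  then show ?thesis using assms(2) that unfolding unif_top_eq by blast
qed

lemma limitin_unif_top_sum:
  fixes f :: "'i \<Rightarrow> nat \<Rightarrow> real \<Rightarrow> real"
  assumes f: "\<And>i n. i \<in> I \<Longrightarrow> f i n \<in> mspace bfun01" and "finite I"
    and lim: "\<And>i. i \<in> I \<Longrightarrow> limitin unif_top (f i) (L i) sequentially"
  shows "limitin unif_top (\<lambda>n. \<lambda>u\<in>{0..1}. \<Sum>i\<in>I. f i n u) (\<lambda>u\<in>{0..1}. \<Sum>i\<in>I. L i u) sequentially"
proof -
  have b: "(\<lambda>u\<in>{0..1}. \<Sum>i\<in>I. g i u) \<in> mspace bfun01" if "\<And>i. i \<in> I \<Longrightarrow> g i \<in> mspace bfun01" for g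
  proof -
    have "\<forall>i\<in>I. \<exists>B. \<forall>u\<in>{0..1}. \<bar>g i u\<bar> \<le> B"
      using that bfun01D by blast
    from bchoice[OF this] obtain B where B: "\<And>i u. i \<in> I \<Longrightarrow> u \<in> {0..1} \<Longrightarrow> \<bar>g i u\<bar> \<le> B i" by blast
    have "\<bar>\<Sum>i\<in>I. g i u\<bar> \<le> (\<Sum>i\<in>I. B i)" if "u \<in> {0..1}" for u
      using B that by (intro order_trans[OF sum_abs] sum_mono) auto
    then show ?thesis by (intro bfun01I[of _ "\<Sum>i\<in>I. B i"]) auto
  qed
  show ?thesis
  proof (subst limitin_unif_top, rule b, rule f, assumption, intro conjI allI impI)
    fix e :: real assume "0 < e"
    define e' where "e' = e / (card I + 1)"
    have e': "0 < e'" using \<open>0 < e\<close> by (simp add: e'_def)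
    have "\<forall>\<^sub>F n in sequentially. \<forall>u\<in>{0..1}. \<bar>f i n u - L i u\<bar> \<le> e'" if "i \<in> I" for i
      using iffD1[OF limitin_unif_top[OF f[OF that]] lim[OF that]] e' by blast
    then have "\<forall>\<^sub>F n in sequentially. \<forall>i\<in>I. \<forall>u\<in>{0..1}. \<bar>f i n u - L i u\<bar> \<le> e'"
      using \<open>finite I\<close> by (simp add: eventually_ball_finite_distrib)
    then show "\<forall>\<^sub>F n in sequentially. \<forall>u\<in>{0..1}.
        \<bar>(\<lambda>u\<in>{0..1}. \<Sum>i\<in>I. f i n u) u - (\<lambda>u\<in>{0..1}. \<Sum>i\<in>I. L i u) u\<bar> \<le> e"
    proof eventually_elim
      case (elim n)
      have "\<bar>(\<Sum>i\<in>I. f i n u) - (\<Sum>i\<in>I. L i u)\<bar> \<le> e" if "u \<in> {0..1}" for u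
      proof -
        have "\<bar>(\<Sum>i\<in>I. f i n u) - (\<Sum>i\<in>I. L i u)\<bar> \<le> (\<Sum>i\<in>I. \<bar>f i n u - L i u\<bar>)"
          unfolding sum_subtractf[symmetric] by (rule sum_abs)
        also have "\<dots> \<le> (\<Sum>i\<in>I. e')" using elim that by (intro sum_mono) auto
        also have "\<dots> \<le> (card I + 1) * e'" using e' by (simp add: algebra_simps)
        also have "\<dots> = e" by (simp add: e'_def)
        finally show ?thesis .
      qed
      then show ?case by simp
    qed
  qed simp
qed

text \<open>The set is a continuous image of a product of compact sets. In terms of sequences:
  choose summands in the sets \<open>strassen_set (\<sigma> i)\<close>, extract a common convergent
  subsequence, and add the limits.\<close>

lemma compactin_strassen_sum_set:
  assumes "\<And>i. i \<in> {1..l} \<Longrightarrow> 0 \<le> \<sigma> i"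
  shows "compactin unif_top (strassen_sum_set l \<sigma>)"
proof -
  have "\<exists>x r. x \<in> strassen_sum_set l \<sigma> \<and> strict_mono r \<and> limitin unif_top (f \<circ> r) x sequentially"
    if f: "range f \<subseteq> strassen_sum_set l \<sigma>" for f :: "nat \<Rightarrow> real \<Rightarrow> real"
  proof -
    have "\<forall>n. \<exists>xs. (\<forall>i\<in>{1..l}. xs i \<in> strassen_set (\<sigma> i)) \<and> f n = (\<lambda>u\<in>{0..1}. \<Sum>i=1..l. xs i u)"
      using f by (auto simp: strassen_sum_set_def)
    from choice[OF this] obtain xs where xs: "\<And>n i. i \<in> {1..l} \<Longrightarrow> xs n i \<in> strassen_set (\<sigma> i)"
      and fxs: "\<And>n. f n = (\<lambda>u\<in>{0..1}. \<Sum>i=1..l. xs n i u)" by blast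
    have "\<exists>s. strict_mono s \<and> (\<forall>i\<in>{1..l}. \<exists>L. L \<in> strassen_set (\<sigma> i) \<and> limitin unif_top ((\<lambda>n. xs n i) \<circ> s) L sequentially)"
    proof (rule common_subsequence[where P = "\<lambda>i s. \<exists>L. L \<in> strassen_set (\<sigma> i) \<and> limitin unif_top ((\<lambda>n. xs n i) \<circ> s) L sequentially"])
      fix i and s :: "nat \<Rightarrow> nat" assume i: "i \<in> {1..l}" and "strict_mono s"
      have "range ((\<lambda>n. xs n i) \<circ> s) \<subseteq> strassen_set (\<sigma> i)" using xs[OF i] by auto
      from compactin_unif_subsequence[OF compactin_strassen_set[OF assms[OF i]] this]
      obtain L r where "L \<in> strassen_set (\<sigma> i)" "strict_mono r"
        "limitin unif_top (((\<lambda>n. xs n i) \<circ> s) \<circ> r) L sequentially" .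
      then show "\<exists>r. strict_mono r \<and> (\<exists>L. L \<in> strassen_set (\<sigma> i) \<and> limitin unif_top ((\<lambda>n. xs n i) \<circ> (s \<circ> r)) L sequentially)"
        unfolding comp_assoc by blast
    next
      fix i and s r :: "nat \<Rightarrow> nat"
      assume "\<exists>L. L \<in> strassen_set (\<sigma> i) \<and> limitin unif_top ((\<lambda>n. xs n i) \<circ> s) L sequentially" "strict_mono r"
      then obtain L where "L \<in> strassen_set (\<sigma> i)" "limitin unif_top ((\<lambda>n. xs n i) \<circ> s) L sequentially"
        by (elim exE conjE)
      then show "\<exists>L. L \<in> strassen_set (\<sigma> i) \<and> limitin unif_top ((\<lambda>n. xs n i) \<circ> (s \<circ> r)) L sequentially"
        using limitin_subseq[OF _ \<open>strict_mono r\<close>, of unif_top "(\<lambda>n. xs n i) \<circ> s" L]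
        by (intro exI[of _ L]) (simp add: comp_assoc)
    qed simp
    then obtain s where s: "strict_mono s"
      "\<forall>i\<in>{1..l}. \<exists>L. L \<in> strassen_set (\<sigma> i) \<and> limitin unif_top ((\<lambda>n. xs n i) \<circ> s) L sequentially"
      by (elim exE conjE)
    from bchoice[OF s(2)] obtain L where L0: "\<forall>i\<in>{1..l}. L i \<in> strassen_set (\<sigma> i) \<and>
        limitin unif_top ((\<lambda>n. xs n i) \<circ> s) (L i) sequentially" ..
    have L: "L i \<in> strassen_set (\<sigma> i)" "limitin unif_top (\<lambda>n. xs (s n) i) (L i) sequentially"
      if "i \<in> {1..l}" for i
      using bspec[OF L0 that] by (simp_all add: comp_def)
    have "limitin unif_top (\<lambda>n. \<lambda>u\<in>{0..1}. \<Sum>i\<in>{1..l}. xs (s n) i u) (\<lambda>u\<in>{0..1}. \<Sum>i\<in>{1..l}. L i u) sequentially"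
      by (rule limitin_unif_top_sum) (use xs strassen_set_bfun01 L(2) in auto)
    then have "limitin unif_top (f \<circ> s) (\<lambda>u\<in>{0..1}. \<Sum>i=1..l. L i u) sequentially"
      by (simp add: comp_def fxs)
    moreover have "(\<lambda>u\<in>{0..1}. \<Sum>i=1..l. L i u) \<in> strassen_sum_set l \<sigma>"
      unfolding strassen_sum_set_def mem_Collect_eq by (intro exI[of _ L] conjI ballI L(1) refl)
    ultimately show ?thesis using s(1) by blast
  qed
  moreover have "strassen_sum_set l \<sigma> \<subseteq> mspace bfun01"
  proof
    fix x assume "x \<in> strassen_sum_set l \<sigma>"
    then obtain xs where xs: "\<forall>i\<in>{1..l}. xs i \<in> strassen_set (\<sigma> i)"
      and x: "x = (\<lambda>u\<in>{0..1}. \<Sum>i=1..l. xs i u)"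
      unfolding strassen_sum_set_def mem_Collect_eq by (elim exE conjE)
    have "continuous_on {0..1} (\<lambda>u. \<Sum>i=1..l. xs i u)"
      using xs by (intro continuous_on_sum) (simp add: strassen_set_iff)
    then have "compact ((\<lambda>u. \<Sum>i=1..l. xs i u) ` {0..1})" by (intro compact_continuous_image) auto
    then have "bounded ((\<lambda>u. \<Sum>i=1..l. xs i u) ` {0..1})" by (rule compact_imp_bounded)
    then obtain B where B: "\<forall>y\<in>(\<lambda>u. \<Sum>i=1..l. xs i u) ` {0..1}. norm y \<le> B"
      unfolding bounded_iff by (rule exE)
    show "x \<in> mspace bfun01" unfolding x by (rule bfun01I[of _ B]) (use B in auto)
  qed
  ultimately show ?thesis unfolding unif_top_eq unif.compactin_sequentially by blast
qed

section \<open>Paths satisfying the law of the iterated logarithm\<close>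

definition lil_scale :: "real \<Rightarrow> real" where
  "lil_scale t = sqrt (2 * t * ln (ln t))"

lemma lnln_pos: "3 \<le> t \<Longrightarrow> 0 < ln (ln t)" for t :: real
proof -
  assume t: "3 \<le> t"
  have "exp 1 < (3 :: real)" using e_less_272 by simp
  then have "1 < ln t" using t by (subst ln_exp[of 1, symmetric], subst ln_less_cancel_iff) auto
  then show ?thesis by simp
qed

lemma lil_scale_pos: "3 \<le> t \<Longrightarrow> 0 < lil_scale t"
  using lnln_pos[of t] by (simp add: lil_scale_def)

lemma lil_scale_mono:
  assumes "3 \<le> s" "s \<le> t" shows "lil_scale s \<le> lil_scale t"
proof -
  have "0 < ln s" using assms by simp
  moreover have "ln s \<le> ln t" using assms by simp
  ultimately have "ln (ln s) \<le> ln (ln t)" by simp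
  then show ?thesis unfolding lil_scale_def using assms lnln_pos[of s]
    by (intro real_sqrt_le_mono mult_mono) auto
qed

lemma lil_scale_double: "\<forall>\<^sub>F t in at_top. lil_scale (2 * t) \<le> 2 * lil_scale t"
  unfolding lil_scale_def by real_asymp

text \<open>
  The ratio of consecutive times tends to 1, yet they are sparse enough for the Borel--Cantelli
  lemma to apply to every energy bound exceeding 1; no geometric sequence has both properties.
\<close>

definition scale_time :: "nat \<Rightarrow> real" where
  "scale_time j = exp (real j / ln (real j))"

lemma scale_time_at_top: "filterlim scale_time at_top sequentially"
  unfolding scale_time_def[abs_def] by real_asymp

lemma scale_time_ratio: "(\<lambda>j. scale_time (Suc j) / scale_time j) \<longlonglongrightarrow> 1"
  unfolding scale_time_def by real_asymp

lemma lil_scale_time_ratio: "(\<lambda>j. lil_scale (scale_time (Suc j)) / lil_scale (scale_time j)) \<longlonglongrightarrow> 1"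
  unfolding scale_time_def lil_scale_def by real_asymp


text \<open>The paths have jumps, so oscillations can be small only up to \<open>e\<close> and for
  large \<open>t\<close>; this is what \<open>mtotally_bounded_equicontinuous\<close> tolerates.
  Local boundedness makes each rescaled path a point of the space of bounded functions.\<close>

definition asymp_equicontinuous :: "(real \<Rightarrow> real) \<Rightarrow> bool" where
  "asymp_equicontinuous z \<longleftrightarrow> z 0 = 0 \<and> (\<forall>t\<ge>0. \<exists>B. \<forall>u\<in>{0..t}. \<bar>z u\<bar> \<le> B) \<and>
     (\<forall>e>0. \<exists>\<delta>>0. \<exists>t0. \<forall>t\<ge>t0. \<forall>u\<in>{0..1}. \<forall>v\<in>{0..1}.
        \<bar>u - v\<bar> \<le> \<delta> \<longrightarrow> \<bar>z (t * u) - z (t * v)\<bar> \<le> e * lil_scale t)"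

section \<open>Relative compactness and boundedness of rescaled paths\<close>

definition path_zeta :: "(real \<Rightarrow> real) \<Rightarrow> real \<Rightarrow> real \<Rightarrow> real" where
  "path_zeta z t = (\<lambda>u\<in>{0..1}. (2 * t * ln (ln t)) powr (-1/2) * z (t * u))"

lemma path_zeta_eq:
  assumes "3 \<le> t" "u \<in> {0..1}"
  shows "path_zeta z t u = z (t * u) / lil_scale t"
proof -
  have "0 < 2 * t * ln (ln t)" using assms lnln_pos[of t] by simp
  then have "(2 * t * ln (ln t)) powr (- (1/2)) = inverse (lil_scale t)"
    unfolding lil_scale_def by (simp only: powr_minus powr_half_sqrt)
  then have eq: "(2 * t * ln (ln t)) powr (-1/2) = inverse (lil_scale t)" by simp
  show ?thesis
    unfolding path_zeta_def restrict_apply if_P[OF assms(2)] eq by (simp only: divide_inverse mult.commute)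
qed

lemma asymp_equicontinuousD:
  assumes "asymp_equicontinuous z" "0 < e"
  obtains \<delta> t0 where "0 < \<delta>" "3 \<le> t0"
    "\<And>t u v. t0 \<le> t \<Longrightarrow> u \<in> {0..1} \<Longrightarrow> v \<in> {0..1} \<Longrightarrow> \<bar>u - v\<bar> \<le> \<delta> \<Longrightarrow>
      \<bar>z (t * u) / lil_scale t - z (t * v) / lil_scale t\<bar> \<le> e"
proof -
  obtain \<delta> t0 where d: "0 < \<delta>" and
    H: "\<forall>t\<ge>t0. \<forall>u\<in>{0..1}. \<forall>v\<in>{0..1}. \<bar>u - v\<bar> \<le> \<delta> \<longrightarrow> \<bar>z (t * u) - z (t * v)\<bar> \<le> e * lil_scale t"
    using assms(1)[unfolded asymp_equicontinuous_def, THEN conjunct2, THEN conjunct2, rule_format, OF assms(2)]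
    by (elim exE conjE)
  have "\<bar>z (t * u) / lil_scale t - z (t * v) / lil_scale t\<bar> \<le> e"
    if "max 3 t0 \<le> t" "u \<in> {0..1}" "v \<in> {0..1}" "\<bar>u - v\<bar> \<le> \<delta>" for t u v
  proof -
    have "\<bar>z (t * u) - z (t * v)\<bar> \<le> e * lil_scale t" using H that by simp
    then show ?thesis using lil_scale_pos[of t] that
      by (simp add: diff_divide_distrib[symmetric] abs_divide divide_le_eq)
  qed
  then show ?thesis by (intro that[OF d, of "max 3 t0"]) auto
qed

lemma path_zeta_bfun01:
  assumes z: "asymp_equicontinuous z" and t: "3 \<le> t"
  shows "path_zeta z t \<in> mspace bfun01"
proof -
  obtain B where B: "\<forall>u\<in>{0..t}. \<bar>z u\<bar> \<le> B"
    using z[unfolded asymp_equicontinuous_def, THEN conjunct2, THEN conjunct1, rule_format, of t] t by (auto elim: exE)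
  show ?thesis
  proof (rule bfun01I)
    show "path_zeta z t \<in> extensional {0..1}" by (simp add: path_zeta_def)
    fix u :: real assume u: "u \<in> {0..1}"
    then have "t * u \<in> {0..t}" using t by (auto simp: mult_left_le)
    then have "\<bar>z (t * u)\<bar> \<le> B" using B by blast
    then show "\<bar>path_zeta z t u\<bar> \<le> B / lil_scale t"
      using lil_scale_pos[OF t] by (simp add: path_zeta_eq[OF t u] abs_divide divide_right_mono)
  qed
qed

text \<open>For given \<open>e\<close> the modulus can fail only for parameters below
  \<open>t0\<close>, and a sequence tending to infinity has finitely many of these; they form the
  exempt set.\<close>

lemma asymp_equicontinuous_rel_compact:
  assumes z: "asymp_equicontinuous z"
  shows "rel_compact_family unif_top (path_zeta z)"
  unfolding rel_compact_family_def
proof (intro allI impI, elim conjE)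
  fix \<tau> :: "nat \<Rightarrow> real" assume \<tau>3: "\<forall>n. 3 \<le> \<tau> n" and \<tau>: "filterlim \<tau> at_top sequentially"
  let ?S = "range (\<lambda>n. path_zeta z (\<tau> n))"
  have S: "?S \<subseteq> mspace bfun01" using path_zeta_bfun01[OF z] \<tau>3 by blast
  have z0: "z 0 = 0" using z by (simp add: asymp_equicontinuous_def)
  have "unif.mtotally_bounded ?S"
  proof (rule mtotally_bounded_equicontinuous[OF S])
    fix e :: real assume "0 < e"
    then obtain \<delta> t0 where \<delta>: "0 < \<delta>" and H: "\<And>t u v. t0 \<le> t \<Longrightarrow> u \<in> {0..1} \<Longrightarrow> v \<in> {0..1} \<Longrightarrow> \<bar>u - v\<bar> \<le> \<delta> \<Longrightarrow>
      \<bar>z (t * u) / lil_scale t - z (t * v) / lil_scale t\<bar> \<le> e"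
      using asymp_equicontinuousD[OF z] by metis
    obtain N where N: "\<And>n. N \<le> n \<Longrightarrow> t0 \<le> \<tau> n"
      using \<tau> unfolding filterlim_at_top eventually_sequentially by meson
    let ?F0 = "(\<lambda>n. path_zeta z (\<tau> n)) ` {..<N}"
    have "\<forall>f\<in>?S - ?F0. f 0 = 0 \<and> (\<forall>u\<in>{0..1}. \<forall>v\<in>{0..1}. \<bar>u - v\<bar> \<le> \<delta> \<longrightarrow> \<bar>f u - f v\<bar> \<le> e)"
    proof
      fix f assume "f \<in> ?S - ?F0"
      then obtain n where n: "f = path_zeta z (\<tau> n)" "\<not> n < N" by auto
      then have t: "t0 \<le> \<tau> n" using N by simp
      have "f u = z (\<tau> n * u) / lil_scale (\<tau> n)" if "u \<in> {0..1}" for u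
        using path_zeta_eq[OF _ that] \<tau>3 n by simp
      then show "f 0 = 0 \<and> (\<forall>u\<in>{0..1}. \<forall>v\<in>{0..1}. \<bar>u - v\<bar> \<le> \<delta> \<longrightarrow> \<bar>f u - f v\<bar> \<le> e)"
        using H[OF t] z0 by simp
    qed
    then show "\<exists>\<F>0. finite \<F>0 \<and> \<F>0 \<subseteq> ?S \<and> (\<exists>\<delta>>0. \<forall>f\<in>?S - \<F>0. f 0 = 0 \<and>
      (\<forall>u\<in>{0..1}. \<forall>v\<in>{0..1}. \<bar>u - v\<bar> \<le> \<delta> \<longrightarrow> \<bar>f u - f v\<bar> \<le> e))"
      using \<delta> by (intro exI[of _ ?F0] exI[of _ \<delta>] conjI) auto
  qed
  then have "compactin unif.mtopology (unif.mtopology closure_of ?S)"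
    using unif.mtotally_bounded_eq_compact_closure_of[OF mcomplete_bfun01] by blast
  then show "relatively_compactin unif_top ?S"
    using S unfolding relatively_compactin_def unif_top_eq unif.topspace_mtopology by blast
qed

lemma unit_interval_mult:
  fixes a u :: real
  assumes "0 \<le> a" "a \<le> 1" "u \<in> {0..1}"
  shows "a * u \<in> {0..1}"
  using assms mult_le_one[of a u] by simp

text \<open>Walking from 0 to \<open>u\<close> in \<open>n\<close> equal steps no longer than
  \<open>\<delta>\<close> changes the normalised path by at most 1 each time, and \<open>n\<close>
  depends on \<open>\<delta>\<close> alone.\<close>

lemma asymp_equicontinuous_bounded:
  assumes z: "asymp_equicontinuous z"
  obtains C t0 where "0 < C" "3 \<le> t0"
    "\<And>t u. t0 \<le> t \<Longrightarrow> u \<in> {0..1} \<Longrightarrow> \<bar>z (t * u) / lil_scale t\<bar> \<le> C"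
proof -
  obtain \<delta> t0 where \<delta>: "0 < \<delta>" and t0: "3 \<le> t0" and H: "\<And>t u v. t0 \<le> t \<Longrightarrow> u \<in> {0..1} \<Longrightarrow> v \<in> {0..1} \<Longrightarrow> \<bar>u - v\<bar> \<le> \<delta> \<Longrightarrow>
      \<bar>z (t * u) / lil_scale t - z (t * v) / lil_scale t\<bar> \<le> 1"
    using asymp_equicontinuousD[OF z zero_less_one] by metis
  have z0: "z 0 = 0" using z by (simp add: asymp_equicontinuous_def)
  obtain n :: nat where n: "1 / \<delta> < real n" using reals_Archimedean2 by blast
  then have n0: "0 < real n" using \<delta> by (meson less_trans zero_less_divide_1_iff)
  have "\<bar>z (t * u) / lil_scale t\<bar> \<le> real n" if t: "t0 \<le> t" and u: "u \<in> {0..1}" for t u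
  proof -
    have "\<bar>z (t * (real i / n * u)) / lil_scale t\<bar> \<le> real i" if "i \<le> n" for i
      using that
    proof (induction i)
      case 0
      then show ?case using z0 by simp
    next
      case (Suc i)
      have mem: "real j / n * u \<in> {0..1}" if "j \<le> n" for j
      proof -
        have "real j / n \<le> 1" using that n0 by (simp add: divide_le_eq_1)
        then show ?thesis using u by (intro unit_interval_mult) simp
      qed
      have "real (Suc i) / n * u - real i / n * u = u / n" by (simp add: field_simps add_divide_distrib)
      moreover have "u / n \<le> \<delta>"
      proof -
        have "u / n \<le> 1 / n" using u by (intro divide_right_mono) auto
        also have "\<dots> \<le> \<delta>" using n n0 \<delta> by (simp add: field_simps)
        finally show ?thesis .
      qed
      moreover have "0 \<le> u / n" using u by simp
      ultimately have "\<bar>z (t * (real (Suc i) / n * u)) / lil_scale t - z (t * (real i / n * u)) / lil_scale t\<bar> \<le> 1"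
        using Suc.prems by (intro H[OF t] mem) auto
      moreover have "\<bar>z (t * (real i / n * u)) / lil_scale t\<bar> \<le> real i" using Suc.prems by (intro Suc.IH) simp
      moreover have "real (Suc i) = real i + 1" by simp
      ultimately show ?case by linarith
    qed
    from this[of n] show ?thesis using n0 by simp
  qed
  then show ?thesis using n0 t0 that by blast
qed

section \<open>Limit points lie in the limit set\<close>

lemma scale_time_between:
  fixes J :: nat
  shows "\<forall>\<^sub>F t in at_top. \<exists>j\<ge>J. scale_time j < t \<and> t \<le> scale_time (Suc j)"
proof -
  have "\<exists>j\<ge>J. scale_time j < t \<and> t \<le> scale_time (Suc j)" if t: "scale_time J < t" for t
  proof -
    have "\<forall>\<^sub>F j in sequentially. t \<le> scale_time j"
      using scale_time_at_top unfolding filterlim_at_top by blast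
    then obtain j1 where "t \<le> scale_time j1" "J \<le> j1"
      unfolding eventually_sequentially by (meson linear order_trans order_refl)
    then have ex: "\<exists>i. t \<le> scale_time (J + i)" by (metis le_Suc_ex)
    \<comment> \<open>A least index instead of monotonicity, since \<open>scale_time\<close> is not
      monotone at the beginning: its value at 3 is below that at 2.\<close>
    define i where "i = (LEAST i. t \<le> scale_time (J + i))"
    have i: "t \<le> scale_time (J + i)" unfolding i_def by (rule LeastI_ex[OF ex])
    then have "i \<noteq> 0" using t by (metis add.right_neutral not_less)
    then obtain i' where i': "i = Suc i'" using not0_implies_Suc by blast
    then have "\<not> t \<le> scale_time (J + i')" using not_less_Least[of i' "\<lambda>i. t \<le> scale_time (J + i)"] unfolding i_def by simp
    then show ?thesis using i i' by (intro exI[of _ "J + i'"]) auto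
  qed
  then show ?thesis using eventually_gt_at_top[of "scale_time J"] by (rule eventually_mono[rotated])
qed

text \<open>Compare \<open>t\<close> with the next scale time \<open>T\<close>. Writing
  \<open>t * u = T * s\<close> moves the argument by at most \<open>1 - t / T\<close> and changes
  the normalisation by a factor near 1; the first effect is covered by the modulus of continuity,
  the second by boundedness. This is where the ratios of consecutive times and of their
  normalisations have to tend to 1.\<close>

lemma zeta_near_scale_time:
  fixes J :: nat
  assumes z: "asymp_equicontinuous z" and \<eta>: "0 < \<eta>"
  shows "\<forall>\<^sub>F t in at_top. \<exists>j\<ge>J. \<forall>u\<in>{0..1}.
    \<bar>z (t * u) / lil_scale t - z (scale_time j * u) / lil_scale (scale_time j)\<bar> \<le> \<eta>"
proof -
  obtain C t1 where C: "0 < C" "3 \<le> t1" and bdd: "\<And>t u. t1 \<le> t \<Longrightarrow> u \<in> {0..1} \<Longrightarrow> \<bar>z (t * u) / lil_scale t\<bar> \<le> C"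
    using asymp_equicontinuous_bounded[OF z] by metis
  obtain \<delta> t2 where \<delta>: "0 < \<delta>" and t2: "3 \<le> t2" and H: "\<And>t u v. t2 \<le> t \<Longrightarrow> u \<in> {0..1} \<Longrightarrow> v \<in> {0..1} \<Longrightarrow> \<bar>u - v\<bar> \<le> \<delta> \<Longrightarrow>
      \<bar>z (t * u) / lil_scale t - z (t * v) / lil_scale t\<bar> \<le> \<eta> / 2"
    using asymp_equicontinuousD[OF z half_gt_zero[OF \<eta>]] by metis
  have "\<forall>\<^sub>F j in sequentially. scale_time (Suc j) / scale_time j < 1 + \<delta>"
    using order_tendstoD(2)[OF scale_time_ratio] \<delta> by simp
  moreover have "\<forall>\<^sub>F j in sequentially. lil_scale (scale_time (Suc j)) / lil_scale (scale_time j) < 1 + \<eta> / (2 * C)"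
    using order_tendstoD(2)[OF lil_scale_time_ratio] \<eta> C by simp
  moreover have "\<forall>\<^sub>F j in sequentially. max t1 t2 \<le> scale_time j"
    using scale_time_at_top unfolding filterlim_at_top by blast
  ultimately have "\<forall>\<^sub>F j in sequentially. scale_time (Suc j) / scale_time j < 1 + \<delta> \<and>
      lil_scale (scale_time (Suc j)) / lil_scale (scale_time j) < 1 + \<eta> / (2 * C) \<and> max t1 t2 \<le> scale_time j"
    by eventually_elim auto
  then obtain J1 where J1: "\<And>j. J1 \<le> j \<Longrightarrow> scale_time (Suc j) / scale_time j < 1 + \<delta> \<and>
      lil_scale (scale_time (Suc j)) / lil_scale (scale_time j) < 1 + \<eta> / (2 * C) \<and> max t1 t2 \<le> scale_time j"
    unfolding eventually_sequentially by blast
  show ?thesis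
    using scale_time_between[of "max J J1"]
  proof eventually_elim
    case (elim t)
    then obtain j where j: "max J J1 \<le> j" "scale_time j < t" "t \<le> scale_time (Suc j)" by blast
    define S T where "S = scale_time j" and "T = scale_time (Suc j)"
    have ST: "max t1 t2 \<le> S" "S < t" "t \<le> T" "T / S < 1 + \<delta>" "lil_scale T / lil_scale S < 1 + \<eta> / (2 * C)"
      using J1[of j] j by (auto simp: S_def T_def)
    have S3: "3 \<le> S" using ST C by linarith
    have pos: "0 < lil_scale S" "0 < lil_scale t" "0 < lil_scale T" using S3 ST by (auto intro!: lil_scale_pos)
    have "\<bar>z (t * u) / lil_scale t - z (T * u) / lil_scale T\<bar> \<le> \<eta>" if u: "u \<in> {0..1}" for u
    proof -
      define s where "s = t / T * u"
      have tT: "0 < t / T" "t / T \<le> 1" using ST S3 by auto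
      have s01: "s \<in> {0..1}" using u tT unfolding s_def by (intro unit_interval_mult) auto
      have Ts: "t * u = T * s" using ST S3 by (simp add: s_def)
      have "1 - t / T \<le> \<delta>"
      proof -
        have "T < (1 + \<delta>) * S" using ST S3 by (simp add: field_simps)
        also have "\<dots> \<le> (1 + \<delta>) * t" using ST \<delta> by (intro mult_left_mono) auto
        finally have "T - t \<le> \<delta> * t" by (simp add: algebra_simps)
        also have "\<dots> \<le> \<delta> * T" using ST \<delta> by (intro mult_left_mono) auto
        finally show ?thesis using ST S3 by (simp add: field_simps)
      qed
      then have "\<bar>s - u\<bar> \<le> \<delta>"
      proof -
        have "u - s = (1 - t / T) * u" by (simp add: s_def algebra_simps)
        moreover have "0 \<le> (1 - t / T) * u" using u tT by (intro mult_nonneg_nonneg) auto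
        moreover have "(1 - t / T) * u \<le> (1 - t / T) * 1" using u tT by (intro mult_left_mono) auto
        ultimately have "0 \<le> u - s" "u - s \<le> 1 - t / T" by (simp_all only: mult_1_right)
        then show ?thesis using \<open>1 - t / T \<le> \<delta>\<close> by linarith
      qed
      then have 1: "\<bar>z (T * s) / lil_scale T - z (T * u) / lil_scale T\<bar> \<le> \<eta> / 2"
        using ST by (intro H s01 u) auto
      have "\<bar>z (T * s) / lil_scale t - z (T * s) / lil_scale T\<bar> = \<bar>z (T * s) / lil_scale T\<bar> * \<bar>lil_scale T / lil_scale t - 1\<bar>"
        using pos by (simp add: abs_mult[symmetric] field_simps)
      also have "\<dots> \<le> C * (\<eta> / (2 * C))"
      proof (intro mult_mono bdd s01)
        have "lil_scale t \<le> lil_scale T" using ST S3 by (intro lil_scale_mono) auto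
        moreover have "lil_scale T / lil_scale t \<le> lil_scale T / lil_scale S"
          using ST S3 pos by (intro divide_left_mono lil_scale_mono) auto
        ultimately show "\<bar>lil_scale T / lil_scale t - 1\<bar> \<le> \<eta> / (2 * C)"
          using ST(5) pos le_divide_eq_1_pos[of "lil_scale t" "lil_scale T"] by linarith
      qed (use ST C in auto)
      also have "\<dots> = \<eta> / 2" using C by simp
      finally show ?thesis using 1 unfolding Ts by linarith
    qed
    then show ?case using j(1) by (intro exI[of _ "Suc j"]) (auto simp: T_def)
  qed
qed

text \<open>Stated along a sequence of times and with slack \<open>1 / real (Suc N)\<close>, so that
  all quantifiers are countable.\<close>

definition lil_energy_bound :: "real \<Rightarrow> (real \<Rightarrow> real) \<Rightarrow> bool" where
  "lil_energy_bound \<sigma> z \<longleftrightarrow> (\<forall>r\<ge>1. \<forall>N. \<exists>j0. \<forall>j\<ge>j0.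
     increment_energy r (\<lambda>u. z (scale_time j * u)) \<le> (\<sigma>\<^sup>2 + 1 / real (Suc N)) * (lil_scale (scale_time j))\<^sup>2)"

text \<open>Paths of the converging sequence are replaced by paths at scale times, taken so late
  that the energy bounds for all grids \<open>r \<le> N\<close> hold with slack
  \<open>1 / real (Suc N)\<close>. The replacements \<open>w N\<close> still converge to
  \<open>x\<close>, and the bounds pass to the limit. Continuity of \<open>x\<close> comes from the
  asymptotic modulus, although the paths themselves may jump.\<close>

lemma limit_points_subset_strassen_set:
  assumes z: "asymp_equicontinuous z" and en: "lil_energy_bound \<sigma> z"
  shows "limit_points unif_top (path_zeta z) \<subseteq> strassen_set \<sigma>"
proof
  fix x assume "x \<in> limit_points unif_top (path_zeta z)"
  then obtain \<tau> :: "nat \<Rightarrow> real" where \<tau>: "\<forall>n. 3 \<le> \<tau> n" "filterlim \<tau> at_top sequentially"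
    and lim0: "limitin unif_top (\<lambda>n. path_zeta z (\<tau> n)) x sequentially"
    unfolding limit_points_def mem_Collect_eq by (elim exE conjE)
  have b: "path_zeta z (\<tau> n) \<in> mspace bfun01" for n using path_zeta_bfun01[OF z] \<tau>(1) by blast
  have xe: "x \<in> extensional {0..1}"
    and lim: "\<And>e. 0 < e \<Longrightarrow> \<forall>\<^sub>F n in sequentially. \<forall>u\<in>{0..1}. \<bar>path_zeta z (\<tau> n) u - x u\<bar> \<le> e"
    using iffD1[OF limitin_unif_top[OF b] lim0] by blast+
  have zeta: "path_zeta z (\<tau> n) u = z (\<tau> n * u) / lil_scale (\<tau> n)" if "u \<in> {0..1}" for n u
    using path_zeta_eq[OF _ that] \<tau>(1) by blast
  have z0: "z 0 = 0" using z by (simp add: asymp_equicontinuous_def)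
  have cont: "continuous_on {0..1} x"
    unfolding continuous_on_iff
  proof (intro ballI allI impI)
    fix u e :: real assume u: "u \<in> {0..1}" and e: "0 < e"
    then have e4: "0 < e / 4" by simp
    obtain \<delta> t0 where \<delta>: "0 < \<delta>" and H: "\<And>t u v. t0 \<le> t \<Longrightarrow> u \<in> {0..1} \<Longrightarrow> v \<in> {0..1} \<Longrightarrow> \<bar>u - v\<bar> \<le> \<delta> \<Longrightarrow>
      \<bar>z (t * u) / lil_scale t - z (t * v) / lil_scale t\<bar> \<le> e / 4"
      using asymp_equicontinuousD[OF z e4] by metis
    have "\<forall>\<^sub>F n in sequentially. t0 \<le> \<tau> n" using \<tau>(2) unfolding filterlim_at_top by blast
    with lim[OF e4] have "\<forall>\<^sub>F n in sequentially. t0 \<le> \<tau> n \<and> (\<forall>u\<in>{0..1}. \<bar>path_zeta z (\<tau> n) u - x u\<bar> \<le> e / 4)"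
      by eventually_elim auto
    then obtain n where n: "t0 \<le> \<tau> n" "\<forall>u\<in>{0..1}. \<bar>path_zeta z (\<tau> n) u - x u\<bar> \<le> e / 4"
      unfolding eventually_sequentially by blast
    have "dist (x v) (x u) < e" if v: "v \<in> {0..1}" "dist v u < \<delta>" for v
    proof -
      have "\<bar>path_zeta z (\<tau> n) v - path_zeta z (\<tau> n) u\<bar> \<le> e / 4"
        unfolding zeta[OF u] zeta[OF v(1)] using v(2) by (intro H[OF n(1) v(1) u]) (simp add: dist_real_def)
      moreover have "\<bar>path_zeta z (\<tau> n) v - x v\<bar> \<le> e / 4" "\<bar>path_zeta z (\<tau> n) u - x u\<bar> \<le> e / 4"
        using n(2) u v by blast+
      ultimately show ?thesis using e unfolding dist_real_def by linarith
    qed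
    then show "\<exists>d>0. \<forall>x'\<in>{0..1}. dist x' u < d \<longrightarrow> dist (x x') (x u) < e" using \<delta> by blast
  qed
  have fin: "\<exists>j. (\<forall>u\<in>{0..1}. \<bar>z (scale_time j * u) / lil_scale (scale_time j) - x u\<bar> \<le> 2 / real (Suc N)) \<and>
      0 < lil_scale (scale_time j) \<and>
      (\<forall>r\<in>{1..N}. increment_energy r (\<lambda>u. z (scale_time j * u)) \<le> (\<sigma>\<^sup>2 + 1 / real (Suc N)) * (lil_scale (scale_time j))\<^sup>2)" for N
  proof -
    define \<eta> where "\<eta> = 1 / real (Suc N)"
    have \<eta>: "0 < \<eta>" by (simp add: \<eta>_def)
    have "\<forall>\<^sub>F j in sequentially. \<forall>r\<in>{1..N}. increment_energy r (\<lambda>u. z (scale_time j * u)) \<le> (\<sigma>\<^sup>2 + 1 / real (Suc N)) * (lil_scale (scale_time j))\<^sup>2"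
      using en unfolding lil_energy_bound_def eventually_sequentially[symmetric]
      by (intro eventually_ball_finite) auto
    moreover have "\<forall>\<^sub>F j in sequentially. 3 \<le> scale_time j"
      using scale_time_at_top unfolding filterlim_at_top by blast
    ultimately have "\<forall>\<^sub>F j in sequentially. 3 \<le> scale_time j \<and>
      (\<forall>r\<in>{1..N}. increment_energy r (\<lambda>u. z (scale_time j * u)) \<le> (\<sigma>\<^sup>2 + 1 / real (Suc N)) * (lil_scale (scale_time j))\<^sup>2)"
      by eventually_elim auto
    then obtain J where J: "\<And>j. J \<le> j \<Longrightarrow> 3 \<le> scale_time j \<and>
      (\<forall>r\<in>{1..N}. increment_energy r (\<lambda>u. z (scale_time j * u)) \<le> (\<sigma>\<^sup>2 + 1 / real (Suc N)) * (lil_scale (scale_time j))\<^sup>2)"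
      unfolding eventually_sequentially by blast
    have "\<forall>\<^sub>F n in sequentially. \<exists>j\<ge>J. \<forall>u\<in>{0..1}.
      \<bar>z (\<tau> n * u) / lil_scale (\<tau> n) - z (scale_time j * u) / lil_scale (scale_time j)\<bar> \<le> \<eta>"
      using zeta_near_scale_time[OF z \<eta>, of J] \<tau>(2) by (rule eventually_compose_filterlim)
    with lim[OF \<eta>] have "\<forall>\<^sub>F n in sequentially. (\<forall>u\<in>{0..1}. \<bar>path_zeta z (\<tau> n) u - x u\<bar> \<le> \<eta>) \<and>
      (\<exists>j\<ge>J. \<forall>u\<in>{0..1}. \<bar>z (\<tau> n * u) / lil_scale (\<tau> n) - z (scale_time j * u) / lil_scale (scale_time j)\<bar> \<le> \<eta>)"
      by eventually_elim blast
    then obtain n j where nj: "\<forall>u\<in>{0..1}. \<bar>path_zeta z (\<tau> n) u - x u\<bar> \<le> \<eta>" "J \<le> j"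
      "\<forall>u\<in>{0..1}. \<bar>z (\<tau> n * u) / lil_scale (\<tau> n) - z (scale_time j * u) / lil_scale (scale_time j)\<bar> \<le> \<eta>"
      unfolding eventually_sequentially by blast
    have "\<bar>z (scale_time j * u) / lil_scale (scale_time j) - x u\<bar> \<le> 2 / real (Suc N)" if u: "u \<in> {0..1}" for u
    proof -
      have "\<bar>path_zeta z (\<tau> n) u - x u\<bar> \<le> \<eta>"
        "\<bar>path_zeta z (\<tau> n) u - z (scale_time j * u) / lil_scale (scale_time j)\<bar> \<le> \<eta>"
        using bspec[OF nj(1) u] bspec[OF nj(3) u] by (simp_all only: zeta[OF u])
      moreover have "2 / real (Suc N) = \<eta> + \<eta>" by (simp add: \<eta>_def)
      ultimately show ?thesis by linarith
    qed
    moreover have "0 < lil_scale (scale_time j)" using J[OF nj(2)] lil_scale_pos by blast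
    ultimately show ?thesis using J[OF nj(2)] by blast
  qed
  from choice[OF allI[OF fin]] obtain j where j: "\<forall>N. (\<forall>u\<in>{0..1}. \<bar>z (scale_time (j N) * u) / lil_scale (scale_time (j N)) - x u\<bar> \<le> 2 / real (Suc N)) \<and>
      0 < lil_scale (scale_time (j N)) \<and>
      (\<forall>r\<in>{1..N}. increment_energy r (\<lambda>u. z (scale_time (j N) * u)) \<le> (\<sigma>\<^sup>2 + 1 / real (Suc N)) * (lil_scale (scale_time (j N)))\<^sup>2)" ..
  define w where "w N = (\<lambda>u\<in>{0..1}. z (scale_time (j N) * u) / lil_scale (scale_time (j N)))" for N
  show "x \<in> strassen_set \<sigma>"
  proof (rule strassen_set_uniform_limit[of w])
    show "w n \<in> extensional {0..1} \<and> w n 0 = 0" for n by (simp add: w_def z0)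
    show "(\<lambda>n. w n u) \<longlonglongrightarrow> x u" if u: "u \<in> {0..1}" for u
    proof (rule LIM_zero_cancel, rule Lim_null_comparison)
      show "\<forall>\<^sub>F n in sequentially. norm (w n u - x u) \<le> 2 / real (Suc n)"
        using j u by (auto simp: w_def)
      show "(\<lambda>n. 2 / real (Suc n)) \<longlonglongrightarrow> 0" by real_asymp
    qed
    show "(\<lambda>n. 1 / real (Suc n)) \<longlonglongrightarrow> 0" by real_asymp
    show "\<forall>\<^sub>F n in sequentially. increment_energy r (w n) \<le> \<sigma>\<^sup>2 + 1 / real (Suc n)" if r: "1 \<le> r" for r
      using eventually_ge_at_top[of r]
    proof eventually_elim
      case (elim n)
      define T where "T = scale_time (j n)"
      have T: "0 < lil_scale T" using j by (simp add: T_def)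
      have grid01: "real i / r \<in> {0..1}" if "i \<le> r" for i using that r by (auto simp: field_simps)
      have "increment_energy r (w n) = real r * (\<Sum>i<r. (z (T * (real (Suc i) / r)) / lil_scale T - z (T * (real i / r)) / lil_scale T)\<^sup>2)"
        unfolding increment_energy_def
      proof (intro arg_cong2[where f = "(*)"] refl sum.cong)
        fix i assume "i \<in> {..<r}"
        then have "real (Suc i) / r \<in> {0..1}" "real i / r \<in> {0..1}" by (intro grid01; simp)+
        then show "(w n (real (Suc i) / r) - w n (real i / r))\<^sup>2 =
          (z (T * (real (Suc i) / r)) / lil_scale T - z (T * (real i / r)) / lil_scale T)\<^sup>2"
          unfolding w_def T_def restrict_apply by (simp only: if_True)
      qed
      also have "\<dots> = increment_energy r (\<lambda>u. z (T * u)) / (lil_scale T)\<^sup>2"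
        unfolding increment_energy_def
        by (simp add: diff_divide_distrib[symmetric] power_divide sum_divide_distrib[symmetric])
      also have "\<dots> \<le> \<sigma>\<^sup>2 + 1 / real (Suc n)"
      proof -
        have "increment_energy r (\<lambda>u. z (T * u)) \<le> (\<sigma>\<^sup>2 + 1 / real (Suc n)) * (lil_scale T)\<^sup>2"
          using j[THEN spec[of _ n]] r elim unfolding T_def by auto
        moreover have "0 < (lil_scale T)\<^sup>2" using T by simp
        ultimately show ?thesis by (simp only: pos_divide_le_eq)
      qed
      finally show ?case .
    qed
  qed (use xe cont in auto)
qed

text \<open>
  The first block, \<open>i = 0\<close>, is left out: the modulus of continuity controls it, and without it the
  increments at the times \<open>r ^ j\<close> are independent for different \<open>j\<close>.
\<close>

definition lil_approximation :: "real \<Rightarrow> (real \<Rightarrow> real) \<Rightarrow> bool" where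
  "lil_approximation \<sigma> z \<longleftrightarrow> (\<forall>r\<ge>2. \<forall>y :: rat list. \<forall>N J. length y = r \<and>
     real r * (\<Sum>i\<in>{1..<r}. (real_of_rat (y ! i))\<^sup>2) < 1 \<longrightarrow>
     (\<exists>j\<ge>J. \<forall>i\<in>{1..<r}. \<bar>z (real r ^ j * (real (Suc i) / real r)) - z (real r ^ j * (real i / real r)) -
        \<sigma> * real_of_rat (y ! i) * lil_scale (real r ^ j)\<bar> \<le> lil_scale (real r ^ j) / real (Suc N)))"

section \<open>Every element of the limit set is a limit point\<close>

lemma rational_toward_zero:
  fixes v e :: real
  assumes "0 < e"
  shows "\<exists>q :: rat. \<bar>real_of_rat q\<bar> \<le> \<bar>v\<bar> \<and> \<bar>v - real_of_rat q\<bar> \<le> e"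
proof (cases "v = 0")
  case True
  then show ?thesis using assms by (intro exI[of _ 0]) simp
next
  case False
  then have "max 0 (\<bar>v\<bar> - e) < \<bar>v\<bar>" using assms by simp
  then obtain q where q: "max 0 (\<bar>v\<bar> - e) < real_of_rat q" "real_of_rat q < \<bar>v\<bar>" using of_rat_dense by blast
  show ?thesis
  proof (cases "0 < v")
    case True
    then show ?thesis using q by (intro exI[of _ q]) auto
  next
    case False
    then show ?thesis using q by (intro exI[of _ "- q"]) (auto simp: of_rat_minus)
  qed
qed

text \<open>The increments of \<open>x\<close> over the cells \<open>1, ..., r - 1\<close> are
  copied by the path at some time \<open>r ^ j\<close>; the first cell and the interior of all cells
  are left to the two moduli of continuity. Errors are shared out in multiples of
  \<open>e / 8\<close>, and those made in the single cells, at most \<open>e / (8 * real r)\<close>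
  each, add up over the grid.\<close>

lemma strassen_set_approached:
  assumes z: "asymp_equicontinuous z" and ap: "lil_approximation \<sigma> z" and \<sigma>: "0 \<le> \<sigma>"
    and x: "x \<in> strassen_set \<sigma>" and e: "0 < e"
  shows "\<exists>t\<ge>t0. 3 \<le> t \<and> (\<forall>u\<in>{0..1}. \<bar>z (t * u) / lil_scale t - x u\<bar> \<le> e)"
proof -
  have x0: "x 0 = 0" using x by (simp add: strassen_set_iff)
  have z0: "z 0 = 0" using z by (simp add: asymp_equicontinuous_def)
  have e8: "0 < e / 8" using e by simp
  obtain \<delta> t1 where \<delta>: "0 < \<delta>" and t1: "3 \<le> t1" and H: "\<And>t u v. t1 \<le> t \<Longrightarrow> u \<in> {0..1} \<Longrightarrow> v \<in> {0..1} \<Longrightarrow> \<bar>u - v\<bar> \<le> \<delta> \<Longrightarrow>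
      \<bar>z (t * u) / lil_scale t - z (t * v) / lil_scale t\<bar> \<le> e / 8"
    using asymp_equicontinuousD[OF z e8] by metis
  have "(\<lambda>r. \<sigma> * sqrt (1 / real r)) \<longlonglongrightarrow> \<sigma> * sqrt 0" by (intro tendsto_intros lim_1_over_n)
  then have "\<forall>\<^sub>F r in sequentially. \<sigma> * sqrt (1 / real r) < e / 8"
    by (rule order_tendstoD(2)) (use e8 in simp)
  moreover have "\<forall>\<^sub>F r in sequentially. 1 / real r < \<delta>"
    using order_tendstoD(2)[OF lim_1_over_n] \<delta> by blast
  ultimately have "\<forall>\<^sub>F r in sequentially. \<sigma> * sqrt (1 / real r) < e / 8 \<and> 1 / real r < \<delta> \<and> 2 \<le> r"
    using eventually_ge_at_top[of 2] by eventually_elim auto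
  then obtain r :: nat where r: "\<sigma> * sqrt (1 / real r) < e / 8" "1 / real r < \<delta>" "2 \<le> r"
    unfolding eventually_sequentially by blast
  \<comment> \<open>\<open>lil_approximation\<close> asks for a strict energy bound, while
    \<open>x\<close> may have energy exactly \<open>\<sigma>\<^sup>2\<close>; so
    \<open>\<theta> * x\<close> is followed instead of \<open>x\<close>, at a cost of at most
    \<open>(1 - \<theta>) * \<sigma>\<close>.\<close>
  define \<theta> where "\<theta> = max (1 / 2) (1 - e / (8 * (\<sigma> + 1)))"
  have \<theta>: "0 < \<theta>" "\<theta> < 1" "(1 - \<theta>) * \<sigma> \<le> e / 8"
  proof -
    show "0 < \<theta>" "\<theta> < 1" using e \<sigma> by (auto simp: \<theta>_def)
    have "1 - \<theta> \<le> e / (8 * (\<sigma> + 1))" by (simp add: \<theta>_def)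
    then have "(1 - \<theta>) * \<sigma> \<le> e / (8 * (\<sigma> + 1)) * \<sigma>" using \<sigma> by (rule mult_right_mono)
    also have "\<dots> \<le> e / 8" using e \<sigma> by (simp add: field_simps)
    finally show "(1 - \<theta>) * \<sigma> \<le> e / 8" .
  qed
  define d where "d i = x (real (Suc i) / real r) - x (real i / real r)" for i
  have en: "real r * (\<Sum>i<r. (d i)\<^sup>2) \<le> \<sigma>\<^sup>2"
    using x r(3) by (simp add: strassen_set_iff increment_energy_def d_def)
  \<comment> \<open>For \<open>\<sigma> = 0\<close> the quotient \<open>d i / \<sigma>\<close> is 0
    by convention, which is right because then all increments vanish.\<close>
  have d\<sigma>: "\<sigma> * (d i / \<sigma>) = d i" if "i < r" for i
  proof (cases "\<sigma> = 0")
    case True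
    then have "(\<Sum>i<r. (d i)\<^sup>2) \<le> 0" using en r(3) by (simp add: mult_le_0_iff)
    moreover have "(d i)\<^sup>2 \<le> (\<Sum>i<r. (d i)\<^sup>2)" using that by (intro member_le_sum) auto
    ultimately have "(d i)\<^sup>2 \<le> 0" by linarith
    then show ?thesis using True by simp
  qed simp
  define \<eta> where "\<eta> = e / (16 * real r * (\<sigma> + 1))"
  have \<eta>: "0 < \<eta>" "\<sigma> * \<eta> \<le> e / (16 * real r)"
  proof -
    show "0 < \<eta>" unfolding \<eta>_def using e \<sigma> r(3) by (intro divide_pos_pos mult_pos_pos) auto
    have "\<sigma> * \<eta> = \<sigma> / (\<sigma> + 1) * (e / (16 * real r))" by (simp add: \<eta>_def mult_ac)
    also have "\<dots> \<le> 1 * (e / (16 * real r))" using e \<sigma> by (intro mult_right_mono) auto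
    finally show "\<sigma> * \<eta> \<le> e / (16 * real r)" by simp
  qed
  \<comment> \<open>Rounding towards 0 does not increase the sum of squares, so the rational vector
    keeps the strict energy bound.\<close>
  have "\<forall>i. \<exists>q :: rat. \<bar>real_of_rat q\<bar> \<le> \<bar>\<theta> * (d i / \<sigma>)\<bar> \<and> \<bar>\<theta> * (d i / \<sigma>) - real_of_rat q\<bar> \<le> \<eta>"
    using rational_toward_zero[OF \<eta>(1)] by blast
  from choice[OF this] obtain q :: "nat \<Rightarrow> rat" where
    q: "\<forall>i. \<bar>real_of_rat (q i)\<bar> \<le> \<bar>\<theta> * (d i / \<sigma>)\<bar> \<and> \<bar>\<theta> * (d i / \<sigma>) - real_of_rat (q i)\<bar> \<le> \<eta>" ..
  define y where "y = map q [0..<r]"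
  have y: "length y = r" "\<And>i. i < r \<Longrightarrow> y ! i = q i" by (simp_all add: y_def)
  have "real r * (\<Sum>i\<in>{1..<r}. (real_of_rat (y ! i))\<^sup>2) \<le> real r * (\<Sum>i<r. \<theta>\<^sup>2 * ((d i)\<^sup>2 / \<sigma>\<^sup>2))"
  proof (intro mult_left_mono)
    have "(\<Sum>i\<in>{1..<r}. (real_of_rat (y ! i))\<^sup>2) \<le> (\<Sum>i\<in>{1..<r}. \<theta>\<^sup>2 * ((d i)\<^sup>2 / \<sigma>\<^sup>2))"
    proof (rule sum_mono)
      fix i assume i: "i \<in> {1..<r}"
      have yi: "y ! i = q i" using y(2) i by simp
      have "(real_of_rat (y ! i))\<^sup>2 = \<bar>real_of_rat (q i)\<bar>\<^sup>2" unfolding yi by (simp only: power2_abs)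
      also have "\<dots> \<le> \<bar>\<theta> * (d i / \<sigma>)\<bar>\<^sup>2" using q by (intro power_mono) auto
      finally show "(real_of_rat (y ! i))\<^sup>2 \<le> \<theta>\<^sup>2 * ((d i)\<^sup>2 / \<sigma>\<^sup>2)"
        by (simp add: power_mult_distrib power_divide)
    qed
    also have "\<dots> \<le> (\<Sum>i<r. \<theta>\<^sup>2 * ((d i)\<^sup>2 / \<sigma>\<^sup>2))" by (intro sum_mono2) auto
    finally show "(\<Sum>i\<in>{1..<r}. (real_of_rat (y ! i))\<^sup>2) \<le> (\<Sum>i<r. \<theta>\<^sup>2 * ((d i)\<^sup>2 / \<sigma>\<^sup>2))" .
  qed simp
  also have "\<dots> = \<theta>\<^sup>2 * ((real r * (\<Sum>i<r. (d i)\<^sup>2)) / \<sigma>\<^sup>2)"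
    by (simp add: sum_distrib_left[symmetric] sum_divide_distrib[symmetric])
  also have "\<dots> \<le> \<theta>\<^sup>2 * 1"
    using en by (intro mult_left_mono divide_le_eq_1[THEN iffD2]) (auto simp: zero_less_power2)
  also have "\<dots> < 1" using \<theta> by (simp add: power_less_one_iff abs_square_less_1)
  finally have ycond: "real r * (\<Sum>i\<in>{1..<r}. (real_of_rat (y ! i))\<^sup>2) < 1" .
  obtain N where N: "1 / real (Suc N) \<le> e / (16 * real r)"
  proof -
    have "0 < e / (16 * real r)" using e r(3) by simp
    then obtain N where "inverse (real (Suc N)) < e / (16 * real r)" using reals_Archimedean by blast
    then show ?thesis using that[of N] by (simp add: inverse_eq_divide)
  qed
  obtain J where J: "\<And>j. J \<le> j \<Longrightarrow> max t0 t1 \<le> real r ^ j"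
  proof -
    have "\<exists>J. max t0 t1 < real r ^ J" by (rule real_arch_pow) (use r(3) in simp)
    then obtain J where "max t0 t1 < real r ^ J" by (rule exE)
    moreover have "real r ^ J \<le> real r ^ j" if "J \<le> j" for j
      using that r(3) by (intro power_increasing) auto
    ultimately show ?thesis by (intro that[of J]) (meson less_imp_le less_le_trans)
  qed
  from ap[unfolded lil_approximation_def, rule_format, OF r(3) conjI[OF y(1) ycond], of J N]
  obtain j where j: "J \<le> j" and inc: "\<forall>i\<in>{1..<r}. \<bar>z (real r ^ j * (real (Suc i) / real r)) - z (real r ^ j * (real i / real r)) -
        \<sigma> * real_of_rat (y ! i) * lil_scale (real r ^ j)\<bar> \<le> lil_scale (real r ^ j) / real (Suc N)"
    by (elim exE conjE)
  define t where "t = real r ^ j"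
  have t: "t0 \<le> t" "t1 \<le> t" "3 \<le> t" using J[OF j] t1 by (auto simp: t_def)
  define f where "f u = z (t * u) / lil_scale t" for u
  have pos: "0 < lil_scale t" using t by (intro lil_scale_pos)
  have grid01: "real i / r \<in> {0..1}" if "i \<le> r" for i using that r(3) by (auto simp: field_simps)
  have step: "\<bar>(f (real (Suc i) / r) - f (real i / r)) - \<theta> * d i\<bar> \<le> e / (8 * real r)" if i: "i \<in> {1..<r}" for i
  proof -
    have "\<bar>z (t * (real (Suc i) / real r)) - z (t * (real i / real r)) - \<sigma> * real_of_rat (q i) * lil_scale t\<bar> \<le> lil_scale t / real (Suc N)"
      using bspec[OF inc i] y(2)[of i] i by (simp only: t_def) simp
    moreover have "(f (real (Suc i) / r) - f (real i / r)) - \<sigma> * real_of_rat (q i) =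
      (z (t * (real (Suc i) / real r)) - z (t * (real i / real r)) - \<sigma> * real_of_rat (q i) * lil_scale t) / lil_scale t"
      using pos by (simp add: f_def diff_divide_distrib)
    ultimately have "\<bar>(f (real (Suc i) / r) - f (real i / r)) - \<sigma> * real_of_rat (q i)\<bar> \<le> 1 / real (Suc N)"
      using pos by (simp add: abs_divide pos_divide_le_eq)
    moreover have "\<bar>\<theta> * d i - \<sigma> * real_of_rat (q i)\<bar> \<le> e / (16 * real r)"
    proof -
      have "\<theta> * d i - \<sigma> * real_of_rat (q i) = \<theta> * (\<sigma> * (d i / \<sigma>)) - \<sigma> * real_of_rat (q i)"
        using d\<sigma>[of i] i by simp
      also have "\<dots> = \<sigma> * (\<theta> * (d i / \<sigma>) - real_of_rat (q i))" by (simp only: right_diff_distrib mult.left_commute)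
      also have "\<bar>\<dots>\<bar> \<le> \<sigma> * \<eta>" unfolding abs_mult using q \<sigma> by (auto intro: mult_left_mono)
      finally show ?thesis using \<eta>(2) by linarith
    qed
    moreover have "e / (8 * real r) = e / (16 * real r) + e / (16 * real r)" by (simp add: field_simps)
    ultimately show ?thesis using N by linarith
  qed
  have \<delta>r: "1 / real r \<le> \<delta>" using r(2) by simp
  have fmod: "\<bar>f u - f v\<bar> \<le> e / 8" if "u \<in> {0..1}" "v \<in> {0..1}" "\<bar>u - v\<bar> \<le> 1 / r" for u v
    unfolding f_def using that \<delta>r by (intro H t(2)) auto
  have xmod: "\<bar>x v - x u\<bar> \<le> e / 8" if "0 \<le> u" "u \<le> v" "v \<le> 1" "v - u \<le> 1 / r" for u v
  proof -
    have "\<bar>x v - x u\<bar> \<le> \<sigma> * sqrt (v - u)" using that \<sigma> by (intro strassen_set_modulus[OF x])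
    also have "\<dots> \<le> \<sigma> * sqrt (1 / real r)" using that \<sigma> by (intro mult_left_mono real_sqrt_le_mono) auto
    finally show ?thesis using r(1) by linarith
  qed
  \<comment> \<open>The summand \<open>e / 4\<close> is the error of the first cell,
    \<open>e / 8\<close> from each of \<open>f\<close> and \<open>x\<close>; every further cell adds
    \<open>e / (8 * real r)\<close>.\<close>
  have gridbound: "\<bar>f (real i / r) - \<theta> * x (real i / r)\<bar> \<le> e / 4 + real i * (e / (8 * real r))" if "i \<le> r" for i
    using that
  proof (induction i)
    case 0
    then show ?case using z0 x0 e by (simp add: f_def)
  next
    case (Suc i)
    show ?case
    proof (cases "i = 0")
      case True
      have "\<bar>f (1 / r) - f 0\<bar> \<le> e / 8" using r(3) by (intro fmod) auto
      moreover have "\<bar>x (1 / r) - x 0\<bar> \<le> e / 8" using r(3) by (intro xmod) auto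
      then have "\<theta> * \<bar>x (1 / r)\<bar> \<le> 1 * (e / 8)" using \<theta> x0 e by (intro mult_mono) auto
      then have "\<bar>\<theta> * x (1 / r)\<bar> \<le> e / 8" using \<theta> by (simp add: abs_mult)
      moreover have "0 \<le> e / (8 * real r)" using e by simp
      moreover have "f 0 = 0" by (simp add: f_def z0)
      moreover have "real (Suc i) / r = 1 / r" "real (Suc i) * (e / (8 * real r)) = e / (8 * real r)"
        using True by simp_all
      ultimately show ?thesis by (simp only:)
    next
      case False
      have "\<bar>(f (real (Suc i) / r) - f (real i / r)) - \<theta> * d i\<bar> \<le> e / (8 * real r)"
        using False Suc.prems by (intro step) auto
      moreover have "\<bar>f (real i / r) - \<theta> * x (real i / r)\<bar> \<le> e / 4 + real i * (e / (8 * real r))"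
        using Suc by simp
      moreover have "f (real (Suc i) / r) - \<theta> * x (real (Suc i) / r) =
        ((f (real (Suc i) / r) - f (real i / r)) - \<theta> * d i) + (f (real i / r) - \<theta> * x (real i / r))"
        by (simp add: d_def algebra_simps)
      moreover have "real (Suc i) * (e / (8 * real r)) = real i * (e / (8 * real r)) + e / (8 * real r)"
        by (simp add: algebra_simps add_divide_distrib)
      ultimately show ?thesis by linarith
    qed
  qed
  have "\<bar>f u - x u\<bar> \<le> e" if u: "u \<in> {0..1}" for u
  proof -
    define i where "i = nat \<lfloor>real r * u\<rfloor>"
    have i: "real i \<le> real r * u" "real r * u < real i + 1" using u by (auto simp: i_def)
    have "real r * u \<le> real r" using u by (simp add: mult_left_le)
    then have ir: "i \<le> r" using i by linarith
    have eq: "u - real i / r = (real r * u - real i) / r" using r(3) by (simp add: field_simps)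
    have ui: "0 \<le> u - real i / r" "u - real i / r \<le> 1 / r"
      unfolding eq using i by (auto intro: divide_right_mono)
    have "\<bar>f u - f (real i / r)\<bar> \<le> e / 8" using ui by (intro fmod u grid01[OF ir]) auto
    moreover have "\<bar>x u - x (real i / r)\<bar> \<le> e / 8" using ui u by (intro xmod) auto
    moreover have "\<bar>f (real i / r) - \<theta> * x (real i / r)\<bar> \<le> e / 4 + e / 8"
    proof -
      have "real i * (e / (8 * real r)) \<le> real r * (e / (8 * real r))"
        using ir e by (intro mult_right_mono) auto
      also have "\<dots> = e / 8" using r(3) by simp
      finally show ?thesis using gridbound[OF ir] by linarith
    qed
    moreover have "\<bar>\<theta> * x (real i / r) - x (real i / r)\<bar> \<le> e / 8"
    proof -
      have "\<bar>x (real i / r) - x 0\<bar> \<le> \<sigma> * sqrt (real i / r - 0)"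
        using grid01[OF ir] \<sigma> by (intro strassen_set_modulus[OF x]) auto
      also have "\<dots> \<le> \<sigma> * 1" using grid01[OF ir] \<sigma> by (intro mult_left_mono) auto
      finally have "\<bar>x (real i / r)\<bar> \<le> \<sigma>" using x0 by simp
      then have "(1 - \<theta>) * \<bar>x (real i / r)\<bar> \<le> (1 - \<theta>) * \<sigma>" using \<theta> by (intro mult_left_mono) auto
      moreover have "\<theta> * x (real i / r) - x (real i / r) = - ((1 - \<theta>) * x (real i / r))" by (simp add: algebra_simps)
      then have "\<bar>\<theta> * x (real i / r) - x (real i / r)\<bar> = (1 - \<theta>) * \<bar>x (real i / r)\<bar>" using \<theta> by (simp add: abs_mult)
      ultimately show ?thesis using \<theta>(3) by linarith
    qed
    ultimately show ?thesis using e by linarith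
  qed
  then show ?thesis using t unfolding f_def by blast
qed

lemma strassen_set_subset_limit_points:
  assumes z: "asymp_equicontinuous z" and ap: "lil_approximation \<sigma> z" and \<sigma>: "0 \<le> \<sigma>"
  shows "strassen_set \<sigma> \<subseteq> limit_points unif_top (path_zeta z)"
proof
  fix x assume x: "x \<in> strassen_set \<sigma>"
  have "\<forall>n. \<exists>t. real n \<le> t \<and> 3 \<le> t \<and> (\<forall>u\<in>{0..1}. \<bar>z (t * u) / lil_scale t - x u\<bar> \<le> 1 / real (Suc n))"
    using strassen_set_approached[OF z ap \<sigma> x] by simp
  from choice[OF this] obtain \<tau> where \<tau>: "\<forall>n. real n \<le> \<tau> n \<and> 3 \<le> \<tau> n \<and>
     (\<forall>u\<in>{0..1}. \<bar>z (\<tau> n * u) / lil_scale (\<tau> n) - x u\<bar> \<le> 1 / real (Suc n))" ..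
  have b: "path_zeta z (\<tau> n) \<in> mspace bfun01" for n using path_zeta_bfun01[OF z] \<tau> by blast
  have "limitin unif_top (\<lambda>n. path_zeta z (\<tau> n)) x sequentially"
  proof (rule limitin_unif_top[OF b, THEN iffD2], intro conjI allI impI)
    show "x \<in> extensional {0..1}" using x by (simp add: strassen_set_iff)
    fix e :: real assume e: "0 < e"
    have "(\<lambda>n. 1 / real (Suc n)) \<longlonglongrightarrow> 0" by real_asymp
    then have "\<forall>\<^sub>F n in sequentially. 1 / real (Suc n) < e" using e by (rule order_tendstoD(2))
    then show "\<forall>\<^sub>F n in sequentially. \<forall>u\<in>{0..1}. \<bar>path_zeta z (\<tau> n) u - x u\<bar> \<le> e"
    proof eventually_elim
      case (elim n)
      have "\<bar>path_zeta z (\<tau> n) u - x u\<bar> \<le> e" if u: "u \<in> {0..1}" for u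
      proof -
        have "\<bar>z (\<tau> n * u) / lil_scale (\<tau> n) - x u\<bar> \<le> 1 / real (Suc n)" "3 \<le> \<tau> n" using \<tau> u by blast+
        then show ?thesis using elim path_zeta_eq[OF _ u] by simp
      qed
      then show ?case by blast
    qed
  qed
  moreover have "filterlim \<tau> at_top sequentially"
    by (rule filterlim_at_top_mono[OF filterlim_real_sequentially]) (use \<tau> in auto)
  ultimately show "x \<in> limit_points unif_top (path_zeta z)"
    unfolding limit_points_def mem_Collect_eq using \<tau> by (intro exI[of _ \<tau>] conjI) auto
qed

section \<open>Sums of paths\<close>

lemma asymp_equicontinuous_sum:
  assumes z: "\<And>i. i \<in> I \<Longrightarrow> asymp_equicontinuous (z i)" and "finite I"
  shows "asymp_equicontinuous (\<lambda>t. \<Sum>i\<in>I. z i t)"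
  using assms(2,1)
proof (induction I rule: finite_induct)
  case empty
  show ?case
    unfolding asymp_equicontinuous_def
  proof (intro conjI allI impI)
    fix e :: real assume "0 < e"
    show "\<exists>\<delta>>0. \<exists>t0. \<forall>t\<ge>t0. \<forall>u\<in>{0..1}. \<forall>v\<in>{0..1}. \<bar>u - v\<bar> \<le> \<delta> \<longrightarrow>
      \<bar>(\<Sum>i\<in>{}. z i (t * u)) - (\<Sum>i\<in>{}. z i (t * v))\<bar> \<le> e * lil_scale t"
      using \<open>0 < e\<close> lil_scale_pos by (intro exI[of _ 1] conjI exI[of _ 3]) (auto intro: less_imp_le)
  qed auto
next
  case (insert i I)
  have zi: "asymp_equicontinuous (z i)" and zI: "asymp_equicontinuous (\<lambda>t. \<Sum>i\<in>I. z i t)" using insert by auto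
  have sum: "(\<Sum>i\<in>insert i I. z i t) = z i t + (\<Sum>i\<in>I. z i t)" for t using insert.hyps by simp
  show ?case
    unfolding sum asymp_equicontinuous_def
  proof (intro conjI allI impI)
    show "z i 0 + (\<Sum>i\<in>I. z i 0) = 0" using zi zI by (simp add: asymp_equicontinuous_def)
    fix t :: real assume t: "0 \<le> t"
    obtain B1 where B1: "\<forall>u\<in>{0..t}. \<bar>z i u\<bar> \<le> B1" using zi t unfolding asymp_equicontinuous_def by blast
    obtain B2 where B2: "\<forall>u\<in>{0..t}. \<bar>\<Sum>i\<in>I. z i u\<bar> \<le> B2" using zI t unfolding asymp_equicontinuous_def by blast
    have "\<forall>u\<in>{0..t}. \<bar>z i u + (\<Sum>i\<in>I. z i u)\<bar> \<le> B1 + B2"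
    proof
      fix u assume u: "u \<in> {0..t}"
      show "\<bar>z i u + (\<Sum>i\<in>I. z i u)\<bar> \<le> B1 + B2" using bspec[OF B1 u] bspec[OF B2 u] by linarith
    qed
    then show "\<exists>B. \<forall>u\<in>{0..t}. \<bar>z i u + (\<Sum>i\<in>I. z i u)\<bar> \<le> B" ..
  next
    fix e :: real assume "0 < e"
    then have e2: "0 < e / 2" by simp
    obtain d1 t1 where 1: "0 < d1" "3 \<le> t1" "\<And>t u v. t1 \<le> t \<Longrightarrow> u \<in> {0..1} \<Longrightarrow> v \<in> {0..1} \<Longrightarrow> \<bar>u - v\<bar> \<le> d1 \<Longrightarrow>
      \<bar>z i (t * u) / lil_scale t - z i (t * v) / lil_scale t\<bar> \<le> e / 2"
      using asymp_equicontinuousD[OF zi e2] by metis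
    obtain d2 t2 where 2: "0 < d2" "3 \<le> t2" "\<And>t u v. t2 \<le> t \<Longrightarrow> u \<in> {0..1} \<Longrightarrow> v \<in> {0..1} \<Longrightarrow> \<bar>u - v\<bar> \<le> d2 \<Longrightarrow>
      \<bar>(\<Sum>i\<in>I. z i (t * u)) / lil_scale t - (\<Sum>i\<in>I. z i (t * v)) / lil_scale t\<bar> \<le> e / 2"
      using asymp_equicontinuousD[OF zI e2] by metis
    have "\<bar>(z i (t * u) + (\<Sum>i\<in>I. z i (t * u))) - (z i (t * v) + (\<Sum>i\<in>I. z i (t * v)))\<bar> \<le> e * lil_scale t"
      if t: "max t1 t2 \<le> t" and uv: "u \<in> {0..1}" "v \<in> {0..1}" "\<bar>u - v\<bar> \<le> min d1 d2" for t u v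
    proof -
      have pos: "0 < lil_scale t" using t 1(2) by (intro lil_scale_pos) auto
      have "\<bar>z i (t * u) / lil_scale t - z i (t * v) / lil_scale t\<bar> \<le> e / 2" using t uv by (intro 1(3)) auto
      moreover have "\<bar>(\<Sum>i\<in>I. z i (t * u)) / lil_scale t - (\<Sum>i\<in>I. z i (t * v)) / lil_scale t\<bar> \<le> e / 2"
        using t uv by (intro 2(3)) auto
      ultimately have "\<bar>z i (t * u) - z i (t * v)\<bar> \<le> e / 2 * lil_scale t"
        "\<bar>(\<Sum>i\<in>I. z i (t * u)) - (\<Sum>i\<in>I. z i (t * v))\<bar> \<le> e / 2 * lil_scale t"
        using pos by (simp_all add: diff_divide_distrib[symmetric] abs_divide pos_divide_le_eq)
      moreover have "e * lil_scale t = e / 2 * lil_scale t + e / 2 * lil_scale t" by simp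
      ultimately show ?thesis by linarith
    qed
    then show "\<exists>\<delta>>0. \<exists>t0. \<forall>t\<ge>t0. \<forall>u\<in>{0..1}. \<forall>v\<in>{0..1}. \<bar>u - v\<bar> \<le> \<delta> \<longrightarrow>
      \<bar>z i (t * u) + (\<Sum>i\<in>I. z i (t * u)) - (z i (t * v) + (\<Sum>i\<in>I. z i (t * v)))\<bar> \<le> e * lil_scale t"
      using 1(1) 2(1) by (intro exI[of _ "min d1 d2"] conjI exI[of _ "max t1 t2"] allI impI ballI) simp_all
  qed
qed

text \<open>Relative compactness of each component yields a common subsequence of times along which
  all components converge, each to a point of its own limit set; uniqueness of limits identifies
  \<open>x\<close> with the sum. Equality would require the components to come close to prescribed
  functions at the same times, about which the separate laws say nothing.\<close>

lemma limit_points_sum: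
  fixes Z :: "nat \<Rightarrow> real \<Rightarrow> real"
  assumes z: "\<And>i. i \<in> {1..l} \<Longrightarrow> asymp_equicontinuous (Z i)"
    and lp: "\<And>i. i \<in> {1..l} \<Longrightarrow> limit_points unif_top (path_zeta (Z i)) = strassen_set (\<sigma> i)"
  shows "limit_points unif_top (path_zeta (\<lambda>t. \<Sum>i=1..l. Z i t)) \<subseteq> strassen_sum_set l \<sigma>"
proof
  fix x assume "x \<in> limit_points unif_top (path_zeta (\<lambda>t. \<Sum>i=1..l. Z i t))"
  then obtain \<tau> :: "nat \<Rightarrow> real" where \<tau>: "\<forall>n. 3 \<le> \<tau> n" "filterlim \<tau> at_top sequentially"
    and lim0: "limitin unif_top (\<lambda>n. path_zeta (\<lambda>t. \<Sum>i=1..l. Z i t) (\<tau> n)) x sequentially"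
    unfolding limit_points_def mem_Collect_eq by (elim exE conjE)
  define f where "f i n = path_zeta (Z i) (\<tau> n)" for i n
  have fb: "f i n \<in> mspace bfun01" if "i \<in> {1..l}" for i n
    unfolding f_def using path_zeta_bfun01[OF z[OF that]] \<tau>(1) by blast
  define P where "P i s \<longleftrightarrow> (\<exists>L. L \<in> strassen_set (\<sigma> i) \<and> limitin unif_top (f i \<circ> s) L sequentially)" for i and s :: "nat \<Rightarrow> nat"
  have "\<exists>s. strict_mono s \<and> (\<forall>i\<in>{1..l}. P i s)"
  proof (rule common_subsequence)
    fix i and s :: "nat \<Rightarrow> nat" assume i: "i \<in> {1..l}" and s: "strict_mono s"
    have \<tau>s: "\<forall>n. 3 \<le> \<tau> (s n)" "filterlim (\<lambda>n. \<tau> (s n)) at_top sequentially"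
      using \<tau>(1) filterlim_compose[OF \<tau>(2) filterlim_subseq[OF s]] by (simp_all add: comp_def)
    let ?S = "range (\<lambda>n. path_zeta (Z i) (\<tau> (s n)))"
    have "relatively_compactin unif_top ?S"
      using asymp_equicontinuous_rel_compact[OF z[OF i], unfolded rel_compact_family_def, rule_format, OF conjI[OF \<tau>s]] .
    then have "compactin unif_top (unif_top closure_of ?S)" and "?S \<subseteq> unif_top closure_of ?S"
      by (auto simp: relatively_compactin_def closure_of_subset)
    from compactin_unif_subsequence[OF this] obtain L r where
      r: "strict_mono r" and lim: "limitin unif_top ((\<lambda>n. path_zeta (Z i) (\<tau> (s n))) \<circ> r) L sequentially" .
    have \<tau>sr: "\<forall>n. 3 \<le> \<tau> (s (r n))" "filterlim (\<lambda>n. \<tau> (s (r n))) at_top sequentially"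
      using \<tau>s(1) filterlim_compose[OF \<tau>s(2) filterlim_subseq[OF r]] by (simp_all add: comp_def)
    have "L \<in> limit_points unif_top (path_zeta (Z i))"
      unfolding limit_points_def mem_Collect_eq
      by (intro exI[of _ "\<lambda>n. \<tau> (s (r n))"] conjI) (use \<tau>sr lim in \<open>simp_all add: comp_def\<close>)
    then have "P i (s \<circ> r)"
      unfolding P_def f_def lp[OF i] using lim by (intro exI[of _ L]) (simp add: comp_def)
    then show "\<exists>r. strict_mono r \<and> P i (s \<circ> r)" using r by blast
  next
    fix i and s r :: "nat \<Rightarrow> nat" assume "P i s" "strict_mono r"
    then obtain L where "L \<in> strassen_set (\<sigma> i)" "limitin unif_top (f i \<circ> s) L sequentially"
      unfolding P_def by (elim exE conjE)
    then show "P i (s \<circ> r)"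
      using limitin_subseq[OF _ \<open>strict_mono r\<close>, of unif_top "f i \<circ> s" L]
      unfolding P_def by (intro exI[of _ L]) (simp add: comp_assoc)
  qed simp
  then obtain s where s: "strict_mono s" "\<forall>i\<in>{1..l}. \<exists>L. L \<in> strassen_set (\<sigma> i) \<and> limitin unif_top (f i \<circ> s) L sequentially"
    unfolding P_def by (elim exE conjE)
  from bchoice[OF s(2)] obtain L where L0: "\<forall>i\<in>{1..l}. L i \<in> strassen_set (\<sigma> i) \<and> limitin unif_top (f i \<circ> s) (L i) sequentially" ..
  have "limitin unif_top (\<lambda>n. \<lambda>u\<in>{0..1}. \<Sum>i\<in>{1..l}. f i (s n) u) (\<lambda>u\<in>{0..1}. \<Sum>i\<in>{1..l}. L i u) sequentially"
    by (rule limitin_unif_top_sum) (use fb L0 in \<open>auto simp: comp_def\<close>)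
  moreover have "(\<lambda>u\<in>{0..1}. \<Sum>i\<in>{1..l}. f i (s n) u) = path_zeta (\<lambda>t. \<Sum>i=1..l. Z i t) (\<tau> (s n))" for n
    unfolding f_def path_zeta_def by (rule ext) (simp add: sum_distrib_left restrict_def)
  ultimately have "limitin unif_top ((\<lambda>n. path_zeta (\<lambda>t. \<Sum>i=1..l. Z i t) (\<tau> n)) \<circ> s) (\<lambda>u\<in>{0..1}. \<Sum>i\<in>{1..l}. L i u) sequentially"
    by (simp add: comp_def)
  moreover have "limitin unif_top ((\<lambda>n. path_zeta (\<lambda>t. \<Sum>i=1..l. Z i t) (\<tau> n)) \<circ> s) x sequentially"
    using lim0 s(1) by (rule limitin_subseq)
  ultimately have "x = (\<lambda>u\<in>{0..1}. \<Sum>i=1..l. L i u)"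
    unfolding unif_top_eq using unif.limitin_metric_unique[OF _ _ sequentially_bot] by blast
  then show "x \<in> strassen_sum_set l \<sigma>"
    unfolding strassen_sum_set_def mem_Collect_eq using L0 by (intro exI[of _ L] conjI) auto
qed

text \<open>Integer times, since it is meant for paths that are constant between integers. The
  exponent 1/4, below the 1/2 of a single increment, leaves a factor \<open>2 powr (n / 2)\<close>
  in the Gaussian exponent to beat the \<open>2 ^ n\<close> intervals of level \<open>n\<close>. The
  constant is a natural number to keep the quantifiers countable, and \<open>k0\<close> may depend
  on \<open>m\<close>.\<close>

definition dyadic_modulus :: "(real \<Rightarrow> real) \<Rightarrow> bool" where
  "dyadic_modulus z \<longleftrightarrow> (\<exists>A :: nat. \<forall>m. \<exists>k0. \<forall>k\<ge>k0. \<forall>a b. a \<le> b \<and> b \<le> 2 ^ k \<and> (b - a) * 2 ^ m \<le> 2 ^ k \<longrightarrow>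
     \<bar>z (real b) - z (real a)\<bar> \<le> real A * 2 powr (- real m / 4) * lil_scale (2 ^ k))"

lemma asymp_equicontinuousI:
  assumes step: "\<And>t. 0 \<le> t \<Longrightarrow> z t = z (real (nat \<lfloor>t\<rfloor>))" and z0: "z 0 = 0" and dm: "dyadic_modulus z"
  shows "asymp_equicontinuous z"
  unfolding asymp_equicontinuous_def
proof (intro conjI allI impI z0)
  fix t :: real assume "0 \<le> t"
  have "\<forall>u\<in>{0..t}. \<bar>z u\<bar> \<le> (\<Sum>n\<le>nat \<lfloor>t\<rfloor>. \<bar>z (real n)\<bar>)"
  proof
    fix u assume u: "u \<in> {0..t}"
    then have "\<bar>z u\<bar> = \<bar>z (real (nat \<lfloor>u\<rfloor>))\<bar>" using step[of u] by simp
    also have "\<dots> \<le> (\<Sum>n\<le>nat \<lfloor>t\<rfloor>. \<bar>z (real n)\<bar>)"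
      using u by (intro member_le_sum) (auto intro: nat_mono floor_mono)
    finally show "\<bar>z u\<bar> \<le> (\<Sum>n\<le>nat \<lfloor>t\<rfloor>. \<bar>z (real n)\<bar>)" .
  qed
  then show "\<exists>B. \<forall>u\<in>{0..t}. \<bar>z u\<bar> \<le> B" ..
next
  fix e :: real assume e: "0 < e"
  obtain A :: nat where A: "\<forall>m. \<exists>k0. \<forall>k\<ge>k0. \<forall>a b. a \<le> b \<and> b \<le> 2 ^ k \<and> (b - a) * 2 ^ m \<le> 2 ^ k \<longrightarrow>
     \<bar>z (real b) - z (real a)\<bar> \<le> real A * 2 powr (- real m / 4) * lil_scale (2 ^ k)"
    using dm unfolding dyadic_modulus_def by (elim exE)
  have "(\<lambda>m. real A * 2 powr (- real m / 4) * 2) \<longlonglongrightarrow> 0" by real_asymp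
  then have "\<forall>\<^sub>F m in sequentially. real A * 2 powr (- real m / 4) * 2 < e" using e by (rule order_tendstoD(2))
  then obtain m where m: "real A * 2 powr (- real m / 4) * 2 < e" unfolding eventually_sequentially by blast
  from A[rule_format, of m] obtain k0 where k0: "\<forall>k\<ge>k0. \<forall>a b. a \<le> b \<and> b \<le> 2 ^ k \<and> (b - a) * 2 ^ m \<le> 2 ^ k \<longrightarrow>
     \<bar>z (real b) - z (real a)\<bar> \<le> real A * 2 powr (- real m / 4) * lil_scale (2 ^ k)"
    by (elim exE)
  obtain t1 where t1: "\<And>t. t1 \<le> t \<Longrightarrow> lil_scale (2 * t) \<le> 2 * lil_scale t"
    using lil_scale_double unfolding eventually_at_top_linorder by blast
  define t0 where "t0 = Max {3, t1, 2 ^ k0, 2 ^ (m + 1)}"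
  \<comment> \<open>Half of \<open>1 / 2 ^ m\<close>: rounding to integers can lengthen an interval
    by 1, and \<open>t0\<close> is large enough for the other half to absorb that.\<close>
  define \<delta> :: real where "\<delta> = 1 / 2 ^ (m + 1)"
  have bound: "\<bar>z (t * v) - z (t * u)\<bar> \<le> e * lil_scale t"
    if t: "t0 \<le> t" and uv: "0 \<le> u" "u \<le> v" "v \<le> 1" "v - u \<le> \<delta>" for t u v
  proof -
    have t': "3 \<le> t" "t1 \<le> t" "2 ^ k0 \<le> t" "2 ^ (m + 1) \<le> t" using t by (auto simp: t0_def)
    \<comment> \<open>\<open>2 ^ k\<close> is the first power of two from \<open>t\<close> on, hence
      below \<open>2 * t\<close>, and \<open>lil_scale_double\<close> compares the
      normalisations.\<close>
    define k where "k = nat \<lceil>log 2 t\<rceil>"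
    have lg: "0 \<le> log 2 t" using t' by simp
    then have "log 2 t \<le> real k" "real k < log 2 t + 1" by (auto simp: k_def) linarith
    then have "2 powr log 2 t \<le> 2 powr real k" "2 powr real k < 2 powr (log 2 t + 1)" by simp_all
    then have k: "t \<le> 2 ^ k" "2 ^ k < 2 * t" using t' by (simp_all add: powr_realpow powr_add)
    have "(2 :: real) ^ k0 \<le> 2 ^ k" "(2 :: real) ^ (m + 1) \<le> 2 ^ k" using k t' by linarith+
    then have kk: "k0 \<le> k" "m + 1 \<le> k"
      using power_le_imp_le_exp[of "2 :: real" k0 k] power_le_imp_le_exp[of "2 :: real" "m + 1" k] by simp_all
    define a b where "a = nat \<lfloor>t * u\<rfloor>" and "b = nat \<lfloor>t * v\<rfloor>"
    have tu: "0 \<le> t * u" "t * u \<le> t * v" using t' uv by (auto intro: mult_left_mono)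
    have ab: "a \<le> b" unfolding a_def b_def using tu by (intro nat_mono floor_mono)
    have ar: "real a \<le> t * u" "t * u < real a + 1" "real b \<le> t * v" using tu by (auto simp: a_def b_def)
    have "t * v \<le> t" using uv t' by (simp add: mult_left_le)
    then have "real b \<le> 2 ^ k" using ar k by linarith
    then have b2: "b \<le> 2 ^ k" by (metis numeral_power_le_of_nat_cancel_iff of_nat_le_iff of_nat_numeral of_nat_power)
    have "real b - real a \<le> t * (v - u) + 1" using ar by (simp add: algebra_simps)
    also have "\<dots> \<le> 2 ^ k * \<delta> + 1" using k t' uv by (intro add_mono mult_mono) auto
    finally have "(real b - real a) * 2 ^ m \<le> (2 ^ k * \<delta> + 1) * 2 ^ m" by (intro mult_right_mono) auto
    also have "\<dots> = 2 ^ k / 2 + 2 ^ m" by (simp add: \<delta>_def field_simps)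
    also have "\<dots> \<le> 2 ^ k"
    proof -
      have "(2 :: real) ^ (m + 1) \<le> 2 ^ k" using kk(2) by (intro power_increasing) auto
      then show ?thesis by simp
    qed
    finally have "real ((b - a) * 2 ^ m) \<le> real (2 ^ k)" using ab by (simp add: of_nat_diff)
    then have ba: "(b - a) * 2 ^ m \<le> 2 ^ k" by (simp only: of_nat_le_iff)
    have "\<bar>z (t * v) - z (t * u)\<bar> = \<bar>z (real b) - z (real a)\<bar>"
      using step[of "t * u"] step[of "t * v"] tu by (simp add: a_def b_def)
    also have "\<dots> \<le> real A * 2 powr (- real m / 4) * lil_scale (2 ^ k)"
      using k0 kk(1) ab b2 ba by blast
    also have "\<dots> \<le> real A * 2 powr (- real m / 4) * (2 * lil_scale t)"
    proof (intro mult_left_mono)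
      have "lil_scale (2 ^ k) \<le> lil_scale (2 * t)" using k t' by (intro lil_scale_mono) auto
      also have "\<dots> \<le> 2 * lil_scale t" by (rule t1[OF t'(2)])
      finally show "lil_scale (2 ^ k) \<le> 2 * lil_scale t" .
    qed simp
    also have "\<dots> = (real A * 2 powr (- real m / 4) * 2) * lil_scale t" by simp
    also have "\<dots> \<le> e * lil_scale t" using m lil_scale_pos[OF t'(1)] by (intro mult_right_mono) auto
    finally show ?thesis .
  qed
  have "\<bar>z (t * u) - z (t * v)\<bar> \<le> e * lil_scale t"
    if t: "t0 \<le> t" and uv: "u \<in> {0..1}" "v \<in> {0..1}" "\<bar>u - v\<bar> \<le> \<delta>" for t u v
  proof (cases "u \<le> v")
    case True
    then show ?thesis using bound[OF t, of u v] uv by (simp add: abs_minus_commute)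
  next
    case False
    then show ?thesis using bound[OF t, of v u] uv by simp
  qed
  moreover have "0 < \<delta>" by (simp add: \<delta>_def)
  ultimately show "\<exists>\<delta>>0. \<exists>t0. \<forall>t\<ge>t0. \<forall>u\<in>{0..1}. \<forall>v\<in>{0..1}. \<bar>u - v\<bar> \<le> \<delta> \<longrightarrow>
      \<bar>z (t * u) - z (t * v)\<bar> \<le> e * lil_scale t"
    by (intro exI[of _ \<delta>] conjI exI[of _ t0] allI impI ballI)
qed

section \<open>Gaussian estimates and chaining\<close>

lemma (in prob_space) chernoff_bound:
  assumes W: "random_variable borel W" and c: "(\<integral>\<^sup>+\<omega>. ennreal (exp (W \<omega>)) \<partial>M) \<le> ennreal c" "0 \<le> c"
  shows "prob {\<omega>\<in>space M. w < W \<omega>} \<le> c * exp (- w)"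
proof -
  note [measurable] = W
  have "emeasure M {\<omega>\<in>space M. w < W \<omega>} = (\<integral>\<^sup>+\<omega>. indicator {\<omega>\<in>space M. w < W \<omega>} \<omega> \<partial>M)" by simp
  also have "\<dots> \<le> (\<integral>\<^sup>+\<omega>. ennreal (exp (- w)) * ennreal (exp (W \<omega>)) \<partial>M)"
  proof (rule nn_integral_mono)
    fix \<omega> assume "\<omega> \<in> space M"
    have "1 \<le> exp (- w) * exp (W \<omega>)" if "w < W \<omega>" using that by (simp add: exp_add[symmetric])
    then have "indicator {\<omega>\<in>space M. w < W \<omega>} \<omega> \<le> ennreal (exp (- w) * exp (W \<omega>))"
      by (auto split: split_indicator simp: ennreal_1[symmetric] simp del: ennreal_1 intro!: ennreal_leI)
    then show "indicator {\<omega>\<in>space M. w < W \<omega>} \<omega> \<le> ennreal (exp (- w)) * ennreal (exp (W \<omega>))"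
      by (simp add: ennreal_mult)
  qed
  also have "\<dots> = ennreal (exp (- w)) * (\<integral>\<^sup>+\<omega>. ennreal (exp (W \<omega>)) \<partial>M)"
    by (rule nn_integral_cmult) measurable
  also have "\<dots> \<le> ennreal (exp (- w)) * ennreal c" by (intro mult_left_mono c) simp
  also have "\<dots> = ennreal (c * exp (- w))" using c by (simp add: ennreal_mult[symmetric] mult.commute)
  finally show ?thesis using c by (simp add: emeasure_eq_measure)
qed

text \<open>Weighting the density by the exponential of a multiple of the square again gives a
  centred normal density, with the variance divided by \<open>d = 1 - 2 * c\<close>, up to the
  factor \<open>1 / sqrt d\<close>.\<close>

lemma normal_square_exp_moment:
  assumes X: "distributed M lborel X (normal_density 0 s)" and s: "0 < s" and l: "c < 1 / 2"
  shows "(\<integral>\<^sup>+\<omega>. ennreal (exp (c * (X \<omega>)\<^sup>2 / s\<^sup>2)) \<partial>M) = ennreal (1 / sqrt (1 - 2 * c))"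
proof -
  define d where "d = 1 - 2 * c"
  have d: "0 < d" using l by (simp add: d_def)
  define s' where "s' = s / sqrt d"
  have s': "0 < s'" using s d by (simp add: s'_def)
  have "(\<integral>\<^sup>+\<omega>. ennreal (exp (c * (X \<omega>)\<^sup>2 / s\<^sup>2)) \<partial>M) =
    (\<integral>\<^sup>+x. ennreal (normal_density 0 s x) * ennreal (exp (c * x\<^sup>2 / s\<^sup>2)) \<partial>lborel)"
    by (rule distributed_nn_integral[OF X, symmetric]) measurable
  also have "\<dots> = (\<integral>\<^sup>+x. ennreal (1 / sqrt d) * ennreal (normal_density 0 s' x) \<partial>lborel)"
  proof (rule nn_integral_cong)
    fix x :: real
    have s2: "s'\<^sup>2 = s\<^sup>2 / d" using d by (simp add: s'_def power_divide)
    have "normal_density 0 s x * exp (c * x\<^sup>2 / s\<^sup>2) = 1 / sqrt (2 * pi * s\<^sup>2) * exp (- x\<^sup>2 / (2 * s\<^sup>2) + c * x\<^sup>2 / s\<^sup>2)"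
      by (simp add: normal_density_def mult_exp_exp)
    also have "- x\<^sup>2 / (2 * s\<^sup>2) + c * x\<^sup>2 / s\<^sup>2 = - x\<^sup>2 / (2 * s'\<^sup>2)"
      unfolding s2 using s d by (simp add: d_def field_simps)
    also have "1 / sqrt (2 * pi * s\<^sup>2) = 1 / sqrt d * (1 / sqrt (2 * pi * s'\<^sup>2))"
      unfolding s2 using d by (simp add: real_sqrt_mult real_sqrt_divide)
    finally have "normal_density 0 s x * exp (c * x\<^sup>2 / s\<^sup>2) = 1 / sqrt d * normal_density 0 s' x"
      by (simp add: normal_density_def)
    then show "ennreal (normal_density 0 s x) * ennreal (exp (c * x\<^sup>2 / s\<^sup>2)) = ennreal (1 / sqrt d) * ennreal (normal_density 0 s' x)"
      using d by (simp add: ennreal_mult[symmetric])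
  qed
  also have "\<dots> = ennreal (1 / sqrt d) * (\<integral>\<^sup>+x. ennreal (normal_density 0 s' x) \<partial>lborel)"
    by (rule nn_integral_cmult) measurable
  also have "(\<integral>\<^sup>+x. ennreal (normal_density 0 s' x) \<partial>lborel) = 1"
    using s' by (subst nn_integral_eq_integral) auto
  finally show ?thesis by (simp add: d_def)
qed

text \<open>Chernoff's bound for the squared variable at \<open>c = 1 / 4\<close>, where the
  exponential moment is the square root of 2. The exponent is not the sharp one, which is harmless
  for the modulus of continuity, where constants do not matter; the sharp constant enters through
  \<open>brownian_energy_exp_moment\<close>.\<close>

lemma (in prob_space) normal_tail_bound:
  assumes X: "distributed M lborel X (normal_density 0 s)" and s: "0 < s" and a: "0 \<le> a"
  shows "prob {\<omega>\<in>space M. a < \<bar>X \<omega>\<bar>} \<le> 2 * exp (- (a\<^sup>2 / (4 * s\<^sup>2)))"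
proof -
  have [measurable]: "random_variable borel X" using X by (simp add: distributed_def)
  have "{\<omega>\<in>space M. a < \<bar>X \<omega>\<bar>} \<subseteq> {\<omega>\<in>space M. a\<^sup>2 / (4 * s\<^sup>2) < 1 / 4 * (X \<omega>)\<^sup>2 / s\<^sup>2}"
  proof (clarify)
    fix \<omega> assume "a < \<bar>X \<omega>\<bar>"
    then have "a\<^sup>2 < \<bar>X \<omega>\<bar>\<^sup>2" using a by (intro power_strict_mono) auto
    then show "a\<^sup>2 / (4 * s\<^sup>2) < 1 / 4 * (X \<omega>)\<^sup>2 / s\<^sup>2" using s by (simp add: field_simps)
  qed
  then have "prob {\<omega>\<in>space M. a < \<bar>X \<omega>\<bar>} \<le> prob {\<omega>\<in>space M. a\<^sup>2 / (4 * s\<^sup>2) < 1 / 4 * (X \<omega>)\<^sup>2 / s\<^sup>2}"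
    by (intro finite_measure_mono) measurable
  also have "\<dots> \<le> 2 * exp (- (a\<^sup>2 / (4 * s\<^sup>2)))"
  proof (rule chernoff_bound)
    have "(\<integral>\<^sup>+\<omega>. ennreal (exp (1 / 4 * (X \<omega>)\<^sup>2 / s\<^sup>2)) \<partial>M) = ennreal (1 / sqrt (1 - 2 * (1 / 4)))"
      by (rule normal_square_exp_moment[OF X s]) simp
    also have "\<dots> \<le> ennreal 2"
    proof (rule ennreal_leI)
      have "sqrt (1 / 4) \<le> sqrt (1 - 2 * (1 / 4) :: real)" by (rule real_sqrt_le_mono) simp
      then have "1 / 2 \<le> sqrt (1 - 2 * (1 / 4) :: real)" by (simp add: real_sqrt_divide)
      then show "1 / sqrt (1 - 2 * (1 / 4)) \<le> (2 :: real)" by (simp add: field_simps)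
    qed
    finally show "(\<integral>\<^sup>+\<omega>. ennreal (exp (1 / 4 * (X \<omega>)\<^sup>2 / s\<^sup>2)) \<partial>M) \<le> ennreal 2" .
    show "random_variable borel (\<lambda>\<omega>. 1 / 4 * (X \<omega>)\<^sup>2 / s\<^sup>2)" by measurable
  qed simp
  finally show ?thesis .
qed

text \<open>On the whole interval the density is at least its value at
  \<open>\<bar>y\<bar> + h\<close>.\<close>

lemma (in prob_space) normal_interval_lower_bound:
  assumes X: "distributed M lborel X (normal_density 0 s)" and s: "0 < s" and h: "0 \<le> h"
  shows "2 * h / (sqrt (2 * pi) * s) * exp (- ((\<bar>y\<bar> + h)\<^sup>2 / (2 * s\<^sup>2))) \<le> prob {\<omega>\<in>space M. \<bar>X \<omega> - y\<bar> \<le> h}"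
proof -
  have Xm: "random_variable borel X" using X by (simp add: distributed_def)
  let ?c = "1 / (sqrt (2 * pi) * s) * exp (- ((\<bar>y\<bar> + h)\<^sup>2 / (2 * s\<^sup>2)))"
  have c0: "0 \<le> ?c" using s by simp
  have "{\<omega>\<in>space M. \<bar>X \<omega> - y\<bar> \<le> h} = X -` {y - h..y + h} \<inter> space M" by (auto simp: abs_le_iff)
  then have "emeasure M {\<omega>\<in>space M. \<bar>X \<omega> - y\<bar> \<le> h} = (\<integral>\<^sup>+x. ennreal (normal_density 0 s x) * indicator {y - h..y + h} x \<partial>lborel)"
    using distributed_emeasure[OF X, of "{y - h..y + h}"] by simp
  moreover have "ennreal (?c * (2 * h)) = (\<integral>\<^sup>+x. ennreal ?c * indicator {y - h..y + h} x \<partial>lborel)"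
    using h c0 by (subst nn_integral_cmult_indicator) (auto simp: ennreal_mult[symmetric])
  moreover have "\<dots> \<le> (\<integral>\<^sup>+x. ennreal (normal_density 0 s x) * indicator {y - h..y + h} x \<partial>lborel)"
  proof (rule nn_integral_mono)
    fix x :: real
    show "ennreal ?c * indicator {y - h..y + h} x \<le> ennreal (normal_density 0 s x) * indicator {y - h..y + h} x"
    proof (cases "x \<in> {y - h..y + h}")
      case True
      then have "\<bar>x\<bar>\<^sup>2 \<le> (\<bar>y\<bar> + h)\<^sup>2" by (intro power_mono) auto
      then have "- ((\<bar>y\<bar> + h)\<^sup>2 / (2 * s\<^sup>2)) \<le> - x\<^sup>2 / (2 * s\<^sup>2)" using s by (simp add: divide_right_mono)
      then have "?c \<le> normal_density 0 s x"
        using s unfolding normal_density_def by (simp add: real_sqrt_mult divide_right_mono)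
      then show ?thesis using True by (simp add: ennreal_leI)
    qed simp
  qed
  ultimately have "ennreal (?c * (2 * h)) \<le> emeasure M {\<omega>\<in>space M. \<bar>X \<omega> - y\<bar> \<le> h}" by simp
  then have "?c * (2 * h) \<le> prob {\<omega>\<in>space M. \<bar>X \<omega> - y\<bar> \<le> h}" by (simp add: emeasure_eq_measure)
  moreover have "?c * (2 * h) = 2 * h / (sqrt (2 * pi) * s) * exp (- ((\<bar>y\<bar> + h)\<^sup>2 / (2 * s\<^sup>2)))" by simp
  ultimately show ?thesis by linarith
qed

text \<open>Second Borel-Cantelli lemma. The probability that none of the events in a block of
  indices occurs is a product of factors \<open>1 - prob (G j) \<le> exp (- p j)\<close>, and the
  sum of \<open>p\<close> diverges. Independence is asked for the complements, the events that are
  intersected.\<close>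

lemma (in prob_space) indep_events_infinitely_often:
  assumes ind: "\<And>n. indep_events (\<lambda>j. space M - G j) {..<n :: nat}"
    and G: "\<And>j. G j \<in> events" and p: "\<And>j. j0 \<le> j \<Longrightarrow> p j \<le> prob (G j)"
    and p0: "\<And>j. 0 \<le> p j" and div: "\<not> summable p"
  shows "AE \<omega> in M. \<forall>J. \<exists>j\<ge>J. \<omega> \<in> G j"
proof -
  have "AE \<omega> in M. \<exists>j\<ge>J. \<omega> \<in> G j" for J
  proof -
    define J' where "J' = max J j0"
    let ?E = "\<Inter>j\<in>{J'..}. space M - G j"
    have Ev: "?E \<in> events" using G by (intro sets.countable_INT') auto
    have bound: "prob ?E \<le> exp (- (\<Sum>j<n. p (j + J')))" for n
    proof (cases "n = 0")
      case False
      let ?I = "{J'..<J' + n}"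
      have "prob ?E \<le> prob (\<Inter>j\<in>?I. space M - G j)"
        using G False by (intro finite_measure_mono sets.finite_INT) auto
      also have "\<dots> = (\<Prod>j\<in>?I. prob (space M - G j))"
        using False by (intro ind[of "J' + n", unfolded indep_events_def, THEN conjunct2, rule_format]) auto
      also have "\<dots> = (\<Prod>j\<in>?I. 1 - prob (G j))" using G by (intro prod.cong) (auto simp: prob_compl)
      also have "\<dots> \<le> (\<Prod>j\<in>?I. exp (- p j))"
      proof (rule prod_mono)
        fix j assume j: "j \<in> ?I"
        have "1 - prob (G j) \<le> 1 + - p j" using p[of j] j by (simp add: J'_def)
        also have "\<dots> \<le> exp (- p j)" by (rule exp_ge_add_one_self)
        finally show "0 \<le> 1 - prob (G j) \<and> 1 - prob (G j) \<le> exp (- p j)" by (simp add: prob_le_1)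
      qed
      also have "\<dots> = exp (- (\<Sum>j\<in>?I. p j))" by (simp add: exp_sum[symmetric] sum_negf)
      also have "(\<Sum>j\<in>?I. p j) = (\<Sum>j<n. p (j + J'))"
        using sum.shift_bounds_nat_ivl[of p 0 J' n] by (simp add: atLeast0LessThan add.commute)
      finally show ?thesis .
    qed simp
    have "\<not> summable (\<lambda>j. p (j + J'))" using div by (simp add: summable_iff_shift)
    have "prob ?E \<le> 0"
    proof (rule ccontr)
      assume "\<not> prob ?E \<le> 0"
      then have q: "0 < prob ?E" by simp
      have "(\<Sum>j<n. p (j + J')) \<le> - ln (prob ?E)" for n
        using ln_le_cancel_iff[OF q exp_gt_zero, THEN iffD2, OF bound[of n]] by simp
      then have "(\<Sum>j\<le>n. p (j + J')) \<le> - ln (prob ?E)" for n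
        by (simp only: lessThan_Suc_atMost[symmetric])
      then have "summable (\<lambda>j. p (j + J'))" by (rule bounded_imp_summable[OF p0])
      then show False using \<open>\<not> summable (\<lambda>j. p (j + J'))\<close> by blast
    qed
    then have "emeasure M ?E = 0" by (simp add: emeasure_eq_measure measure_nonneg antisym)
    then have "AE \<omega> in M. \<omega> \<notin> ?E" using Ev by (intro AE_not_in null_setsI)
    then show ?thesis
    proof (rule AE_mp, intro AE_I2 impI)
      fix \<omega> assume "\<omega> \<in> space M" "\<omega> \<notin> ?E"
      then obtain j where "J' \<le> j" "\<omega> \<in> G j" by auto
      then show "\<exists>j\<ge>J. \<omega> \<in> G j" by (intro exI[of _ j]) (simp add: J'_def)
    qed
  qed
  then show ?thesis by (simp add: AE_all_countable)
qed

text \<open>\<open>\<pi> n x\<close> rounds \<open>x\<close> down to a multiple of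
  \<open>2 ^ (k - n)\<close>. Refining the level by one moves the rounded point by at most one
  interval of the finer level, and at level \<open>m\<close> the points \<open>a\<close> and
  \<open>b\<close> are rounded to the same or to neighbouring multiples. The factor 2 comes from the
  two chains.\<close>

lemma dyadic_chaining:
  fixes z :: "nat \<Rightarrow> real" and d :: "nat \<Rightarrow> real"
  assumes inc: "\<And>n j. n \<le> k \<Longrightarrow> j < 2 ^ n \<Longrightarrow> \<bar>z (Suc j * 2 ^ (k - n)) - z (j * 2 ^ (k - n))\<bar> \<le> d n"
    and d: "\<And>n. 0 \<le> d n" and m: "m \<le> k" and ab: "a \<le> b" "b \<le> 2 ^ k" "b - a \<le> 2 ^ (k - m)"
  shows "\<bar>z b - z a\<bar> \<le> 2 * (\<Sum>n=m..k. d n)"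
proof -
  define h where "h n = (2 :: nat) ^ (k - n)" for n
  define \<pi> where "\<pi> n x = x div h n * h n" for n x
  have hpos: "0 < h n" for n by (simp add: h_def)
  have hk: "2 ^ n * h n = 2 ^ k" if "n \<le> k" for n using that by (simp add: h_def power_add[symmetric])
  have step: "\<bar>z (\<pi> (Suc n) x) - z (\<pi> n x)\<bar> \<le> d (Suc n)" if n: "n < k" and x: "x \<le> 2 ^ k" for n x
  proof -
    define q where "q = x div h (Suc n)"
    have "k - n = Suc (k - Suc n)" using n by simp
    then have hn: "h n = h (Suc n) * 2" by (simp add: h_def)
    have "x div h n = q div 2" unfolding hn q_def by (rule div_mult2_eq)
    then have \<pi>n: "\<pi> n x = 2 * (q div 2) * h (Suc n)" by (simp add: \<pi>_def hn)
    have \<pi>Sn: "\<pi> (Suc n) x = q * h (Suc n)" by (simp add: \<pi>_def q_def)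
    show ?thesis
    proof (cases "even q")
      case True
      then show ?thesis using d by (simp add: \<pi>n \<pi>Sn)
    next
      case False
      then have q: "q = Suc (2 * (q div 2))" by presburger
      have "q * h (Suc n) \<le> x" unfolding q_def by simp
      also have "\<dots> \<le> 2 ^ Suc n * h (Suc n)" using x hk[of "Suc n"] n by simp
      finally have "q \<le> 2 ^ Suc n" using hpos by simp
      then have "2 * (q div 2) < 2 ^ Suc n" using q by linarith
      from inc[OF _ this] n have "\<bar>z (Suc (2 * (q div 2)) * h (Suc n)) - z (2 * (q div 2) * h (Suc n))\<bar> \<le> d (Suc n)"
        by (simp add: h_def)
      then show ?thesis unfolding \<pi>n \<pi>Sn using q by simp
    qed
  qed
  have chain: "\<bar>z (\<pi> n x) - z (\<pi> m x)\<bar> \<le> (\<Sum>i=Suc m..n. d i)" if "m \<le> n" "n \<le> k" and x: "x \<le> 2 ^ k" for n x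
    using that(1,2)
  proof (induction n rule: dec_induct)
    case (step n)
    have "\<bar>z (\<pi> (Suc n) x) - z (\<pi> n x)\<bar> \<le> d (Suc n)" using step.prems by (intro \<open>\<And>n x. n < k \<Longrightarrow> x \<le> 2 ^ k \<Longrightarrow> \<bar>z (\<pi> (Suc n) x) - z (\<pi> n x)\<bar> \<le> d (Suc n)\<close> x) simp
    moreover have "\<bar>z (\<pi> n x) - z (\<pi> m x)\<bar> \<le> (\<Sum>i=Suc m..n. d i)" using step by simp
    moreover have "(\<Sum>i=Suc m..Suc n. d i) = (\<Sum>i=Suc m..n. d i) + d (Suc n)" using step.hyps by simp
    ultimately show ?case by linarith
  qed simp
  have \<pi>k: "\<pi> k x = x" for x by (simp add: \<pi>_def h_def)
  have top: "\<bar>z (\<pi> m b) - z (\<pi> m a)\<bar> \<le> d m"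
  proof -
    define q where "q = a div h m"
    have "q \<le> b div h m" unfolding q_def using ab(1) by (rule div_le_mono)
    moreover have "b div h m \<le> (a + h m) div h m" using ab by (intro div_le_mono) (simp add: h_def)
    then have "b div h m \<le> Suc q" using hpos[of m] by (simp add: q_def)
    ultimately consider "b div h m = q" | "b div h m = Suc q" by linarith
    then show ?thesis
    proof cases
      case 1
      then show ?thesis using d by (simp add: \<pi>_def q_def)
    next
      case 2
      have "b div h m * h m \<le> b" by simp
      also have "\<dots> \<le> 2 ^ m * h m" using ab hk[OF m] by simp
      finally have "Suc q \<le> 2 ^ m" using hpos[of m] unfolding 2 by (simp only: mult_le_cancel2)
      then have "\<bar>z (Suc q * h m) - z (q * h m)\<bar> \<le> d m" using inc[OF m, of q] by (simp add: h_def)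
      then show ?thesis using 2 by (simp add: \<pi>_def q_def)
    qed
  qed
  have split: "(\<Sum>n=m..k. d n) = d m + (\<Sum>n=Suc m..k. d n)" using m by (rule sum.atLeast_Suc_atMost)
  have "\<bar>z b - z (\<pi> m b)\<bar> \<le> (\<Sum>n=Suc m..k. d n)" using chain[of k b] m ab by (simp add: \<pi>k)
  moreover have "\<bar>z a - z (\<pi> m a)\<bar> \<le> (\<Sum>n=Suc m..k. d n)" using chain[of k a] m ab by (simp add: \<pi>k)
  ultimately show ?thesis using top split d[of m] by linarith
qed

section \<open>Brownian motion\<close>

lemma brownian_measurable:
  assumes "std_brownian_motion N B" "0 \<le> t"
  shows "B t \<in> borel_measurable N"
  using assms unfolding std_brownian_motion_def by blast

lemma brownian_increment:
  assumes "std_brownian_motion N B" "0 \<le> s" "s < t"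
  shows "distributed N lborel (\<lambda>\<omega>. B t \<omega> - B s \<omega>) (normal_density 0 (sqrt (t - s)))"
  using assms unfolding std_brownian_motion_def by blast

lemma brownian_indep:
  assumes "std_brownian_motion N B" "0 \<le> t 0" "\<And>i. i < n \<Longrightarrow> t i \<le> t (Suc i)"
  shows "prob_space.indep_vars N (\<lambda>_. borel) (\<lambda>i \<omega>. B (t (Suc i)) \<omega> - B (t i) \<omega>) {..<n :: nat}"
  using assms unfolding std_brownian_motion_def by blast

section \<open>Modulus of continuity of Brownian motion at dyadic scales\<close>

lemma sum_quarter_powers_le:
  assumes "m \<le> k"
  shows "(\<Sum>n=m..k. 2 powr (- real n / 4)) \<le> 7 * 2 powr (- real m / 4)"
proof -
  define q :: real where "q = 2 powr (- 1 / 4)"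
  have q0: "0 < q" by (simp add: q_def)
  have qn: "2 powr (- real n / 4) = q ^ n" for n
    unfolding q_def by (simp add: powr_realpow[symmetric] powr_powr)
  have "q ^ 4 = 1 / 2" unfolding qn[symmetric] by (simp add: powr_minus_divide)
  \<comment> \<open>Makes 7 an upper bound for \<open>1 / (1 - q)\<close>, the sum of the geometric
    series.\<close>
  have q: "q \<le> 6 / 7"
  proof (rule ccontr)
    assume "\<not> q \<le> 6 / 7"
    then have "(6 / 7) ^ 4 < q ^ 4" by (intro power_strict_mono) auto
    then show False using \<open>q ^ 4 = 1 / 2\<close> by (simp add: power4_eq_xxxx)
  qed
  \<comment> \<open>The term \<open>6 * q ^ k\<close> bounds the rest of the series and makes the
    induction go through.\<close>
  have "(\<Sum>n=m..k. q ^ n) + 6 * q ^ k \<le> 7 * q ^ m"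
    using assms
  proof (induction k rule: dec_induct)
    case (step k)
    have "q ^ Suc k \<le> 6 / 7 * q ^ k" using q q0 by (simp add: mult_right_mono)
    then show ?case using step by simp
  qed simp
  moreover have "0 \<le> q ^ k" using q0 by simp
  ultimately show ?thesis unfolding qn by linarith
qed

text \<open>Turns the exponent of the Gaussian tail at level \<open>n\<close> into one that beats
  both the number of intervals at this level and the sum over \<open>k\<close>.\<close>

lemma two_powr_half_ge: "2 + 2 * real n \<le> 9 * 2 powr (real n / 2)"
proof -
  have "1 + real n / 4 \<le> 1 + real n / 2 * ln 2"
    using ln2_ge_two_thirds mult_left_mono[of "2 / 3" "ln 2" "real n / 2"] by simp
  also have "\<dots> \<le> exp (real n / 2 * ln 2)" by (rule exp_ge_add_one_self)
  also have "\<dots> = 2 powr (real n / 2)" by (simp add: powr_def)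
  finally show ?thesis by simp
qed

lemma brownian_dyadic_modulus:
  assumes bm: "std_brownian_motion N B"
  shows "AE \<omega> in N. dyadic_modulus (\<lambda>t. B t \<omega>)"
proof -
  interpret prob_space N using bm by (simp add: std_brownian_motion_def)
  have [measurable]: "B (real n) \<in> borel_measurable N" for n
    using bm by (rule brownian_measurable) simp
  define dev where "dev k n j \<omega> = B (real (Suc j * 2 ^ (k - n))) \<omega> - B (real (j * 2 ^ (k - n))) \<omega>" for k n j \<omega>
  \<comment> \<open>An increment at level \<open>n\<close> has variance \<open>2 ^ (k - n)\<close>,
    so the tail exponent at this threshold is \<open>9 * 2 powr (n / 2) * ln k\<close>, at least
    \<open>(2 + 2 * n) * ln k\<close>. The resulting bound \<open>2 / (k ^ 2 * 4 ^ n)\<close> for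
    \<open>k \<ge> 2\<close> leaves at most \<open>4 / k ^ 2\<close> after summing over
    \<open>2 ^ n\<close> intervals per level and over all levels.\<close>
  define thr where "thr k n = 6 * 2 powr (- real n / 4) * sqrt (2 ^ k * ln (real k))" for k n :: nat
  have [measurable]: "dev k n j \<in> borel_measurable N" for k n j unfolding dev_def[abs_def] by measurable
  define A where "A k n j = {\<omega>\<in>space N. thr k n < \<bar>dev k n j \<omega>\<bar>}" for k n j
  have [measurable]: "A k n j \<in> events" for k n j unfolding A_def by measurable
  define F where "F k = (\<Union>n\<in>{..k}. \<Union>j\<in>{..<2 ^ n}. A k n j)" for k
  have pA: "prob (A k n j) \<le> 2 * (1 / real k ^ 2 * (1 / 4) ^ n)" if k: "2 \<le> k" and n: "n \<le> k" for k n j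
  proof -
    define s where "s = sqrt (real (Suc j * 2 ^ (k - n)) - real (j * 2 ^ (k - n)))"
    have s2: "s\<^sup>2 = 2 ^ (k - n)" "0 < s" by (simp_all add: s_def algebra_simps)
    have X: "distributed N lborel (dev k n j) (normal_density 0 s)"
      unfolding dev_def[abs_def] s_def by (rule brownian_increment[OF bm]) auto
    have lnk: "0 < ln (real k)" using k by simp
    have "thr k n \<ge> 0" using lnk by (simp add: thr_def)
    then have "prob (A k n j) \<le> 2 * exp (- ((thr k n)\<^sup>2 / (4 * s\<^sup>2)))"
      unfolding A_def by (intro normal_tail_bound X s2)
    also have "(thr k n)\<^sup>2 / (4 * s\<^sup>2) = 9 * 2 powr (real n / 2) * ln (real k)"
    proof -
      have "(2 powr (- real n / 4))\<^sup>2 = 2 powr (- real n / 2)"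
        by (simp add: power2_eq_square powr_add[symmetric])
      moreover have "(2 :: real) ^ k = 2 ^ (k - n) * 2 powr real n"
        using n by (simp add: powr_realpow power_add[symmetric])
      moreover have "2 powr (- real n / 2) * 2 powr real n = 2 powr (real n / 2)"
        by (simp add: powr_add[symmetric])
      moreover have "(sqrt (2 ^ k * ln (real k)))\<^sup>2 = 2 ^ k * ln (real k)" using lnk by simp
      ultimately have "(thr k n)\<^sup>2 = 36 * (2 powr (real n / 2)) * 2 ^ (k - n) * ln (real k)"
        unfolding thr_def power_mult_distrib by (simp add: mult_ac)
      then show ?thesis unfolding s2 by simp
    qed
    also have "2 * exp (- (9 * 2 powr (real n / 2) * ln (real k))) \<le> 2 * exp (- ((2 + 2 * real n) * ln (real k)))"
      using two_powr_half_ge[of n] lnk by (simp add: mult_right_mono)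
    also have "exp (- ((2 + 2 * real n) * ln (real k))) = 1 / real k ^ 2 * (1 / real k ^ 2) ^ n"
    proof -
      have "exp (- ((2 + 2 * real n) * ln (real k))) = inverse (exp (real (2 + 2 * n) * ln (real k)))"
        by (simp add: exp_minus)
      also have "exp (real (2 + 2 * n) * ln (real k)) = real k ^ (2 + 2 * n)"
        using k by (simp only: exp_of_nat_mult exp_ln)
      finally show ?thesis unfolding power_add power_mult by (simp add: divide_inverse power_inverse)
    qed
    also have "2 * (1 / real k ^ 2 * (1 / real k ^ 2) ^ n) \<le> 2 * (1 / real k ^ 2 * (1 / 4) ^ n)"
    proof (intro mult_left_mono power_mono)
      have "(2 :: real) ^ 2 \<le> real k ^ 2" using k by (intro power_mono) auto
      then show "1 / real k ^ 2 \<le> 1 / 4" using k by (intro divide_left_mono) auto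
    qed auto
    finally show ?thesis .
  qed
  have pF: "prob (F k) \<le> 4 / real k ^ 2" if k: "2 \<le> k" for k
  proof -
    have "prob (F k) \<le> (\<Sum>n\<in>{..k}. prob (\<Union>j\<in>{..<2 ^ n}. A k n j))"
      unfolding F_def by (intro finite_measure_subadditive_finite) auto
    also have "\<dots> \<le> (\<Sum>n\<in>{..k}. \<Sum>j\<in>{..<2 ^ n}. prob (A k n j))"
      by (intro sum_mono finite_measure_subadditive_finite) auto
    also have "\<dots> \<le> (\<Sum>n\<in>{..k}. \<Sum>j\<in>{..<(2 :: nat) ^ n}. 2 * (1 / real k ^ 2 * (1 / 4) ^ n))"
      using pA[OF k] by (intro sum_mono) auto
    also have "\<dots> = 2 / real k ^ 2 * (\<Sum>n\<in>{..k}. (1 / 2) ^ n)"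
    proof -
      have "(2 :: real) ^ n * (1 / 4) ^ n = (1 / 2) ^ n" for n by (simp add: power_mult_distrib[symmetric])
      then have "(\<Sum>j\<in>{..<(2 :: nat) ^ n}. 2 * (1 / real k ^ 2 * (1 / 4) ^ n)) = 2 / real k ^ 2 * (1 / 2) ^ n" for n
        by (simp add: mult.left_commute)
      then show ?thesis unfolding sum_distrib_left by (intro sum.cong refl)
    qed
    also have "(\<Sum>n\<in>{..k}. (1 / 2 :: real) ^ n) = 2 - (1 / 2) ^ k" by (induction k) auto
    then have "(\<Sum>n\<in>{..k}. (1 / 2 :: real) ^ n) \<le> 2" by simp
    then have "2 / real k ^ 2 * (\<Sum>n\<in>{..k}. (1 / 2) ^ n) \<le> 2 / real k ^ 2 * 2" by (intro mult_left_mono) auto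
    finally show ?thesis by simp
  qed
  have "AE \<omega> in N. eventually (\<lambda>k. \<omega> \<in> space N - F k) sequentially"
  proof (rule borel_cantelli_AE1)
    show "F k \<in> events" for k unfolding F_def by measurable
    show "emeasure N (F k) < \<infinity>" for k by (simp add: emeasure_eq_measure)
    have "summable (\<lambda>k. 4 * inverse (real k ^ 2))" by (intro summable_mult inverse_power_summable) simp
    then show "summable (\<lambda>k. prob (F k))"
      by (rule summable_comparison_test_ev[rotated])
        (use pF in \<open>auto intro!: eventually_sequentiallyI[of 2] simp: divide_inverse\<close>)
  qed
  then show ?thesis
  proof (rule AE_mp, intro AE_I2 impI)
    fix \<omega> assume ev: "eventually (\<lambda>k. \<omega> \<in> space N - F k) sequentially"
    \<comment> \<open>\<open>ln (ln (2 ^ k))\<close> differs from \<open>ln k\<close> by a constant,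
      which the factor 2 in \<open>lil_scale\<close> absorbs.\<close>
    have "\<forall>\<^sub>F k in sequentially. sqrt (2 ^ k * ln (real k)) \<le> lil_scale (2 ^ k)"
      unfolding lil_scale_def by real_asymp
    with ev eventually_ge_at_top[of 2] have "\<forall>\<^sub>F k in sequentially. \<omega> \<in> space N - F k \<and> sqrt (2 ^ k * ln (real k)) \<le> lil_scale (2 ^ k) \<and> 2 \<le> k"
      by eventually_elim simp
    then obtain K where K: "\<And>k. K \<le> k \<Longrightarrow> \<omega> \<in> space N - F k \<and> sqrt (2 ^ k * ln (real k)) \<le> lil_scale (2 ^ k) \<and> 2 \<le> k"
      unfolding eventually_sequentially by blast
    show "dyadic_modulus (\<lambda>t. B t \<omega>)"
      unfolding dyadic_modulus_def
    \<comment> \<open>84 is 2 from chaining, times 6 from \<open>thr\<close>, times 7 from the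
      geometric series.\<close>
    proof (rule exI[of _ 84], rule allI)
      fix m
      show "\<exists>k0. \<forall>k\<ge>k0. \<forall>a b. a \<le> b \<and> b \<le> 2 ^ k \<and> (b - a) * 2 ^ m \<le> 2 ^ k \<longrightarrow>
        \<bar>B (real b) \<omega> - B (real a) \<omega>\<bar> \<le> real 84 * 2 powr (- real m / 4) * lil_scale (2 ^ k)"
      proof (intro exI[of _ "max m K"] allI impI, elim conjE)
        fix k a b :: nat
        assume k: "max m K \<le> k" and ab: "a \<le> b" "b \<le> 2 ^ k" "(b - a) * 2 ^ m \<le> 2 ^ k"
        have mk: "m \<le> k" and Kk: "\<omega> \<notin> F k" "sqrt (2 ^ k * ln (real k)) \<le> lil_scale (2 ^ k)" "2 \<le> k"
          and \<omega>: "\<omega> \<in> space N"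
          using k K[of k] by auto
        have "(2 :: nat) ^ k = 2 ^ (k - m) * 2 ^ m" using mk by (simp add: power_add[symmetric])
        then have ba: "b - a \<le> 2 ^ (k - m)" using ab(3) by simp
        have lnk: "0 < ln (real k)" using Kk(3) by simp
        have "\<bar>B (real b) \<omega> - B (real a) \<omega>\<bar> \<le> 2 * (\<Sum>n=m..k. thr k n)"
        proof (rule dyadic_chaining[where z = "\<lambda>n. B (real n) \<omega>" and d = "thr k"])
          fix n j :: nat assume "n \<le> k" "j < 2 ^ n"
          then have "\<omega> \<notin> A k n j" using Kk(1) by (auto simp: F_def)
          then show "\<bar>B (real (Suc j * 2 ^ (k - n))) \<omega> - B (real (j * 2 ^ (k - n))) \<omega>\<bar> \<le> thr k n"
            using \<omega> by (simp add: A_def dev_def)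
        qed (use lnk mk ab ba in \<open>auto simp: thr_def\<close>)
        also have "(\<Sum>n=m..k. thr k n) = 6 * sqrt (2 ^ k * ln (real k)) * (\<Sum>n=m..k. 2 powr (- real n / 4))"
          by (simp add: thr_def sum_distrib_left mult_ac)
        also have "\<dots> \<le> 6 * sqrt (2 ^ k * ln (real k)) * (7 * 2 powr (- real m / 4))"
          using lnk by (intro mult_left_mono sum_quarter_powers_le mk) auto
        also have "\<dots> \<le> 6 * lil_scale (2 ^ k) * (7 * 2 powr (- real m / 4))"
          using Kk(2) by (intro mult_right_mono mult_left_mono) auto
        finally show "\<bar>B (real b) \<omega> - B (real a) \<omega>\<bar> \<le> real 84 * 2 powr (- real m / 4) * lil_scale (2 ^ k)"
          by (simp add: mult_ac)
      qed
    qed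
  qed
qed

text \<open>The energy divided by \<open>T\<close> is a sum of squares of \<open>r\<close>
  independent standard normal variables, so independence turns the moment into the
  \<open>r\<close>-th power of that of a single square.\<close>

lemma brownian_energy_exp_moment:
  assumes bm: "std_brownian_motion N B" and r: "1 \<le> r" and T: "0 < T" and c: "c < 1 / 2"
  shows "(\<integral>\<^sup>+\<omega>. ennreal (exp (c * increment_energy r (\<lambda>u. B (T * u) \<omega>) / T)) \<partial>N) =
    ennreal ((1 / sqrt (1 - 2 * c)) ^ r)"
proof -
  interpret prob_space N using bm by (simp add: std_brownian_motion_def)
  define t where "t i = T * (real i / r)" for i
  define s where "s = sqrt (T / r)"
  have s: "0 < s" "s\<^sup>2 = T / r" using T r by (simp_all add: s_def)
  define D where "D i \<omega> = B (t (Suc i)) \<omega> - B (t i) \<omega>" for i \<omega>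
  have ind: "indep_vars (\<lambda>_. borel) D {..<r}"
    unfolding D_def by (rule brownian_indep[OF bm]) (use T in \<open>auto simp: t_def intro!: mult_left_mono divide_right_mono\<close>)
  have dist: "distributed N lborel (D i) (normal_density 0 s)" for i
  proof -
    have "t (Suc i) - t i = T / r" by (simp add: t_def right_diff_distrib[symmetric] diff_divide_distrib[symmetric])
    moreover have "0 < T / r" using T r by simp
    ultimately have "t i < t (Suc i)" by linarith
    then have "distributed N lborel (\<lambda>\<omega>. B (t (Suc i)) \<omega> - B (t i) \<omega>) (normal_density 0 (sqrt (t (Suc i) - t i)))"
      by (intro brownian_increment[OF bm]) (use T in \<open>auto simp: t_def\<close>)
    then show ?thesis unfolding D_def[abs_def] s_def \<open>t (Suc i) - t i = T / r\<close> .
  qed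
  have "(\<integral>\<^sup>+\<omega>. ennreal (exp (c * increment_energy r (\<lambda>u. B (T * u) \<omega>) / T)) \<partial>N) =
    (\<integral>\<^sup>+\<omega>. (\<Prod>i<r. ennreal (exp (c * (D i \<omega>)\<^sup>2 / s\<^sup>2))) \<partial>N)"
  proof (rule nn_integral_cong)
    fix \<omega>
    have "c * increment_energy r (\<lambda>u. B (T * u) \<omega>) / T = (\<Sum>i<r. c * (D i \<omega>)\<^sup>2 / s\<^sup>2)"
      unfolding increment_energy_def s(2) D_def t_def using T r
      by (simp add: sum_distrib_left sum_divide_distrib mult_ac)
    then show "ennreal (exp (c * increment_energy r (\<lambda>u. B (T * u) \<omega>) / T)) = (\<Prod>i<r. ennreal (exp (c * (D i \<omega>)\<^sup>2 / s\<^sup>2)))"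
      by (simp add: exp_sum prod_ennreal)
  qed
  also have "\<dots> = (\<Prod>i<r. \<integral>\<^sup>+\<omega>. ennreal (exp (c * (D i \<omega>)\<^sup>2 / s\<^sup>2)) \<partial>N)"
    by (intro indep_vars_nn_integral indep_vars_compose2[OF ind, where Y = "\<lambda>_ x. ennreal (exp (c * x\<^sup>2 / s\<^sup>2))"]) auto
  also have "\<dots> = (\<Prod>i<r. ennreal (1 / sqrt (1 - 2 * c)))"
    by (intro prod.cong refl normal_square_exp_moment dist s c)
  also have "\<dots> = ennreal ((1 / sqrt (1 - 2 * c)) ^ r)"
    using c by (simp add: ennreal_power)
  finally show ?thesis .
qed

lemma summable_scale_time_powr:
  assumes "0 < e"
  shows "summable (\<lambda>j. (real j / ln (real j)) powr (- (1 + e)))"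
proof (rule summable_comparison_test_ev)
  \<comment> \<open>Chosen so that the logarithm, bounded by \<open>j powr a / a\<close>, costs half
    of the excess: \<open>(1 - a) * (1 + e) = 1 + e / 2\<close>.\<close>
  define a where "a = e / (2 * (1 + e))"
  have a: "0 < a" using assms by (simp add: a_def)
  have a2: "a * (1 + e) = e / 2"
    unfolding a_def using assms by (simp add: divide_eq_eq)
  show "\<forall>\<^sub>F j in sequentially. norm ((real j / ln (real j)) powr (- (1 + e))) \<le>
      (1 / a) powr (1 + e) * real j powr (- (1 + e / 2))"
    using eventually_ge_at_top[of 2]
  proof eventually_elim
    case (elim j)
    have l: "0 < ln (real j)" using elim by simp
    have "(x / y) powr (- c) = (y / x) powr c" if "0 < x" "0 < y" for x y c :: real
      using that by (simp add: powr_minus powr_divide)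
    from this[of "real j" "ln (real j)" "1 + e"]
    have "(real j / ln (real j)) powr (- (1 + e)) = (ln (real j) / real j) powr (1 + e)"
      using l elim by simp
    also have "\<dots> \<le> (1 / a * real j powr (a - 1)) powr (1 + e)"
    proof (intro powr_mono2)
      have "ln (real j) \<le> real j powr a / a" using elim a by (intro ln_powr_bound) auto
      then show "ln (real j) / real j \<le> 1 / a * real j powr (a - 1)"
        using elim by (simp add: powr_diff divide_right_mono field_simps)
    qed (use assms l elim in auto)
    also have "\<dots> = (1 / a) powr (1 + e) * real j powr ((a - 1) * (1 + e))"
      using a by (simp add: powr_mult powr_powr powr_divide)
    also have "(a - 1) * (1 + e) = - (1 + e / 2)" using a2 by (simp add: algebra_simps)
    finally show ?case by simp
  qed
  show "summable (\<lambda>j. (1 / a) powr (1 + e) * real j powr (- (1 + e / 2)))"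
    using assms by (intro summable_mult, subst summable_real_powr_iff) auto
qed

text \<open>Chernoff's bound with \<open>c\<close> just below 1/2 gives probability at most a
  constant times \<open>ln T powr (- (1 + e / 2))\<close> for an energy beyond \<open>1 + e\<close>
  times the squared normalisation. At \<open>T = scale_time j\<close> the logarithm is
  \<open>j / ln j\<close>, so the series converges for every \<open>e\<close>.\<close>

lemma brownian_lil_energy_bound:
  assumes bm: "std_brownian_motion N B"
  shows "AE \<omega> in N. lil_energy_bound 1 (\<lambda>t. B t \<omega>)"
proof -
  interpret prob_space N using bm by (simp add: std_brownian_motion_def)
  have main: "AE \<omega> in N. \<exists>j0. \<forall>j\<ge>j0. increment_energy r (\<lambda>u. B (scale_time j * u) \<omega>) \<le>
     (1\<^sup>2 + 1 / real (Suc n)) * (lil_scale (scale_time j))\<^sup>2" if r: "1 \<le> r" for r n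
  proof -
    define e where "e = 1 / real (Suc n)"
    have e: "0 < e" by (simp add: e_def)
    \<comment> \<open>Between \<open>1 / (2 * (1 + e))\<close> and \<open>1 / 2\<close>: small
      enough for a finite exponential moment, large enough to leave an exponent beyond 1.\<close>
    define c where "c = (1 + e / 2) / (2 * (1 + e))"
    have c: "c < 1 / 2" "2 * c * (1 + e) = 1 + e / 2" "0 < c" using e by (auto simp: c_def field_simps)
    define C where "C = (1 / sqrt (1 - 2 * c)) ^ r"
    have C: "0 \<le> C" using c by (simp add: C_def)
    define En where "En j \<omega> = increment_energy r (\<lambda>u. B (scale_time j * u) \<omega>)" for j \<omega>
    have T0: "0 < scale_time j" for j by (simp add: scale_time_def)
    have [measurable]: "B (scale_time j * (real i / real r)) \<in> borel_measurable N" for i j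
      using T0[of j] by (intro brownian_measurable[OF bm]) simp
    have Enm[measurable]: "En j \<in> borel_measurable N" for j
      unfolding En_def[abs_def] increment_energy_def by measurable
    define F where "F j = {\<omega>\<in>space N. (1 + e) * (lil_scale (scale_time j))\<^sup>2 < En j \<omega>}" for j
    have pF: "prob (F j) \<le> C * (real j / ln (real j)) powr (- (1 + e / 2))" if j: "3 \<le> scale_time j" for j
    proof -
      define T where "T = scale_time j"
      have T: "3 \<le> T" "0 < T" using j by (auto simp: T_def)
      have lil2: "(lil_scale T)\<^sup>2 = 2 * T * ln (ln T)" using lnln_pos[OF T(1)] T by (simp add: lil_scale_def)
      have "F j = {\<omega>\<in>space N. (1 + e / 2) * ln (ln T) < c * En j \<omega> / T}"
      proof -
        have "(1 + e) * (lil_scale T)\<^sup>2 < x \<longleftrightarrow> (1 + e / 2) * ln (ln T) < c * x / T" for x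
        proof -
          have "(1 + e) * (lil_scale T)\<^sup>2 < x \<longleftrightarrow> c / T * ((1 + e) * (lil_scale T)\<^sup>2) < c / T * x"
            by (rule mult_less_cancel_left_pos[symmetric]) (use c(3) T in simp)
          also have "c / T * ((1 + e) * (lil_scale T)\<^sup>2) = (2 * c * (1 + e)) * ln (ln T)"
            unfolding lil2 using T by simp
          finally show ?thesis unfolding c(2) by simp
        qed
        then show ?thesis unfolding F_def T_def by simp
      qed
      also have "prob \<dots> \<le> C * exp (- ((1 + e / 2) * ln (ln T)))"
        unfolding T_def
      proof (rule chernoff_bound)
        show "(\<integral>\<^sup>+\<omega>. ennreal (exp (c * En j \<omega> / scale_time j)) \<partial>N) \<le> ennreal C"
          unfolding En_def C_def using brownian_energy_exp_moment[OF bm r T0 c(1)] by simp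
      qed (use C in auto)
      also have "exp (- ((1 + e / 2) * ln (ln T))) = ln T powr (- (1 + e / 2))"
        using lnln_pos[OF T(1)] T by (simp add: powr_def algebra_simps)
      also have "ln T = real j / ln (real j)" by (simp add: T_def scale_time_def)
      finally show ?thesis .
    qed
    have "AE \<omega> in N. eventually (\<lambda>j. \<omega> \<in> space N - F j) sequentially"
    proof (rule borel_cantelli_AE1)
      show "F j \<in> events" for j unfolding F_def by measurable
      show "emeasure N (F j) < \<infinity>" for j by (simp add: emeasure_eq_measure)
      have "\<forall>\<^sub>F j in sequentially. 3 \<le> scale_time j"
        using scale_time_at_top unfolding filterlim_at_top by blast
      then have "\<forall>\<^sub>F j in sequentially. norm (prob (F j)) \<le> C * (real j / ln (real j)) powr (- (1 + e / 2))"
        by eventually_elim (use pF in simp)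
      moreover have "summable (\<lambda>j. C * (real j / ln (real j)) powr (- (1 + e / 2)))"
        using e by (intro summable_mult summable_scale_time_powr) simp
      ultimately show "summable (\<lambda>j. prob (F j))" by (rule summable_comparison_test_ev)
    qed
    then show ?thesis
    proof (rule AE_mp, intro AE_I2 impI)
      fix \<omega> assume \<omega>: "\<omega> \<in> space N" and "eventually (\<lambda>j. \<omega> \<in> space N - F j) sequentially"
      then obtain j0 where "\<forall>j\<ge>j0. \<omega> \<in> space N - F j" unfolding eventually_sequentially by blast
      then show "\<exists>j0. \<forall>j\<ge>j0. increment_energy r (\<lambda>u. B (scale_time j * u) \<omega>) \<le>
        (1\<^sup>2 + 1 / real (Suc n)) * (lil_scale (scale_time j))\<^sup>2"
        using \<omega> by (intro exI[of _ j0]) (simp add: F_def En_def e_def not_less)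
    qed
  qed
  have "AE \<omega> in N. 1 \<le> r \<longrightarrow> (\<forall>n. \<exists>j0. \<forall>j\<ge>j0. increment_energy r (\<lambda>u. B (scale_time j * u) \<omega>) \<le>
     (1\<^sup>2 + 1 / real (Suc n)) * (lil_scale (scale_time j))\<^sup>2)" for r
  proof (cases "1 \<le> r")
    case True
    then show ?thesis unfolding AE_all_countable using main[OF True] by (simp add: AE_all_countable)
  qed simp
  then show ?thesis unfolding lil_energy_bound_def by (intro AE_all_countable[THEN iffD2] allI)
qed

section \<open>Lower bound: prescribed increments are approached infinitely often\<close>

lemma not_summable_one_over_linear:
  assumes "0 < (c :: real)"
  shows "\<not> summable (\<lambda>j. 1 / (real j * c))"
proof
  assume "summable (\<lambda>j. 1 / (real j * c))"
  then have "summable (\<lambda>j. c * (1 / (real j * c)))" by (rule summable_mult)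
  moreover have "(\<lambda>j. c * (1 / (real j * c))) = (\<lambda>j. inverse (real j))"
    using assms by (simp add: field_simps)
  ultimately show False using not_summable_harmonic[where 'a = real] by simp
qed

text \<open>The condition \<open>1 \<le> 2 * h / (sqrt (2 * pi) * s)\<close> disposes of the
  prefactors in \<open>normal_interval_lower_bound\<close>; what remains is a product of
  exponentials. In the application \<open>h\<close> is of the order of \<open>lil_scale\<close>, far
  above the standard deviation \<open>s\<close>.\<close>

lemma (in prob_space) indep_normals_hit_box:
  fixes r :: nat
  assumes ind: "indep_vars (\<lambda>_. borel) D {..<r}" and r: "2 \<le> r" and s: "0 < s"
    and dist: "\<And>i. i \<in> {1..<r} \<Longrightarrow> distributed M lborel (D i) (normal_density 0 s)"
    and h: "0 < h" "1 \<le> 2 * h / (sqrt (2 * pi) * s)"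
    and \<Lambda>: "(\<Sum>i\<in>{1..<r}. (\<bar>y i\<bar> + h)\<^sup>2 / (2 * s\<^sup>2)) \<le> \<Lambda>"
  shows "exp (- \<Lambda>) \<le> prob {\<omega>\<in>space M. \<forall>i\<in>{1..<r}. \<bar>D i \<omega> - y i\<bar> \<le> h}"
proof -
  have "indep_events (\<lambda>i. {\<omega>\<in>space M. \<bar>D i \<omega> - y i\<bar> \<le> h}) {..<r}"
    by (rule indep_eventsI_indep_vars[OF ind]) measurable
  then have "prob (\<Inter>i\<in>{1..<r}. {\<omega>\<in>space M. \<bar>D i \<omega> - y i\<bar> \<le> h}) = (\<Prod>i\<in>{1..<r}. prob {\<omega>\<in>space M. \<bar>D i \<omega> - y i\<bar> \<le> h})"
    using r unfolding indep_events_def by (elim conjE allE[of _ "{1..<r}"]) auto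
  moreover have "(\<Inter>i\<in>{1..<r}. {\<omega>\<in>space M. \<bar>D i \<omega> - y i\<bar> \<le> h}) = {\<omega>\<in>space M. \<forall>i\<in>{1..<r}. \<bar>D i \<omega> - y i\<bar> \<le> h}"
  proof -
    have "1 \<in> {1..<r}" using r by simp
    then show ?thesis by blast
  qed
  moreover have "exp (- \<Lambda>) \<le> (\<Prod>i\<in>{1..<r}. exp (- ((\<bar>y i\<bar> + h)\<^sup>2 / (2 * s\<^sup>2))))"
    using \<Lambda> by (simp add: exp_sum[symmetric] sum_negf)
  moreover have "\<dots> \<le> (\<Prod>i\<in>{1..<r}. prob {\<omega>\<in>space M. \<bar>D i \<omega> - y i\<bar> \<le> h})"
  proof (rule prod_mono)
    fix i assume i: "i \<in> {1..<r}"
    have "1 * exp (- ((\<bar>y i\<bar> + h)\<^sup>2 / (2 * s\<^sup>2))) \<le> 2 * h / (sqrt (2 * pi) * s) * exp (- ((\<bar>y i\<bar> + h)\<^sup>2 / (2 * s\<^sup>2)))"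
      using h by (intro mult_right_mono) auto
    also have "\<dots> \<le> prob {\<omega>\<in>space M. \<bar>D i \<omega> - y i\<bar> \<le> h}"
      by (rule normal_interval_lower_bound[OF dist[OF i] s]) (use h in simp)
    finally show "0 \<le> exp (- ((\<bar>y i\<bar> + h)\<^sup>2 / (2 * s\<^sup>2))) \<and>
      exp (- ((\<bar>y i\<bar> + h)\<^sup>2 / (2 * s\<^sup>2))) \<le> prob {\<omega>\<in>space M. \<bar>D i \<omega> - y i\<bar> \<le> h}" by simp
  qed
  ultimately show ?thesis by simp
qed


text \<open>The cells \<open>1, ..., r - 1\<close> of \<open>{0..r ^ j}\<close> fill the interval
  from \<open>r ^ (j - 1)\<close> to \<open>r ^ j\<close>, so the increment vectors for different
  \<open>j\<close> are independent. Under the strict energy condition the box around the prescribed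
  vector is hit, for large \<open>j\<close>, with probability at least
  \<open>exp (- ln (ln (r ^ j)))\<close>, which is \<open>1 / (j * ln r)\<close>, and the harmonic
  series diverges.\<close>

lemma brownian_lil_approximation:
  assumes bm: "std_brownian_motion N B"
  shows "AE \<omega> in N. lil_approximation 1 (\<lambda>t. B t \<omega>)"
proof -
  interpret prob_space N using bm by (simp add: std_brownian_motion_def)
  have main: "AE \<omega> in N. \<forall>J. \<exists>j\<ge>J. \<forall>i\<in>{1..<r}.
      \<bar>B (real r ^ j * (real (Suc i) / real r)) \<omega> - B (real r ^ j * (real i / real r)) \<omega> - 1 * y i * lil_scale (real r ^ j)\<bar>
        \<le> lil_scale (real r ^ j) / real (Suc n)"
    if r: "2 \<le> r" and y: "real r * (\<Sum>i\<in>{1..<r}. (y i)\<^sup>2) < 1" for r n :: nat and y :: "nat \<Rightarrow> real"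
  proof -
    define \<tau> where "\<tau> j i = real r ^ j * (real i / real r)" for i j
    define t where "t j = real r ^ j" for j
    have t0: "0 < t j" for j using r by (simp add: t_def)
    define D where "D j i \<omega> = B (\<tau> j (Suc i)) \<omega> - B (\<tau> j i) \<omega>" for j i \<omega>
    define ok where "ok j x \<longleftrightarrow> (\<forall>i\<in>{1..<r}. \<bar>x i - y i * lil_scale (t j)\<bar> \<le> lil_scale (t j) / real (Suc n))"
      for j and x :: "nat \<Rightarrow> real"
    define G where "G j = {\<omega>\<in>space N. ok j (\<lambda>i. D j i \<omega>)}" for j
    have \<tau>0: "0 \<le> \<tau> j i" for i j by (simp add: \<tau>_def)
    have [measurable]: "B (\<tau> j i) \<in> borel_measurable N" for i j by (rule brownian_measurable[OF bm \<tau>0])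
    have [measurable]: "D j i \<in> borel_measurable N" for i j unfolding D_def[abs_def] by measurable
    have Gev: "G j \<in> events" for j unfolding G_def ok_def by measurable
    have \<tau>lt: "\<tau> j i < \<tau> j (Suc i)" for i j
      unfolding \<tau>_def using r by (intro mult_strict_left_mono divide_strict_right_mono) auto
    have indep: "indep_events (\<lambda>j. space N - G j) {..<l}" for l
    proof -
      \<comment> \<open>Numbers all cells consecutively, cell \<open>i\<close> of block
        \<open>j\<close> as \<open>q = j * w + (i - 1)\<close>. The last time of block
        \<open>j\<close> is the first of block \<open>j + 1\<close>, so the times \<open>s q\<close>
        form one increasing sequence, to which the independence of consecutive increments
        applies.\<close>
      define w where "w = r - 1"
      have w: "0 < w" "Suc w = r" using r by (auto simp: w_def)
      define s where "s q = \<tau> (q div w) (Suc (q mod w))" for q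
      have sS: "s (Suc q) = \<tau> (q div w) (Suc (Suc (q mod w)))" for q
      proof (cases "Suc (q mod w) = w")
        case True
        then have "Suc q div w = Suc (q div w)" "Suc q mod w = 0" by (simp_all add: div_Suc mod_Suc)
        then have "s (Suc q) = real r ^ Suc (q div w) * (1 / real r)" by (simp add: s_def \<tau>_def)
        also have "\<dots> = real r ^ (q div w) * (real r / real r)" using r by simp
        also have "\<dots> = \<tau> (q div w) (Suc (Suc (q mod w)))" using True w by (simp add: \<tau>_def)
        finally show ?thesis .
      next
        case False
        then have "Suc q div w = q div w" "Suc q mod w = Suc (q mod w)" by (simp_all add: div_Suc mod_Suc)
        then show ?thesis by (simp add: s_def)
      qed
      have "indep_vars (\<lambda>_. borel) (\<lambda>q \<omega>. B (s (Suc q)) \<omega> - B (s q) \<omega>) {..<l * w}"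
      proof (rule brownian_indep[OF bm])
        show "0 \<le> s 0" by (simp add: s_def \<tau>0)
        show "s q \<le> s (Suc q)" for q unfolding sS by (simp add: s_def less_imp_le \<tau>lt)
      qed
      also have "(\<lambda>q \<omega>. B (s (Suc q)) \<omega> - B (s q) \<omega>) = (\<lambda>q. D (q div w) (Suc (q mod w)))"
        unfolding sS by (simp add: s_def D_def[abs_def])
      finally have ind: "indep_vars (\<lambda>_. borel) (\<lambda>q. D (q div w) (Suc (q mod w))) {..<l * w}" .
      define K where "K j = {j * w..<Suc j * w}" for j
      have "indep_vars (\<lambda>j. PiM (K j) (\<lambda>_. borel)) (\<lambda>j \<omega>. restrict (\<lambda>q. D (q div w) (Suc (q mod w)) \<omega>) (K j)) {..<l}"
      proof (rule indep_vars_restrict[OF ind])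
        fix j assume "j \<in> {..<l}"
        then have "Suc j * w \<le> l * w" by (intro mult_right_mono) auto
        then show "K j \<subseteq> {..<l * w}" by (auto simp: K_def)
      next
        show "disjoint_family_on K {..<l}"
          unfolding disjoint_family_on_def
        proof (intro ballI impI)
          fix i j :: nat assume "i \<noteq> j"
          have "q div w = j" if "q \<in> K j" for q j
          proof -
            have "j \<le> q div w" using that w by (simp add: K_def less_eq_div_iff_mult_less_eq)
            moreover have "q div w < Suc j" using that w by (simp add: K_def div_less_iff_less_mult)
            ultimately show ?thesis by simp
          qed
          then show "K i \<inter> K j = {}" using \<open>i \<noteq> j\<close> by blast
        qed
      qed
      then have "indep_events (\<lambda>j. {\<omega>\<in>space N. \<not> ok j (\<lambda>i. restrict (\<lambda>q. D (q div w) (Suc (q mod w)) \<omega>) (K j) (j * w + (i - 1)))}) {..<l}"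
      proof (rule indep_eventsI_indep_vars)
        fix j
        have mem: "j * w + (i - 1) \<in> K j" if "i \<in> {1..<r}" for i using that w by (auto simp: K_def)
        have "{f \<in> space (PiM (K j) (\<lambda>_. borel)). ok j (\<lambda>i. f (j * w + (i - 1)))} \<in> sets (PiM (K j) (\<lambda>_. borel :: real measure))"
          unfolding ok_def
        proof (rule sets.sets_Collect_finite_All')
          fix i assume i: "i \<in> {1..<r}"
          have [measurable]: "(\<lambda>f. f (j * w + (i - 1))) \<in> borel_measurable (PiM (K j) (\<lambda>_. borel :: real measure))"
            using mem[OF i] by (rule measurable_component_singleton)
          show "{f \<in> space (PiM (K j) (\<lambda>_. borel)). \<bar>f (j * w + (i - 1)) - y i * lil_scale (t j)\<bar> \<le> lil_scale (t j) / real (Suc n)}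
            \<in> sets (PiM (K j) (\<lambda>_. borel :: real measure))" by measurable
        qed (use r in auto)
        then show "{f \<in> space (PiM (K j) (\<lambda>_. borel)). \<not> ok j (\<lambda>i. f (j * w + (i - 1)))} \<in> sets (PiM (K j) (\<lambda>_. borel :: real measure))"
          by (rule sets.sets_Collect_neg)
      qed
      moreover have "{\<omega>\<in>space N. \<not> ok j (\<lambda>i. restrict (\<lambda>q. D (q div w) (Suc (q mod w)) \<omega>) (K j) (j * w + (i - 1)))} = space N - G j" for j
      proof -
        have "restrict (\<lambda>q. D (q div w) (Suc (q mod w)) \<omega>) (K j) (j * w + (i - 1)) = D j i \<omega>" if i: "i \<in> {1..<r}" for i \<omega>
        proof -
          obtain i' where i': "i = Suc i'" "i' < w" using i w by (cases i) auto
          then have "(j * w + i') div w = j" "(j * w + i') mod w = i'" "j * w + i' \<in> K j"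
            by (auto simp: K_def)
          then show ?thesis using i' by simp
        qed
        then have "ok j (\<lambda>i. restrict (\<lambda>q. D (q div w) (Suc (q mod w)) \<omega>) (K j) (j * w + (i - 1))) \<longleftrightarrow> ok j (\<lambda>i. D j i \<omega>)" for \<omega>
          unfolding ok_def by (intro ball_cong refl) simp
        then show ?thesis unfolding G_def by auto
      qed
      ultimately show ?thesis by simp
    qed
    have lower: "\<exists>j0. \<forall>j\<ge>j0. 1 / (real j * ln (real r)) \<le> prob (G j)"
    proof -
      \<comment> \<open>The strictness of the energy condition leaves room for a box of half-width
        \<open>h\<close> in units of \<open>lil_scale\<close>.\<close>
      have "((\<lambda>h. real r * (\<Sum>i\<in>{1..<r}. (\<bar>y i\<bar> + h)\<^sup>2)) \<longlongrightarrow> real r * (\<Sum>i\<in>{1..<r}. (\<bar>y i\<bar> + 0)\<^sup>2)) (at_right 0)"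
        by (intro tendsto_intros)
      then have "\<forall>\<^sub>F h in at_right 0. real r * (\<Sum>i\<in>{1..<r}. (\<bar>y i\<bar> + h)\<^sup>2) < 1"
        by (rule order_tendstoD(2)) (use y in simp)
      moreover have "\<forall>\<^sub>F h in at_right 0. h \<in> {0<..<1 / real (Suc n)}"
        by (rule eventually_at_right_real) simp
      ultimately have "\<forall>\<^sub>F h in at_right 0. real r * (\<Sum>i\<in>{1..<r}. (\<bar>y i\<bar> + h)\<^sup>2) < 1 \<and> h \<in> {0<..<1 / real (Suc n)}"
        by eventually_elim auto
      from eventually_happens'[OF trivial_limit_at_right_real this]
      obtain h :: real where "real r * (\<Sum>i\<in>{1..<r}. (\<bar>y i\<bar> + h)\<^sup>2) < 1 \<and> h \<in> {0<..<1 / real (Suc n)}" ..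
      then have h: "real r * (\<Sum>i\<in>{1..<r}. (\<bar>y i\<bar> + h)\<^sup>2) < 1" "0 < h" "h < 1 / real (Suc n)" by simp_all
      have r1: "1 < real r" using r by simp
      have lnr: "0 < ln (real r)" using r1 by simp
      have "filterlim (\<lambda>j. real j * ln (real r)) at_top sequentially"
        using lnr by (intro filterlim_at_top_mult_tendsto_pos[OF tendsto_const] filterlim_real_sequentially)
          (simp_all add: mult.commute)
      then have big: "\<forall>\<^sub>F j in sequentially. c \<le> real j * ln (real r)" for c
        unfolding filterlim_at_top by blast
      have "\<forall>\<^sub>F j in sequentially. 1 / (real j * ln (real r)) \<le> prob (G j)"
        \<comment> \<open>The first bound gives \<open>3 \<le> t j\<close>, the second
          \<open>pi / (4 * h\<^sup>2) \<le> L\<close>, which makes the prefactors in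
          \<open>indep_normals_hit_box\<close> at least 1.\<close>
        using big[of "ln 3"] big[of "exp (pi / (4 * h\<^sup>2))"]
      proof eventually_elim
        case (elim j)
        have lnt: "ln (t j) = real j * ln (real r)" using r by (simp add: t_def ln_realpow)
        have t3: "3 \<le> t j" using elim(1) t0[of j] unfolding lnt[symmetric] by simp
        define L where "L = ln (ln (t j))"
        have lnt0: "0 < ln (t j)" using t3 by simp
        have L: "0 < L" "pi / (4 * h\<^sup>2) \<le> L"
        proof -
          show "0 < L" using lnln_pos[OF t3] by (simp add: L_def)
          have "ln (exp (pi / (4 * h\<^sup>2))) \<le> L" unfolding L_def lnt using elim(2) lnt0 lnt by (subst ln_le_cancel_iff) auto
          then show "pi / (4 * h\<^sup>2) \<le> L" by simp
        qed
        have lil: "0 < lil_scale (t j)" "(lil_scale (t j))\<^sup>2 = 2 * t j * L"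
          using lil_scale_pos[OF t3] L t0[of j] by (auto simp: lil_scale_def L_def)
        define s where "s = sqrt (t j / r)"
        have s: "0 < s" "s\<^sup>2 = t j / r" using t0[of j] r by (auto simp: s_def)
        have diff: "\<tau> j (Suc i) - \<tau> j i = t j / r" for i
          by (simp add: \<tau>_def t_def right_diff_distrib[symmetric] diff_divide_distrib[symmetric])
        have "exp (- L) \<le> prob {\<omega>\<in>space N. \<forall>i\<in>{1..<r}. \<bar>D j i \<omega> - y i * lil_scale (t j)\<bar> \<le> h * lil_scale (t j)}"
        proof (rule indep_normals_hit_box[OF _ r s(1)])
          show "indep_vars (\<lambda>_. borel) (D j) {..<r}"
            unfolding D_def[abs_def] by (rule brownian_indep[OF bm]) (use \<tau>0 \<tau>lt in \<open>auto intro: less_imp_le\<close>)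
          show "distributed N lborel (D j i) (normal_density 0 s)" for i
            using brownian_increment[OF bm \<tau>0 \<tau>lt, of j i] unfolding D_def[abs_def] s_def diff .
          show "0 < h * lil_scale (t j)" using h lil by simp
          show "1 \<le> 2 * (h * lil_scale (t j)) / (sqrt (2 * pi) * s)"
          proof -
            have "(sqrt (2 * pi) * s)\<^sup>2 = 2 * pi * (t j / r)" using s by (simp add: power_mult_distrib)
            also have "\<dots> \<le> 2 * (4 * h\<^sup>2 * L) * t j"
            proof -
              have "pi \<le> 4 * h\<^sup>2 * L" using L(2) h(2) by (simp add: field_simps)
              then have "2 * pi \<le> 2 * (4 * h\<^sup>2 * L)" by linarith
              then have "2 * pi * (t j / r) \<le> 2 * (4 * h\<^sup>2 * L) * (t j / r)" by (rule mult_right_mono) (use t0[of j] in simp)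
              also have "\<dots> \<le> 2 * (4 * h\<^sup>2 * L) * t j"
              proof (intro mult_left_mono)
                show "t j / r \<le> t j" using t0[of j] r by (simp add: divide_le_eq)
              qed (use L in simp)
              finally show ?thesis .
            qed
            also have "\<dots> = (2 * (h * lil_scale (t j)))\<^sup>2" unfolding power_mult_distrib lil(2) by simp
            finally have "sqrt (2 * pi) * s \<le> 2 * (h * lil_scale (t j))"
              by (rule power2_le_imp_le) (use h lil in simp)
            moreover have "0 < sqrt (2 * pi) * s" using s by simp
            ultimately show ?thesis by simp
          qed
          show "(\<Sum>i\<in>{1..<r}. (\<bar>y i * lil_scale (t j)\<bar> + h * lil_scale (t j))\<^sup>2 / (2 * s\<^sup>2)) \<le> L"
          proof -
            have "(\<bar>y i * lil_scale (t j)\<bar> + h * lil_scale (t j))\<^sup>2 / (2 * s\<^sup>2) = L * (real r * (\<bar>y i\<bar> + h)\<^sup>2)" for i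
            proof -
              have "\<bar>y i * lil_scale (t j)\<bar> + h * lil_scale (t j) = (\<bar>y i\<bar> + h) * lil_scale (t j)"
                using lil by (simp add: abs_mult distrib_right)
              then show ?thesis
                unfolding s(2) using t0[of j] r by (simp add: power_mult_distrib lil(2))
            qed
            then have "(\<Sum>i\<in>{1..<r}. (\<bar>y i * lil_scale (t j)\<bar> + h * lil_scale (t j))\<^sup>2 / (2 * s\<^sup>2)) =
              L * (real r * (\<Sum>i\<in>{1..<r}. (\<bar>y i\<bar> + h)\<^sup>2))"
              by (simp add: sum_distrib_left)
            also have "\<dots> \<le> L * 1" using h(1) L(1) by (intro mult_left_mono) auto
            finally show ?thesis by simp
          qed
        qed
        also have "\<dots> \<le> prob (G j)"
        proof (rule finite_measure_mono[OF _ Gev])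
          have "h * lil_scale (t j) \<le> lil_scale (t j) / real (Suc n)"
            using mult_right_mono[OF less_imp_le[OF h(3)] less_imp_le[OF lil(1)]] by simp
          then show "{\<omega>\<in>space N. \<forall>i\<in>{1..<r}. \<bar>D j i \<omega> - y i * lil_scale (t j)\<bar> \<le> h * lil_scale (t j)} \<subseteq> G j"
            unfolding G_def ok_def by (auto intro: order_trans)
        qed
        also have "exp (- L) = 1 / (real j * ln (real r))"
          unfolding L_def lnt[symmetric] using lnt0 by (simp add: exp_minus inverse_eq_divide)
        finally show ?case .
      qed
      then show ?thesis unfolding eventually_sequentially .
    qed
    then obtain j0 where j0: "\<And>j. j0 \<le> j \<Longrightarrow> 1 / (real j * ln (real r)) \<le> prob (G j)" by blast
    have lnr: "0 < ln (real r)" using r by simp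
    have "AE \<omega> in N. \<forall>J. \<exists>j\<ge>J. \<omega> \<in> G j"
      by (rule indep_events_infinitely_often[OF indep Gev j0 _ not_summable_one_over_linear[OF lnr]]) (use lnr in auto)
    then show ?thesis
    proof (rule AE_mp, intro AE_I2 impI allI)
      fix \<omega> J assume "\<forall>J. \<exists>j\<ge>J. \<omega> \<in> G j"
      then obtain j where "J \<le> j" "\<omega> \<in> G j" by blast
      then show "\<exists>j\<ge>J. \<forall>i\<in>{1..<r}.
        \<bar>B (real r ^ j * (real (Suc i) / real r)) \<omega> - B (real r ^ j * (real i / real r)) \<omega> - 1 * y i * lil_scale (real r ^ j)\<bar>
        \<le> lil_scale (real r ^ j) / real (Suc n)"
        by (intro exI[of _ j]) (simp add: G_def ok_def D_def \<tau>_def t_def)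
    qed
  qed
  have "AE \<omega> in N. 2 \<le> r \<longrightarrow> (length y = r \<and> real r * (\<Sum>i\<in>{1..<r}. (real_of_rat (y ! i))\<^sup>2) < 1 \<longrightarrow>
     (\<forall>J. \<exists>j\<ge>J. \<forall>i\<in>{1..<r}. \<bar>B (real r ^ j * (real (Suc i) / real r)) \<omega> - B (real r ^ j * (real i / real r)) \<omega> -
        1 * real_of_rat (y ! i) * lil_scale (real r ^ j)\<bar> \<le> lil_scale (real r ^ j) / real (Suc n)))" for r n and y :: "rat list"
  proof (cases "2 \<le> r \<and> real r * (\<Sum>i\<in>{1..<r}. (real_of_rat (y ! i))\<^sup>2) < 1")
    case True
    then show ?thesis using main[of r "\<lambda>i. real_of_rat (y ! i)" n] by auto
  qed auto
  \<comment> \<open>Targets are lists of rationals, a countable type, so one null set serves all of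
    them.\<close>
  then have "AE \<omega> in N. \<forall>r. \<forall>y :: rat list. \<forall>n. 2 \<le> r \<longrightarrow> (length y = r \<and> real r * (\<Sum>i\<in>{1..<r}. (real_of_rat (y ! i))\<^sup>2) < 1 \<longrightarrow>
     (\<forall>J. \<exists>j\<ge>J. \<forall>i\<in>{1..<r}. \<bar>B (real r ^ j * (real (Suc i) / real r)) \<omega> - B (real r ^ j * (real i / real r)) \<omega> -
        1 * real_of_rat (y ! i) * lil_scale (real r ^ j)\<bar> \<le> lil_scale (real r ^ j) / real (Suc n)))"
    by (intro AE_all_countable[THEN iffD2] allI)
  then show ?thesis
    by (rule AE_mp, intro AE_I2 impI) (unfold lil_approximation_def, blast)
qed

section \<open>Transfer to the approximated process\<close>

lemma lil_scale_dominates: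
  assumes "0 < c"
  shows "\<forall>\<^sub>F t in at_top. sqrt t \<le> c * lil_scale t" "\<forall>\<^sub>F t in at_top. a \<le> c * lil_scale t"
proof -
  have "filterlim (\<lambda>t. lil_scale t / sqrt t) at_top at_top" unfolding lil_scale_def by real_asymp
  then have "\<forall>\<^sub>F t in at_top. 1 / c \<le> lil_scale t / sqrt t" unfolding filterlim_at_top by blast
  then show "\<forall>\<^sub>F t in at_top. sqrt t \<le> c * lil_scale t"
    using eventually_gt_at_top[of 0]
    by eventually_elim (use assms in \<open>simp add: field_simps\<close>)
  have "filterlim lil_scale at_top at_top" unfolding lil_scale_def[abs_def] by real_asymp
  then have "\<forall>\<^sub>F t in at_top. a / c \<le> lil_scale t" unfolding filterlim_at_top by blast
  then show "\<forall>\<^sub>F t in at_top. a \<le> c * lil_scale t"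
    by eventually_elim (use assms in \<open>simp add: field_simps\<close>)
qed

section \<open>Stability of the path properties under errors of order o(sqrt t)\<close>

context
  fixes b y :: "real \<Rightarrow> real" and \<sigma> :: real
  assumes err: "((\<lambda>t. (y t - \<sigma> * b t) / sqrt t) \<longlongrightarrow> 0) at_top"
begin

lemma approx_error_bound: "\<exists>t0\<ge>1. \<forall>t\<ge>t0. \<bar>y t - \<sigma> * b t\<bar> \<le> sqrt t"
proof -
  have "\<forall>\<^sub>F t in at_top. \<bar>(y t - \<sigma> * b t) / sqrt t\<bar> < 1"
    using tendstoD[OF err zero_less_one] by (simp add: dist_real_def)
  then obtain t1 where t1: "\<And>t. t1 \<le> t \<Longrightarrow> \<bar>(y t - \<sigma> * b t) / sqrt t\<bar> < 1"
    unfolding eventually_at_top_linorder by blast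
  have "\<bar>y t - \<sigma> * b t\<bar> \<le> sqrt t" if "max 1 t1 \<le> t" for t
  proof -
    have "0 < sqrt t" using that by simp
    then show ?thesis using t1[of t] that by (simp add: abs_divide divide_less_eq)
  qed
  then show ?thesis by (intro exI[of _ "max 1 t1"]) simp
qed

text \<open>For \<open>i \<ge> 1\<close> the time \<open>T * (i / r)\<close> grows with
  \<open>T\<close> and the error is at most \<open>sqrt T\<close>. At \<open>i = 0\<close> the error
  is a fixed number, again negligible against \<open>lil_scale T\<close>.\<close>

lemma approx_error_grid:
  assumes \<eta>: "0 < \<eta>" and r: "1 \<le> (r :: nat)"
  shows "\<forall>\<^sub>F T in at_top. \<forall>i\<le>r. \<bar>y (T * (real i / real r)) - \<sigma> * b (T * (real i / real r))\<bar> \<le> \<eta> * lil_scale T"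
proof -
  obtain t0 where t0: "1 \<le> t0" "\<forall>t\<ge>t0. \<bar>y t - \<sigma> * b t\<bar> \<le> sqrt t"
    using approx_error_bound by (elim exE conjE)
  show ?thesis
    using lil_scale_dominates(1)[OF \<eta>] lil_scale_dominates(2)[OF \<eta>, of "\<bar>y 0 - \<sigma> * b 0\<bar>"] eventually_ge_at_top[of "r * t0"]
  proof eventually_elim
    case (elim T)
    have T0: "0 < T" using elim(3) t0 r by (meson less_le_trans mult_pos_pos of_nat_0_less_iff zero_less_one less_eq_Suc_le One_nat_def)
    show ?case
    proof (intro allI impI)
      fix i assume i: "i \<le> r"
      show "\<bar>y (T * (real i / real r)) - \<sigma> * b (T * (real i / real r))\<bar> \<le> \<eta> * lil_scale T"
      proof (cases "i = 0")
        case True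
        then show ?thesis using elim(2) by simp
      next
        case False
        have "t0 \<le> T * (1 / r)" using elim(3) r by (simp add: field_simps)
        also have "\<dots> \<le> T * (real i / r)" using T0 False by (intro mult_left_mono divide_right_mono) auto
        finally have "\<bar>y (T * (real i / real r)) - \<sigma> * b (T * (real i / real r))\<bar> \<le> sqrt (T * (real i / r))" by (rule t0(2)[rule_format])
        also have "\<dots> \<le> sqrt (T * 1)"
        proof (intro real_sqrt_le_mono mult_left_mono)
          show "real i / r \<le> 1" using i r by simp
        qed (use T0 in simp)
        also have "\<dots> \<le> \<eta> * lil_scale T" using elim(1) by simp
        finally show ?thesis .
      qed
    qed
  qed
qed

text \<open>The bound by \<open>sqrt t\<close> starts at \<open>t0\<close>; the errors at the
  finitely many earlier integers are bounded by a constant \<open>C\<close>. Beyond them the error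
  is at most \<open>sqrt (2 ^ k)\<close>.\<close>

lemma approx_error_dyadic:
  assumes \<eta>: "0 < \<eta>"
  shows "\<forall>\<^sub>F k in sequentially. \<forall>n\<le>2 ^ k. \<bar>y (real n) - \<sigma> * b (real n)\<bar> \<le> \<eta> * lil_scale (2 ^ k)"
proof -
  obtain t0 where t0: "1 \<le> t0" "\<forall>t\<ge>t0. \<bar>y t - \<sigma> * b t\<bar> \<le> sqrt t"
    using approx_error_bound by (elim exE conjE)
  obtain n0 :: nat where n0: "t0 \<le> real n0" using real_arch_simple by blast
  define C where "C = (\<Sum>n\<le>n0. \<bar>y (real n) - \<sigma> * b (real n)\<bar>)"
  have pow: "filterlim (\<lambda>k. 2 ^ k :: real) at_top sequentially" by real_asymp
  show ?thesis
    using eventually_compose_filterlim[OF lil_scale_dominates(1)[OF \<eta>] pow]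
      eventually_compose_filterlim[OF lil_scale_dominates(2)[OF \<eta>, of C] pow]
  proof eventually_elim
    case (elim k)
    show ?case
    proof (intro allI impI)
      fix n :: nat assume n: "n \<le> 2 ^ k"
      show "\<bar>y (real n) - \<sigma> * b (real n)\<bar> \<le> \<eta> * lil_scale (2 ^ k)"
      proof (cases "n \<le> n0")
        case True
        then have "\<bar>y (real n) - \<sigma> * b (real n)\<bar> \<le> C" unfolding C_def by (intro member_le_sum) auto
        then show ?thesis using elim(2) by linarith
      next
        case False
        then have "\<bar>y (real n) - \<sigma> * b (real n)\<bar> \<le> sqrt (real n)" using n0 by (intro t0(2)[rule_format]) auto
        also have "real n \<le> 2 ^ k" using n by (metis of_nat_le_iff of_nat_numeral of_nat_power)
        then have "sqrt (real n) \<le> sqrt (2 ^ k)" by (rule real_sqrt_le_mono)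
        finally show ?thesis using elim(1) by linarith
      qed
    qed
  qed
qed

lemma dyadic_modulus_perturb:
  assumes "dyadic_modulus b"
  shows "dyadic_modulus y"
proof -
  obtain A :: nat where A: "\<forall>m. \<exists>k0. \<forall>k\<ge>k0. \<forall>i j. i \<le> j \<and> j \<le> 2 ^ k \<and> (j - i) * 2 ^ m \<le> 2 ^ k \<longrightarrow>
     \<bar>b (real j) - b (real i)\<bar> \<le> real A * 2 powr (- real m / 4) * lil_scale (2 ^ k)"
    using assms unfolding dyadic_modulus_def by (elim exE)
  \<comment> \<open>The 2 accounts for the errors at both endpoints, each at most
    \<open>q * lil_scale (2 ^ k)\<close>.\<close>
  define A' where "A' = nat \<lceil>\<bar>\<sigma>\<bar> * real A + 2\<rceil>"
  have A': "\<bar>\<sigma>\<bar> * real A + 2 \<le> real A'" unfolding A'_def by linarith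
  have "\<forall>m. \<exists>k0. \<forall>k\<ge>k0. \<forall>i j. i \<le> j \<and> j \<le> 2 ^ k \<and> (j - i) * 2 ^ m \<le> 2 ^ k \<longrightarrow>
     \<bar>y (real j) - y (real i)\<bar> \<le> real A' * 2 powr (- real m / 4) * lil_scale (2 ^ k)"
  proof
    fix m
    define q :: real where "q = 2 powr (- real m / 4)"
    have q: "0 < q" by (simp add: q_def)
    obtain k0 where k0: "\<forall>k\<ge>k0. \<forall>i j. i \<le> j \<and> j \<le> 2 ^ k \<and> (j - i) * 2 ^ m \<le> 2 ^ k \<longrightarrow>
      \<bar>b (real j) - b (real i)\<bar> \<le> real A * q * lil_scale (2 ^ k)"
      using A[rule_format, of m] unfolding q_def by (elim exE)
    obtain k1 where k1: "\<forall>k\<ge>k1. \<forall>n\<le>2 ^ k. \<bar>y (real n) - \<sigma> * b (real n)\<bar> \<le> q * lil_scale (2 ^ k)"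
      using approx_error_dyadic[OF q] unfolding eventually_sequentially by (elim exE)
    show "\<exists>k0. \<forall>k\<ge>k0. \<forall>i j. i \<le> j \<and> j \<le> 2 ^ k \<and> (j - i) * 2 ^ m \<le> 2 ^ k \<longrightarrow>
      \<bar>y (real j) - y (real i)\<bar> \<le> real A' * 2 powr (- real m / 4) * lil_scale (2 ^ k)"
    proof (rule exI[of _ "max 2 (max k0 k1)"], intro allI impI, elim conjE)
      fix k i j :: nat
      assume k: "max 2 (max k0 k1) \<le> k" and ij: "i \<le> j" "j \<le> 2 ^ k" "(j - i) * 2 ^ m \<le> 2 ^ k"
      have "(2 :: real) ^ 2 \<le> 2 ^ k" using k by (intro power_increasing) auto
      then have lil: "0 < lil_scale (2 ^ k)" by (intro lil_scale_pos) simp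
      have "\<bar>b (real j) - b (real i)\<bar> \<le> real A * q * lil_scale (2 ^ k)" using k0 k ij by simp
      then have 1: "\<bar>\<sigma> * (b (real j) - b (real i))\<bar> \<le> \<bar>\<sigma>\<bar> * (real A * q * lil_scale (2 ^ k))"
        unfolding abs_mult by (rule mult_left_mono) simp
      have 2: "\<bar>y (real j) - \<sigma> * b (real j)\<bar> \<le> q * lil_scale (2 ^ k)" "\<bar>y (real i) - \<sigma> * b (real i)\<bar> \<le> q * lil_scale (2 ^ k)"
        using k1 k ij by simp_all
      have "y (real j) - y (real i) = \<sigma> * (b (real j) - b (real i)) + (y (real j) - \<sigma> * b (real j)) - (y (real i) - \<sigma> * b (real i))"
        by (simp add: algebra_simps)
      then have "\<bar>y (real j) - y (real i)\<bar> \<le> \<bar>\<sigma>\<bar> * (real A * q * lil_scale (2 ^ k)) + q * lil_scale (2 ^ k) + q * lil_scale (2 ^ k)"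
        using 1 2 by linarith
      also have "\<dots> = (\<bar>\<sigma>\<bar> * real A + 2) * (q * lil_scale (2 ^ k))" by (simp add: algebra_simps)
      also have "\<dots> \<le> real A' * (q * lil_scale (2 ^ k))" using A' q lil by (intro mult_right_mono) auto
      finally show "\<bar>y (real j) - y (real i)\<bar> \<le> real A' * 2 powr (- real m / 4) * lil_scale (2 ^ k)"
        by (simp add: q_def mult_ac)
    qed
  qed
  then show ?thesis unfolding dyadic_modulus_def by (rule exI)
qed

text \<open>The inequality \<open>(a + v)\<^sup>2 \<le> (1 + \<kappa>) * a\<^sup>2 + (1 + 1 /
  \<kappa>) * v\<^sup>2\<close> separates the energy of \<open>b\<close> from the error, so a small
  \<open>\<kappa>\<close> spoils the constant \<open>\<sigma>\<^sup>2\<close> only slightly.\<close>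

lemma lil_energy_bound_perturb:
  assumes b: "lil_energy_bound 1 b"
  shows "lil_energy_bound \<sigma> y"
  unfolding lil_energy_bound_def
proof (intro allI impI)
  fix r n :: nat assume r: "1 \<le> r"
  define e where "e = 1 / real (Suc n)"
  have e: "0 < e" "e \<le> 1" by (simp_all add: e_def)
  define c where "c = \<sigma>\<^sup>2 + 1"
  have c: "1 \<le> c" "\<sigma>\<^sup>2 \<le> c" by (simp_all add: c_def)
  \<comment> \<open>The factor \<open>1 + \<kappa>\<close> occurs twice, from the separation and
    from the slack in the bound for \<open>b\<close>; with this \<open>\<kappa>\<close> it costs at
    most \<open>3 * e / 4\<close>.\<close>
  define \<kappa> where "\<kappa> = e / (4 * c)"
  have \<kappa>: "0 < \<kappa>" "\<kappa> \<le> 1" "4 * \<kappa> * \<sigma>\<^sup>2 \<le> e"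
  proof -
    show "0 < \<kappa>" using e c by (simp add: \<kappa>_def)
    show "\<kappa> \<le> 1" using e c by (simp add: \<kappa>_def divide_le_eq)
    have "4 * \<kappa> * \<sigma>\<^sup>2 = e * (\<sigma>\<^sup>2 / c)" by (simp add: \<kappa>_def)
    also have "\<dots> \<le> e * 1" using e c by (intro mult_left_mono) auto
    finally show "4 * \<kappa> * \<sigma>\<^sup>2 \<le> e" by simp
  qed
  obtain n' where "inverse (real (Suc n')) < \<kappa>" using reals_Archimedean[OF \<kappa>(1)] by blast
  then have n': "1 / real (Suc n') \<le> \<kappa>" by (simp add: inverse_eq_divide)
  \<comment> \<open>Leaves exactly \<open>e / 4\<close> for the error part, in which each difference
    of errors is at most \<open>2 * \<eta> * lil_scale T\<close>.\<close>
  define \<eta> where "\<eta> = sqrt (e / (16 * (real r)\<^sup>2 * (1 + 1 / \<kappa>)))"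
  have \<eta>2: "\<eta>\<^sup>2 = e / (16 * (real r)\<^sup>2 * (1 + 1 / \<kappa>))" "0 < \<eta>"
    using e \<kappa> r by (simp_all add: \<eta>_def add_pos_pos)
  have \<kappa>1: "0 < 1 + 1 / \<kappa>" using \<kappa> by (simp add: add_pos_pos)
  obtain j0 where j0: "\<forall>j\<ge>j0. increment_energy r (\<lambda>u. b (scale_time j * u)) \<le> (1\<^sup>2 + 1 / real (Suc n')) * (lil_scale (scale_time j))\<^sup>2"
    using b[unfolded lil_energy_bound_def, rule_format, OF r, of n'] by (elim exE)
  have "\<forall>\<^sub>F j in sequentially. \<forall>i\<le>r. \<bar>y (scale_time j * (real i / real r)) - \<sigma> * b (scale_time j * (real i / real r))\<bar> \<le> \<eta> * lil_scale (scale_time j)"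
    using approx_error_grid[OF \<eta>2(2) r] scale_time_at_top by (rule eventually_compose_filterlim)
  then obtain j1 where j1: "\<forall>j\<ge>j1. \<forall>i\<le>r. \<bar>y (scale_time j * (real i / real r)) - \<sigma> * b (scale_time j * (real i / real r))\<bar> \<le> \<eta> * lil_scale (scale_time j)"
    unfolding eventually_sequentially by (elim exE)
  show "\<exists>j0. \<forall>j\<ge>j0. increment_energy r (\<lambda>u. y (scale_time j * u)) \<le> (\<sigma>\<^sup>2 + 1 / real (Suc n)) * (lil_scale (scale_time j))\<^sup>2"
  proof (rule exI[of _ "max j0 j1"], intro allI impI)
    fix j assume j: "max j0 j1 \<le> j"
    define T where "T = scale_time j"
    define L where "L = (lil_scale T)\<^sup>2"
    define p where "p i = b (T * (real (Suc i) / real r)) - b (T * (real i / real r))" for i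
    define w where "w i = y (T * (real i / real r)) - \<sigma> * b (T * (real i / real r))" for i
    have w: "\<bar>w i\<bar> \<le> \<eta> * lil_scale T" if "i \<le> r" for i
      using j1 j that by (simp add: w_def T_def)
    have L: "0 \<le> L" by (simp add: L_def)
    have "increment_energy r (\<lambda>u. y (T * u)) = real r * (\<Sum>i<r. (\<sigma> * p i + (w (Suc i) - w i))\<^sup>2)"
      unfolding increment_energy_def
    proof (intro arg_cong2[where f = "(*)"] refl sum.cong)
      fix i
      have "y (T * (real (Suc i) / real r)) - y (T * (real i / real r)) = \<sigma> * p i + (w (Suc i) - w i)"
        unfolding p_def w_def by (simp only: right_diff_distrib)
      then show "(y (T * (real (Suc i) / real r)) - y (T * (real i / real r)))\<^sup>2 = (\<sigma> * p i + (w (Suc i) - w i))\<^sup>2" by simp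
    qed
    also have "\<dots> \<le> real r * (\<Sum>i<r. (1 + \<kappa>) * \<sigma>\<^sup>2 * (p i)\<^sup>2 + (1 + 1 / \<kappa>) * (4 * \<eta>\<^sup>2 * L))"
    proof (intro mult_left_mono sum_mono)
      fix i assume i: "i \<in> {..<r}"
      define v where "v = w (Suc i) - w i"
      have "\<bar>v\<bar> \<le> 2 * \<eta> * lil_scale T" using w[of i] w[of "Suc i"] i by (simp add: v_def)
      then have "\<bar>v\<bar>\<^sup>2 \<le> (2 * \<eta> * lil_scale T)\<^sup>2" by (intro power_mono) auto
      then have v2: "v\<^sup>2 \<le> 4 * \<eta>\<^sup>2 * L" by (simp add: L_def power_mult_distrib)
      have "0 \<le> (\<kappa> * (\<sigma> * p i) - v)\<^sup>2 / \<kappa>" using \<kappa>(1) by simp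
      also have "\<dots> = \<kappa> * (\<sigma> * p i)\<^sup>2 - 2 * (\<sigma> * p i) * v + v\<^sup>2 / \<kappa>"
        using \<kappa>(1) by (simp add: power2_eq_square field_simps)
      finally have "(\<sigma> * p i + v)\<^sup>2 \<le> (1 + \<kappa>) * (\<sigma> * p i)\<^sup>2 + (1 + 1 / \<kappa>) * v\<^sup>2"
        by (simp add: power2_sum algebra_simps)
      also have "\<dots> \<le> (1 + \<kappa>) * \<sigma>\<^sup>2 * (p i)\<^sup>2 + (1 + 1 / \<kappa>) * (4 * \<eta>\<^sup>2 * L)"
        using v2 \<kappa>1 by (intro add_mono mult_left_mono) (auto simp: power_mult_distrib)
      finally show "(\<sigma> * p i + (w (Suc i) - w i))\<^sup>2 \<le> (1 + \<kappa>) * \<sigma>\<^sup>2 * (p i)\<^sup>2 + (1 + 1 / \<kappa>) * (4 * \<eta>\<^sup>2 * L)"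
        by (simp only: v_def)
    qed simp
    also have "\<dots> = (1 + \<kappa>) * \<sigma>\<^sup>2 * increment_energy r (\<lambda>u. b (T * u)) + (real r)\<^sup>2 * (1 + 1 / \<kappa>) * 4 * \<eta>\<^sup>2 * L"
    proof -
      have lin: "real r * (\<Sum>i<r. A * Q i + C) = A * (real r * (\<Sum>i<r. Q i)) + (real r)\<^sup>2 * C" for A C :: real and Q :: "nat \<Rightarrow> real"
        by (simp add: sum.distrib sum_distrib_left[symmetric] power2_eq_square algebra_simps)
      have en: "increment_energy r (\<lambda>u. b (T * u)) = real r * (\<Sum>i<r. (p i)\<^sup>2)"
        by (simp only: increment_energy_def p_def)
      show ?thesis
        unfolding en lin[of "(1 + \<kappa>) * \<sigma>\<^sup>2" "\<lambda>i. (p i)\<^sup>2" "(1 + 1 / \<kappa>) * (4 * \<eta>\<^sup>2 * L)"]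
        by (simp only: mult.assoc)
    qed
    also have "(real r)\<^sup>2 * (1 + 1 / \<kappa>) * 4 * \<eta>\<^sup>2 * L = e / 4 * L"
    proof -
      have "R * k * 4 * (e / (16 * R * k)) * L = e / 4 * L" if "R \<noteq> 0" "k \<noteq> 0" for R k :: real
        using that by (simp add: field_simps)
      from this[of "(real r)\<^sup>2" "1 + 1 / \<kappa>"] show ?thesis unfolding \<eta>2(1) using r \<kappa>1 by simp
    qed
    also have "(1 + \<kappa>) * \<sigma>\<^sup>2 * increment_energy r (\<lambda>u. b (T * u)) \<le> (1 + \<kappa>) * \<sigma>\<^sup>2 * ((1 + \<kappa>) * L)"
    proof (intro mult_left_mono)
      have "increment_energy r (\<lambda>u. b (T * u)) \<le> (1\<^sup>2 + 1 / real (Suc n')) * L"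
        using j0 j unfolding T_def L_def by simp
      also have "\<dots> \<le> (1 + \<kappa>) * L" using n' L by (intro mult_right_mono) auto
      finally show "increment_energy r (\<lambda>u. b (T * u)) \<le> (1 + \<kappa>) * L" .
    qed (use \<kappa> in simp)
    also have "(1 + \<kappa>) * \<sigma>\<^sup>2 * ((1 + \<kappa>) * L) + e / 4 * L \<le> (\<sigma>\<^sup>2 + e) * L"
    proof -
      have "\<kappa> * \<kappa> * \<sigma>\<^sup>2 \<le> \<kappa> * 1 * \<sigma>\<^sup>2" using \<kappa> by (intro mult_right_mono mult_left_mono) auto
      moreover have "(1 + \<kappa>) * \<sigma>\<^sup>2 * (1 + \<kappa>) = \<sigma>\<^sup>2 + 2 * (\<kappa> * \<sigma>\<^sup>2) + \<kappa> * \<kappa> * \<sigma>\<^sup>2" by (simp add: algebra_simps)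
      ultimately have "(1 + \<kappa>) * \<sigma>\<^sup>2 * (1 + \<kappa>) + e / 4 \<le> \<sigma>\<^sup>2 + e" using \<kappa>(3) by linarith
      then have "((1 + \<kappa>) * \<sigma>\<^sup>2 * (1 + \<kappa>) + e / 4) * L \<le> (\<sigma>\<^sup>2 + e) * L" using L by (rule mult_right_mono)
      then show ?thesis by (simp add: algebra_simps)
    qed
    finally show "increment_energy r (\<lambda>u. y (scale_time j * u)) \<le> (\<sigma>\<^sup>2 + 1 / real (Suc n)) * (lil_scale (scale_time j))\<^sup>2"
      by (simp only: T_def L_def e_def)
  qed
qed

lemma lil_approximation_perturb:
  assumes b: "lil_approximation 1 b"
  shows "lil_approximation \<sigma> y"
  unfolding lil_approximation_def
proof (intro allI impI, elim conjE)
  fix r n J :: nat and q :: "rat list"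
  assume r: "2 \<le> r" and q: "length q = r" "real r * (\<Sum>i\<in>{1..<r}. (real_of_rat (q ! i))\<^sup>2) < 1"
  \<comment> \<open>Of the tolerance \<open>e\<close>, half goes to the approximation of
    \<open>b\<close>, scaled by \<open>\<sigma>\<close>, and a quarter to the error at each endpoint
    of a cell.\<close>
  define e where "e = 1 / real (Suc n)"
  have e: "0 < e" by (simp add: e_def)
  have "0 < e / (2 * (\<bar>\<sigma>\<bar> + 1))" using e by simp
  then obtain n' where "1 / real (Suc n') < e / (2 * (\<bar>\<sigma>\<bar> + 1))"
    using reals_Archimedean by (metis inverse_eq_divide)
  then have "\<bar>\<sigma>\<bar> * (1 / real (Suc n')) \<le> \<bar>\<sigma>\<bar> * (e / (2 * (\<bar>\<sigma>\<bar> + 1)))" by (intro mult_left_mono) auto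
  also have "\<dots> = e / 2 * (\<bar>\<sigma>\<bar> / (\<bar>\<sigma>\<bar> + 1))" by simp
  also have "\<dots> \<le> e / 2 * 1" using e by (intro mult_left_mono) auto
  finally have n': "\<bar>\<sigma>\<bar> * (1 / real (Suc n')) \<le> e / 2" by simp
  have e4: "0 < e / 4" and r1: "1 \<le> r" using e r by auto
  obtain T0 where T0: "\<forall>T\<ge>T0. \<forall>i\<le>r. \<bar>y (T * (real i / real r)) - \<sigma> * b (T * (real i / real r))\<bar> \<le> e / 4 * lil_scale T"
    using approx_error_grid[OF e4 r1] unfolding eventually_at_top_linorder by (elim exE)
  have "\<exists>J. max 3 T0 < real r ^ J" by (rule real_arch_pow) (use r in simp)
  then obtain J' where J': "max 3 T0 < real r ^ J'" by (rule exE)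
  obtain j where j: "max J J' \<le> j" and inc: "\<forall>i\<in>{1..<r}. \<bar>b (real r ^ j * (real (Suc i) / real r)) - b (real r ^ j * (real i / real r)) -
        1 * real_of_rat (q ! i) * lil_scale (real r ^ j)\<bar> \<le> lil_scale (real r ^ j) / real (Suc n')"
    using b[unfolded lil_approximation_def, rule_format, OF r conjI[OF q], of "max J J'" n'] by (elim exE conjE)
  define t where "t = real r ^ j"
  have "real r ^ J' \<le> t" unfolding t_def using j r by (intro power_increasing) auto
  then have t: "3 \<le> t" "T0 \<le> t" using J' by auto
  have lil: "0 < lil_scale t" using t(1) by (rule lil_scale_pos)
  have "\<bar>y (t * (real (Suc i) / real r)) - y (t * (real i / real r)) - \<sigma> * real_of_rat (q ! i) * lil_scale t\<bar> \<le> lil_scale t / real (Suc n)"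
    if i: "i \<in> {1..<r}" for i
  proof -
    define t1 t2 where "t1 = t * (real i / real r)" and "t2 = t * (real (Suc i) / real r)"
    have 1: "\<bar>b t2 - b t1 - real_of_rat (q ! i) * lil_scale t\<bar> \<le> lil_scale t / real (Suc n')"
      using bspec[OF inc i] by (simp only: t_def t1_def t2_def mult_1_left)
    have 2: "\<bar>y t1 - \<sigma> * b t1\<bar> \<le> e / 4 * lil_scale t" "\<bar>y t2 - \<sigma> * b t2\<bar> \<le> e / 4 * lil_scale t"
      unfolding t1_def t2_def by (rule T0[rule_format, OF t(2)]; use i in simp)+
    have "\<bar>\<sigma> * (b t2 - b t1 - real_of_rat (q ! i) * lil_scale t)\<bar> \<le> \<bar>\<sigma>\<bar> * (lil_scale t / real (Suc n'))"
      unfolding abs_mult using 1 by (rule mult_left_mono) simp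
    also have "\<dots> = \<bar>\<sigma>\<bar> * (1 / real (Suc n')) * lil_scale t" by simp
    also have "\<dots> \<le> e / 2 * lil_scale t" using n' lil by (intro mult_right_mono) auto
    finally have 3: "\<bar>\<sigma> * (b t2 - b t1 - real_of_rat (q ! i) * lil_scale t)\<bar> \<le> e / 2 * lil_scale t" .
    have "y t2 - y t1 - \<sigma> * real_of_rat (q ! i) * lil_scale t =
      \<sigma> * (b t2 - b t1 - real_of_rat (q ! i) * lil_scale t) + (y t2 - \<sigma> * b t2) - (y t1 - \<sigma> * b t1)"
      by (simp add: algebra_simps)
    moreover have "lil_scale t / real (Suc n) = e / 2 * lil_scale t + e / 4 * lil_scale t + e / 4 * lil_scale t"
    proof -
      have "lil_scale t / real (Suc n) = e * lil_scale t" by (simp add: e_def)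
      then show ?thesis by (simp add: field_simps)
    qed
    ultimately show ?thesis using 2 3 unfolding t1_def[symmetric] t2_def[symmetric] by linarith
  qed
  then show "\<exists>j\<ge>J. \<forall>i\<in>{1..<r}. \<bar>y (real r ^ j * (real (Suc i) / real r)) - y (real r ^ j * (real i / real r)) -
        \<sigma> * real_of_rat (q ! i) * lil_scale (real r ^ j)\<bar> \<le> lil_scale (real r ^ j) / real (Suc n)"
    using j unfolding t_def by (intro exI[of _ j]) auto
qed

end

section \<open>Transfer through equality of distributions\<close>

definition strassen_path :: "real \<Rightarrow> (real \<Rightarrow> real) \<Rightarrow> bool" where
  "strassen_path \<sigma> z \<longleftrightarrow> dyadic_modulus z \<and> lil_energy_bound \<sigma> z \<and> lil_approximation \<sigma> z"

lemma strassen_path_restrict: "strassen_path \<sigma> (restrict z {0..}) \<longleftrightarrow> strassen_path \<sigma> z"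
proof -
  have "0 \<le> scale_time j" for j by (simp add: scale_time_def)
  then show ?thesis
    unfolding strassen_path_def dyadic_modulus_def lil_energy_bound_def lil_approximation_def increment_energy_def
    by simp
qed

text \<open>Quantifiers over naturals and rational lists, and conditions on finitely many
  coordinates: this is the purpose of the form given to the three properties, since events of the
  product sigma-algebra are what a distribution determines.\<close>

lemma measurable_strassen_path:
  "{z \<in> space (PiM {0..} (\<lambda>_. borel)). strassen_path \<sigma> z} \<in> sets (PiM {0..} (\<lambda>_. borel :: real measure))"
proof -
  let ?M = "PiM {0 :: real..} (\<lambda>_. borel :: real measure)"
  have *: "(\<lambda>z. z t) \<in> borel_measurable ?M" if "0 \<le> t" for t
    using that by (intro measurable_component_singleton) simp
  have s0: "0 \<le> scale_time j" for j by (simp add: scale_time_def)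
  have [measurable]: "(\<lambda>z. z (real n)) \<in> borel_measurable ?M" for n by (rule *) simp
  have [measurable]: "(\<lambda>z. z (scale_time j * (real i / real r))) \<in> borel_measurable ?M" for i j r
    by (rule *) (simp add: s0)
  have [measurable]: "(\<lambda>z. z (real r ^ j * (real i / real r))) \<in> borel_measurable ?M" for i j r
    by (rule *) simp
  have [measurable]: "Measurable.pred ?M dyadic_modulus" unfolding dyadic_modulus_def by measurable
  have [measurable]: "Measurable.pred ?M (lil_energy_bound \<sigma>)"
    unfolding lil_energy_bound_def increment_energy_def by measurable
  have [measurable]: "Measurable.pred ?M (lil_approximation \<sigma>)"
    unfolding lil_approximation_def by measurable
  show ?thesis unfolding strassen_path_def by measurable
qed

text \<open>The perturbation lemmas are applied to \<open>Y\<close> on the space that carries the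
  Brownian motion; the resulting almost sure event depends on the distribution of the path alone and
  therefore holds for \<open>Z\<close> as well. An error of order
  \<open>t powr (1/2 - \<alpha>)\<close> is o(sqrt t) because \<open>\<alpha> > 0\<close>.\<close>

lemma strong_approx_strassen_path:
  fixes M :: "'a measure"
  assumes "strong_approx TYPE('b) M Z \<sigma>"
  shows "AE \<omega> in M. strassen_path \<sigma> (\<lambda>t. Z t \<omega>)"
proof -
  obtain \<alpha> and N :: "'b measure" and Y B where \<alpha>: "0 < \<alpha>" and bm: "std_brownian_motion N B" and law: "same_law M Z N Y"
    and lim: "AE \<omega> in N. Limsup at_top (\<lambda>t. ereal (\<bar>Y t \<omega> - \<sigma> * B t \<omega>\<bar> * t powr (- (1/2 - \<alpha>)))) < \<infinity>"
    using assms unfolding strong_approx_def by (elim exE conjE)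
  have "AE \<omega> in N. strassen_path \<sigma> (\<lambda>t. Y t \<omega>)"
    using lim brownian_dyadic_modulus[OF bm] brownian_lil_energy_bound[OF bm] brownian_lil_approximation[OF bm]
  proof eventually_elim
    case (elim \<omega>)
    define y where "y t = Y t \<omega>" for t
    define b where "b t = B t \<omega>" for t
    obtain C :: real where C: "Limsup at_top (\<lambda>t. ereal (\<bar>y t - \<sigma> * b t\<bar> * t powr (- (1/2 - \<alpha>)))) < ereal C"
      using elim(1) ereal_dense2 unfolding y_def b_def by blast
    have err: "((\<lambda>t. (y t - \<sigma> * b t) / sqrt t) \<longlongrightarrow> 0) at_top"
    proof (rule Lim_null_comparison)
      show "\<forall>\<^sub>F t in at_top. norm ((y t - \<sigma> * b t) / sqrt t) \<le> C * t powr (- \<alpha>)"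
        using Limsup_lessD[OF C] eventually_gt_at_top[of 0]
      proof eventually_elim
        case (elim t)
        have "t powr (- (1/2 - \<alpha>)) * t powr (- \<alpha>) = t powr (- (1 / 2))"
          by (simp add: powr_add[symmetric])
        also have "\<dots> = 1 / sqrt t"
          using elim(2) by (simp add: powr_minus powr_half_sqrt inverse_eq_divide)
        finally have eq: "1 / sqrt t = t powr (- (1/2 - \<alpha>)) * t powr (- \<alpha>)" ..
        have "norm ((y t - \<sigma> * b t) / sqrt t) = \<bar>y t - \<sigma> * b t\<bar> * (1 / sqrt t)"
          using elim(2) by (simp add: abs_divide)
        also have "\<dots> = \<bar>y t - \<sigma> * b t\<bar> * t powr (- (1/2 - \<alpha>)) * t powr (- \<alpha>)"
          by (simp only: eq mult.assoc)
        also have "\<dots> \<le> C * t powr (- \<alpha>)"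
        proof (rule mult_right_mono)
          show "\<bar>y t - \<sigma> * b t\<bar> * t powr (- (1/2 - \<alpha>)) \<le> C" using less_imp_le[OF elim(1)] by (simp only: ereal_less_eq)
        qed simp
        finally show ?case .
      qed
      have "((\<lambda>t :: real. t powr (- \<alpha>)) \<longlongrightarrow> 0) at_top"
        using \<alpha> by (intro tendsto_neg_powr filterlim_ident) auto
      then show "((\<lambda>t. C * t powr (- \<alpha>)) \<longlongrightarrow> 0) at_top"
        using tendsto_mult_left[of _ 0 at_top C] by simp
    qed
    show ?case
      using elim(2-4) dyadic_modulus_perturb[OF err] lil_energy_bound_perturb[OF err] lil_approximation_perturb[OF err]
      unfolding strassen_path_def y_def b_def by blast
  qed
  then have "AE \<omega> in N. strassen_path \<sigma> (\<lambda>t\<in>{0..}. Y t \<omega>)" by (simp add: strassen_path_restrict)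
  moreover have Ym: "(\<lambda>\<omega>. \<lambda>t\<in>{0..}. Y t \<omega>) \<in> measurable N (PiM {0..} (\<lambda>_. borel))"
    using law unfolding same_law_def by (intro measurable_restrict) auto
  ultimately have "AE z in distr N (PiM {0..} (\<lambda>_. borel)) (\<lambda>\<omega>. \<lambda>t\<in>{0..}. Y t \<omega>). strassen_path \<sigma> z"
    using measurable_strassen_path by (subst AE_distr_iff) auto
  then have "AE z in distr M (PiM {0..} (\<lambda>_. borel)) (\<lambda>\<omega>. \<lambda>t\<in>{0..}. Z t \<omega>). strassen_path \<sigma> z"
    using law[unfolded same_law_def, THEN conjunct2, THEN conjunct2] by (simp only:)
  moreover have Zm: "(\<lambda>\<omega>. \<lambda>t\<in>{0..}. Z t \<omega>) \<in> measurable M (PiM {0..} (\<lambda>_. borel))"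
    using law unfolding same_law_def by (intro measurable_restrict) auto
  ultimately have "AE \<omega> in M. strassen_path \<sigma> (\<lambda>t\<in>{0..}. Z t \<omega>)"
    using measurable_strassen_path by (subst (asm) AE_distr_iff) auto
  then show ?thesis by (simp add: strassen_path_restrict)
qed

text \<open>A deterministic statement: chance enters only through the null set outside which
  \<open>strassen_path\<close> holds.\<close>

theorem strassen_law:
  assumes step: "\<And>t. 0 \<le> t \<Longrightarrow> z t = z (real (nat \<lfloor>t\<rfloor>))" and z0: "z 0 = 0"
    and z: "strassen_path \<sigma> z" and \<sigma>: "0 \<le> \<sigma>"
  shows "asymp_equicontinuous z" "limit_points unif_top (path_zeta z) = strassen_set \<sigma>"
proof -
  show ae: "asymp_equicontinuous z"
    using z by (intro asymp_equicontinuousI step z0) (auto simp: strassen_path_def)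
  have "lil_energy_bound \<sigma> z" "lil_approximation \<sigma> z" using z by (auto simp: strassen_path_def)
  then show "limit_points unif_top (path_zeta z) = strassen_set \<sigma>"
    using limit_points_subset_strassen_set[OF ae] strassen_set_subset_limit_points[OF ae _ \<sigma>] by blast
qed

section \<open>Application to the nonconventional sums\<close>

lemma Xi_part_step:
  assumes "0 \<le> t"
  shows "Xi_part l \<mu> F X qs i t \<omega> = Xi_part l \<mu> F X qs i (real (nat \<lfloor>t\<rfloor>)) \<omega>"
proof -
  have "real n \<le> t \<longleftrightarrow> n \<le> nat \<lfloor>t\<rfloor>" for n using assms by (simp add: le_nat_iff le_floor_iff)
  then show ?thesis unfolding Xi_part_def by simp
qed

lemma Xi_part_0: "Xi_part l \<mu> F X qs i 0 \<omega> = 0"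
  unfolding Xi_part_def by (rule sum.neutral) auto

lemma zeta_eq_path_zeta: "zeta Z \<omega> = path_zeta (\<lambda>t. Z t \<omega>)"
  by (rule ext) (simp add: zeta_def path_zeta_def)

text \<open>The Brownian motions for different \<open>i\<close> may live on different spaces, so no
  joint approximation is available. Part (2) does without one: the first part holds on
  \<open>M\<close> itself for each of finitely many \<open>i\<close>, hence for all of them off one
  null set, and the rest concerns the paths at a fixed \<open>\<omega>\<close>.\<close>

lemma strassen_law_sums:
  fixes M :: "'a measure"
  assumes \<sigma>: "\<And>i. i \<in> {1..l} \<Longrightarrow> 0 \<le> \<sigma> i"
    and sa: "\<And>i. i \<in> {1..l} \<Longrightarrow> strong_approx TYPE('b) M (Xi_part l \<mu> F X qs i) (\<sigma> i)"
  shows "(\<forall>i\<in>{1..l}. compactin unif_top (strassen_set (\<sigma> i)) \<and>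
            (AE \<omega> in M.
               rel_compact_family unif_top (zeta (Xi_part l \<mu> F X qs i) \<omega>) \<and>
               limit_points unif_top (zeta (Xi_part l \<mu> F X qs i) \<omega>) = strassen_set (\<sigma> i))) \<and>
         compactin unif_top (strassen_sum_set l \<sigma>) \<and>
         (AE \<omega> in M.
            rel_compact_family unif_top (zeta (Xi l \<mu> F X qs) \<omega>) \<and>
            limit_points unif_top (zeta (Xi l \<mu> F X qs) \<omega>) \<subseteq> strassen_sum_set l \<sigma>)"
proof (intro conjI ballI)
  have path: "AE \<omega> in M. asymp_equicontinuous (\<lambda>t. Xi_part l \<mu> F X qs i t \<omega>) \<and>
      limit_points unif_top (zeta (Xi_part l \<mu> F X qs i) \<omega>) = strassen_set (\<sigma> i)" if i: "i \<in> {1..l}" for i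
    using strong_approx_strassen_path[OF sa[OF i]]
  proof eventually_elim
    case (elim \<omega>)
    show ?case
      unfolding zeta_eq_path_zeta
      using strassen_law[OF Xi_part_step Xi_part_0 elim \<sigma>[OF i]] by simp
  qed
  show "compactin unif_top (strassen_set (\<sigma> i))" if "i \<in> {1..l}" for i
    using that \<sigma> by (intro compactin_strassen_set) auto
  show "AE \<omega> in M. rel_compact_family unif_top (zeta (Xi_part l \<mu> F X qs i) \<omega>) \<and>
      limit_points unif_top (zeta (Xi_part l \<mu> F X qs i) \<omega>) = strassen_set (\<sigma> i)" if "i \<in> {1..l}" for i
    using path[OF that]
  proof eventually_elim
    case (elim \<omega>)
    then show ?case using asymp_equicontinuous_rel_compact unfolding zeta_eq_path_zeta by blast
  qed
  show "compactin unif_top (strassen_sum_set l \<sigma>)"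
    using \<sigma> by (rule compactin_strassen_sum_set)
  have "AE \<omega> in M. \<forall>i\<in>{1..l}. asymp_equicontinuous (\<lambda>t. Xi_part l \<mu> F X qs i t \<omega>) \<and>
      limit_points unif_top (zeta (Xi_part l \<mu> F X qs i) \<omega>) = strassen_set (\<sigma> i)"
    using path by (intro AE_finite_allI) auto
  then show "AE \<omega> in M. rel_compact_family unif_top (zeta (Xi l \<mu> F X qs) \<omega>) \<and>
      limit_points unif_top (zeta (Xi l \<mu> F X qs) \<omega>) \<subseteq> strassen_sum_set l \<sigma>"
  proof eventually_elim
    case (elim \<omega>)
    have ae: "\<And>i. i \<in> {1..l} \<Longrightarrow> asymp_equicontinuous (\<lambda>t. Xi_part l \<mu> F X qs i t \<omega>)"
      and lp: "\<And>i. i \<in> {1..l} \<Longrightarrow> limit_points unif_top (path_zeta (\<lambda>t. Xi_part l \<mu> F X qs i t \<omega>)) = strassen_set (\<sigma> i)"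
      using elim unfolding zeta_eq_path_zeta by blast+
    have eq: "zeta (Xi l \<mu> F X qs) \<omega> = path_zeta (\<lambda>t. \<Sum>i=1..l. Xi_part l \<mu> F X qs i t \<omega>)"
      unfolding zeta_eq_path_zeta Xi_def ..
    have "rel_compact_family unif_top (path_zeta (\<lambda>t. \<Sum>i=1..l. Xi_part l \<mu> F X qs i t \<omega>))"
      by (intro asymp_equicontinuous_rel_compact asymp_equicontinuous_sum ae finite_atLeastAtMost)
    moreover have "limit_points unif_top (path_zeta (\<lambda>t. \<Sum>i=1..l. Xi_part l \<mu> F X qs i t \<omega>)) \<subseteq> strassen_sum_set l \<sigma>"
      by (rule limit_points_sum[OF ae lp])
    ultimately show ?case unfolding eq by (rule conjI)
  qed
qed

theorem corollary2p3:
  fixes M :: "'a measure"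
    and X :: "nat \<Rightarrow> 'a \<Rightarrow> real^'p"
    and Fs :: "int extended \<Rightarrow> int extended \<Rightarrow> 'a measure"
    and \<mu> :: "(real^'p) measure"
    and \<nu> :: "int \<Rightarrow> ((real^'p) \<times> (real^'p)) measure"
    and F :: "(nat \<Rightarrow> real^'p) \<Rightarrow> real"
    and qs :: "nat \<Rightarrow> real \<Rightarrow> real"
    and l k :: nat
    and \<iota> K0 \<kappa> p q \<delta> m :: real
    and \<sigma> :: "nat \<Rightarrow> real"
  assumes "prob_space M"
    \<comment> \<open>the process\<close>
    and "\<And>n. X n \<in> borel_measurable M"
    and "\<And>n. distr M borel (X n) = \<mu>"
    and "\<And>n n'. distr M (borel \<Otimes>\<^sub>M borel) (\<lambda>\<omega>. (X n \<omega>, X n' \<omega>)) = \<nu> (int n - int n')"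
    \<comment> \<open>the \<sigma>-algebras\<close>
    and "\<And>a b. a \<le> b \<Longrightarrow> subalgebra M (Fs a b)"
    and "\<And>a b a' b'. a \<le> b \<Longrightarrow> a' \<le> a \<Longrightarrow> b \<le> b' \<Longrightarrow> sets (Fs a b) \<subseteq> sets (Fs a' b')"
    \<comment> \<open>the function F\<close>
    and "1 \<le> l"
    and "0 < \<iota>" "0 < K0" "0 < \<kappa>" "\<kappa> \<le> 1"
    and "\<And>x y. \<bar>F x - F y\<bar> \<le>
           K0 * (1 + (\<Sum>j=1..l. norm (x j) powr \<iota>) + (\<Sum>j=1..l. norm (y j) powr \<iota>)) *
           (\<Sum>j=1..l. norm (x j - y j) powr \<kappa>)"
    and "\<And>x. \<bar>F x\<bar> \<le> K0 * (1 + (\<Sum>j=1..l. norm (x j) powr \<iota>))"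
    and "(\<integral>x. F x \<partial>(Pi\<^sub>M {1..l} (\<lambda>_. \<mu>))) = 0"
    \<comment> \<open>the functions q_i\<close>
    and "1 \<le> k" "k \<le> l"
    and "\<And>i. i \<in> {1..l} \<Longrightarrow> mono_on {0<..} (qs i)"
    and "\<And>i (n::nat). i \<in> {1..l} \<Longrightarrow> 1 \<le> n \<Longrightarrow> qs i (real n) \<in> \<int> \<and> 0 < qs i (real n)"
    and "\<And>i (n::nat). 1 \<le> i \<Longrightarrow> i < l \<Longrightarrow> 1 \<le> n \<Longrightarrow> qs i (real n) < qs (Suc i) (real n)"
    and "\<And>j (n::nat). j \<in> {1..k} \<Longrightarrow> 1 \<le> n \<Longrightarrow> qs j (real n) = real j * real n"
    and "\<exists>d0>0. \<forall>i\<in>{k+1..l}. \<forall>n::nat. 2 \<le> n \<longrightarrow>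
           real n powr d0 \<le> qs i (real n + 1) - qs i (real n)"
    and "\<And>i \<epsilon>. k \<le> i \<Longrightarrow> i < l \<Longrightarrow> 0 < \<epsilon> \<Longrightarrow>
           0 < liminf (\<lambda>n::nat. ereal (qs (Suc i) (\<epsilon> * real n) - qs i (real n)))"
    \<comment> \<open>moment and mixing conditions, with d = (l - 1) CARD('p)\<close>
    and "1 \<le> p" "1 \<le> q" "0 < \<delta>" "0 < m"
    and "\<delta> < \<kappa> - real ((l - 1) * CARD('p)) / p"
    and "(\<Sum>n. ennreal (real n powr \<delta>) * mixing_coeff M Fs q p n) < \<infinity>"
    and "(\<Sum>r. epowr (of_nat r * approx_coeff M Fs X q r) \<delta>) < \<infinity>"
    and "moment_norm \<mu> m < \<infinity>"
    and "moment_norm \<mu> (2 * q * (\<iota> + 2)) < \<infinity>"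
    and "1 / (2 + \<delta>) \<ge> 1 / p + (\<iota> + 2) / m + \<delta> / q"
    \<comment> \<open>the constants of the strong approximation\<close>
    and "\<And>i. i \<in> {1..l} \<Longrightarrow> 0 \<le> \<sigma> i"
    and "\<And>i. i \<in> {1..l} \<Longrightarrow> strong_approx TYPE('b) M (Xi_part l \<mu> F X qs i) (\<sigma> i)"
  shows "(\<forall>i\<in>{1..l}. compactin unif_top (strassen_set (\<sigma> i)) \<and>
            (AE \<omega> in M.
               rel_compact_family unif_top (zeta (Xi_part l \<mu> F X qs i) \<omega>) \<and>
               limit_points unif_top (zeta (Xi_part l \<mu> F X qs i) \<omega>) = strassen_set (\<sigma> i))) \<and>
         compactin unif_top (strassen_sum_set l \<sigma>) \<and>
         (AE \<omega> in M.
            rel_compact_family unif_top (zeta (Xi l \<mu> F X qs) \<omega>) \<and>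
            limit_points unif_top (zeta (Xi l \<mu> F X qs) \<omega>) \<subseteq> strassen_sum_set l \<sigma>)"
  by (rule strassen_law_sums) (fact assms)+

end
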